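(* Let $\Gamma$ be a finitely generated group having the rapid decay property (RD) with exponent $C_1$, and let $(\rho_N)$ be a sequence of permutation representations $\rho_N:\Gamma\to S_N$ which converges strongly in distribution to $\lambda$. Let $p\in\mathbb C[\Gamma]$ with $p=p^*$ and let $I_0\subset\mathbb R$ be a compact interval such that conditions (AC) and (R4) hold for $P=\lambda(p)$ on $I_0$. Let $I$ be a closed interval (of positive length) contained in the interior of $I_0$ and, for each $N$, let $(\varphi_\alpha)_{\alpha\in[N]}$ be an orthonormal eigenbasis of $P_N=\rho_N(p)$. Then, for any finite $T\subset\Gamma$ and any sequence of $T$-local matrices $K_N\in M_N(\mathbb C)$ with $\|K_N\|_{1,\infty}\le1$, quantum ergodicity (QE) and quantum mixing (QM) hold in $I$.
   Context: Algebra. $e$ is the unit of $\Gamma$; $|g|$ is the word length of $g\in\Gamma$ for a fixed finite generating set. $\mathbb C[\Gamma]$ is the group algebra of finite sums $p=\sum_g p_g g$, with $p^*=\sum_g\bar p_g g^{-1}$ and $\|p\|_2^2=\sum_g|p_g|^2$. $\lambda$ is the left regular representation on $\ell^2(\Gamma)$, $\lambda(g)\delta_v=\delta_{gv}$. A permutation representation is a homomorphism $\rho_N:\Gamma\to S_N$; $g.x=\rho_N(g)(x)$ for $x\in[N]=\{1,\dots,N\}$, and $\rho_N(g)$ is identified with the matrix $\rho_N(g)(x,y)=\mathbf 1(x=g.y)$. For a representation $\rho$, $\rho(p)=\sum_g p_g\rho(g)$. Sequences $(\rho_N)$ are indexed by an infinite set of integers $N\to\infty$. Scalar products are $\langle f,h\rangle=\sum_x\overline{f(x)}h(x)$.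 $(\rho_N)$ converges in distribution to $\lambda$ if $\frac1N\mathrm{Tr}(\rho_N(g))\to0$ for all $g\in\Gamma\setminus\{e\}$. It converges strongly in distribution to $\lambda$ if in addition, for every $q\in\mathbb C[\Gamma]$, $\lim_{N\to\infty}\|\rho_N(q)_{|1^\perp}\|_{\rm op}=\|\lambda(q)\|_{\rm op}$, where $1\in\mathbb C^N$ is the constant vector. (RD): for some finite generating set $S$ of $\Gamma$ there are $C,C_1>0$ with $\|\lambda(q)\|_{\rm op}\le C(\mathrm{diam}_S(q))^{C_1}\|q\|_2$ for all $q\in\mathbb C[\Gamma]$, where $\mathrm{diam}_S(q)$ is the maximum of $1$ and the diameter of the support of $q$ in the Cayley graph $\mathrm{Cay}(\Gamma,S)$ (vertices $\Gamma$, edges from $g$ to $sg$, $s\in S$). With $R^z=(P-z\,\mathrm{Id})^{-1}$, $\Im R^z=(R^z-(R^z)^* )/(2i)$ and $Q(g,h)=\langle\delta_g,Q\delta_h\rangle$: (AC) on $I_0$: there is $C_0\ge1$ with $C_0^{-1}\le(\Im R^z)(e,e)\le C_0$ for all $z=E+i\eta$, $E\in I_0$, $0<\eta\le1$. (R4) on $I_0$: for some $C_1'>2C_1+1$, $\displaystyle\lim_{\eta\to0}\sup_{\lambda_0\in I_0}\sum_{g\in\Gamma}\eta^2|(\Im R^{\lambda_0+i\eta})(e,g)|^4|g|^{C_1'}=0$. Observables. $\|K\|_{1,\infty}=\max_{x,y}|K(x,y)|$. For finite $T\subset\Gamma$, $K_N\in M_N(\mathbb C)$ is $T$-local if $K_N(x,y)=0$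 unless $x=g.y$ for some $g\in T$. Its average is $\langle K_N\rangle=\rho_N(k_N)$, $k_N=\sum_{g\in T}k_{N,g}\,g$, $k_{N,g}=\frac1N\sum_{x=1}^N K_N(g.x,x)$. Let $\lambda_\alpha$ be the eigenvalue of $\varphi_\alpha$, $\Lambda_J=\{\alpha:\lambda_\alpha\in J\}$ and $J_E^\eta=[E-\eta,E+\eta]$; averages over an empty index set are $0$. (QE) in $I$: $\displaystyle\lim_{N\to\infty}\frac1{|\Lambda_I|}\sum_{\alpha\in\Lambda_I}|\langle\varphi_\alpha,K_N\varphi_\alpha\rangle-\langle\varphi_\alpha,\langle K_N\rangle\varphi_\alpha\rangle|^2=0$. (QM) in $I$: $\displaystyle\lim_{\eta\to0}\limsup_{N\to\infty}\sup_{E_1,E_2}\frac1{|\Lambda_{J_{E_1}^\eta}|}\sum_{\alpha\in\Lambda_{J_{E_1}^\eta}}\sum_{\beta\in\Lambda_{J_{E_2}^\eta}}|\langle\varphi_\beta,K_N\varphi_\alpha\rangle-\langle\varphi_\beta,\langle K_N\rangle\varphi_\alpha\rangle|^2=0$, the supremum being over $E_1,E_2$ in the interior of $I$. *)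

theory Defs
  imports "HOL-Analysis.Analysis" "HOL-Algebra.Generated_Groups" "HOL-Algebra.Sym_Groups"
begin

section \<open>The Hilbert space of square-summable functions on a set\<close>

text \<open>
  Vectors are total functions that vanish outside the index set \<open>X\<close>; \<open>X\<close> is the carrier of a group
  or \<open>{1..N}\<close>. Operators are functions on vectors.
\<close>

definition ell2 :: "'x set \<Rightarrow> ('x \<Rightarrow> complex) set" where
  "ell2 X = {f. (\<forall>x. x \<notin> X \<longrightarrow> f x = 0) \<and> (\<lambda>x. (cmod (f x))\<^sup>2) summable_on X}"

definition ell2_norm :: "'x set \<Rightarrow> ('x \<Rightarrow> complex) \<Rightarrow> real" where
  "ell2_norm X f = sqrt (\<Sum>\<^sub>\<infinity>x\<in>X. (cmod (f x))\<^sup>2)"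

definition ell2_inner :: "'x set \<Rightarrow> ('x \<Rightarrow> complex) \<Rightarrow> ('x \<Rightarrow> complex) \<Rightarrow> complex" where
  "ell2_inner X f h = (\<Sum>\<^sub>\<infinity>x\<in>X. cnj (f x) * h x)"

definition delta :: "'x \<Rightarrow> 'x \<Rightarrow> complex" where
  "delta g = (\<lambda>x. if x = g then 1 else 0)"

text \<open>Operator norm of the restriction of \<open>A\<close> to a subspace \<open>V\<close> of \<open>ell2 X\<close>. The supremum is a real
  one and is only meaningful when \<open>A\<close> is bounded on \<open>V\<close>, as is the case for every operator below.\<close>

definition op_norm_on ::
    "'x set \<Rightarrow> ('x \<Rightarrow> complex) set \<Rightarrow> (('x \<Rightarrow> complex) \<Rightarrow> 'x \<Rightarrow> complex) \<Rightarrow> real" where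
  "op_norm_on X V A = Sup {ell2_norm X (A f) | f. f \<in> V \<and> ell2_norm X f \<le> 1}"

definition op_adjoint ::
    "'x set \<Rightarrow> (('x \<Rightarrow> complex) \<Rightarrow> 'x \<Rightarrow> complex) \<Rightarrow> ('x \<Rightarrow> complex) \<Rightarrow> 'x \<Rightarrow> complex" where
  "op_adjoint X A h =
    (THE u. u \<in> ell2 X \<and> (\<forall>f\<in>ell2 X. ell2_inner X u f = ell2_inner X h (A f)))"

text \<open>\<open>(A - z Id)\<inverse>\<close>; for bounded self-adjoint \<open>A\<close> and non-real \<open>z\<close> the map inverted here is a
  bijection of \<open>ell2 X\<close>.\<close>

definition resolvent ::
    "'x set \<Rightarrow> (('x \<Rightarrow> complex) \<Rightarrow> 'x \<Rightarrow> complex) \<Rightarrow> complex \<Rightarrow> ('x \<Rightarrow> complex) \<Rightarrow> 'x \<Rightarrow> complex" where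
  "resolvent X A z = inv_into (ell2 X) (\<lambda>u x. A u x - z * u x)"

definition op_Im ::
    "'x set \<Rightarrow> (('x \<Rightarrow> complex) \<Rightarrow> 'x \<Rightarrow> complex) \<Rightarrow> ('x \<Rightarrow> complex) \<Rightarrow> 'x \<Rightarrow> complex" where
  "op_Im X A f = (\<lambda>x. (A f x - op_adjoint X A f x) / (2 * \<i>))"

definition op_entry ::
    "'x set \<Rightarrow> (('x \<Rightarrow> complex) \<Rightarrow> 'x \<Rightarrow> complex) \<Rightarrow> 'x \<Rightarrow> 'x \<Rightarrow> complex" where
  "op_entry X Q g h = ell2_inner X (delta g) (Q (delta h))"


section \<open>Word metrics\<close>

definition fin_gen_set :: "('g, 'm) monoid_scheme \<Rightarrow> 'g set \<Rightarrow> bool" where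
  "fin_gen_set G S \<longleftrightarrow> finite S \<and> S \<subseteq> carrier G \<and> generate G S = carrier G"

definition word_length :: "('g, 'm) monoid_scheme \<Rightarrow> 'g set \<Rightarrow> 'g \<Rightarrow> nat" where
  "word_length G S g =
    (LEAST n. \<exists>ws. length ws = n \<and> set ws \<subseteq> S \<union> (\<lambda>s. inv\<^bsub>G\<^esub> s) ` S \<and>
                   foldr (\<lambda>s h. s \<otimes>\<^bsub>G\<^esub> h) ws \<one>\<^bsub>G\<^esub> = g)"

text \<open>Edges are \<open>g \<midarrow> s g\<close>; distances ignore their orientation, since \<open>S\<close> need not be symmetric.\<close>

definition cayley_edges :: "('g, 'm) monoid_scheme \<Rightarrow> 'g set \<Rightarrow> ('g \<times> 'g) set" where
  "cayley_edges G S = {(g, s \<otimes>\<^bsub>G\<^esub> g) | g s. g \<in> carrier G \<and> s \<in> S}"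

definition cayley_dist :: "('g, 'm) monoid_scheme \<Rightarrow> 'g set \<Rightarrow> 'g \<Rightarrow> 'g \<Rightarrow> nat" where
  "cayley_dist G S g h = (LEAST n. (g, h) \<in> (cayley_edges G S \<union> (cayley_edges G S)\<inverse>) ^^ n)"


section \<open>The group algebra, the regular representation and rapid decay\<close>

definition supp :: "('g \<Rightarrow> complex) \<Rightarrow> 'g set" where
  "supp p = {g. p g \<noteq> 0}"

definition group_algebra :: "('g, 'm) monoid_scheme \<Rightarrow> ('g \<Rightarrow> complex) set" where
  "group_algebra G = {p. finite (supp p) \<and> supp p \<subseteq> carrier G}"

definition galg_star :: "('g, 'm) monoid_scheme \<Rightarrow> ('g \<Rightarrow> complex) \<Rightarrow> 'g \<Rightarrow> complex" where
  "galg_star G p = (\<lambda>g. if g \<in> carrier G then cnj (p (inv\<^bsub>G\<^esub> g)) else 0)"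

definition left_reg ::
    "('g, 'm) monoid_scheme \<Rightarrow> 'g \<Rightarrow> ('g \<Rightarrow> complex) \<Rightarrow> 'g \<Rightarrow> complex" where
  "left_reg G g f = (\<lambda>v. if v \<in> carrier G then f (inv\<^bsub>G\<^esub> g \<otimes>\<^bsub>G\<^esub> v) else 0)"

lemma (in group) left_reg_delta:
  assumes "g \<in> carrier G" "v \<in> carrier G"
  shows "left_reg G g (delta v) = delta (g \<otimes> v)"
proof
  fix w
  show "left_reg G g (delta v) w = delta (g \<otimes> v) w"
  proof (cases "w \<in> carrier G")
    case True
    then have "inv g \<otimes> w = v \<longleftrightarrow> w = g \<otimes> v"
      using assms inv_solve_left by metis
    then show ?thesis using True by (simp add: left_reg_def delta_def)
  next
    case False
    then show ?thesis using assms by (auto simp: left_reg_def delta_def)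
  qed
qed

definition left_reg_alg ::
    "('g, 'm) monoid_scheme \<Rightarrow> ('g \<Rightarrow> complex) \<Rightarrow> ('g \<Rightarrow> complex) \<Rightarrow> 'g \<Rightarrow> complex" where
  "left_reg_alg G p f = (\<lambda>v. \<Sum>g\<in>supp p. p g * left_reg G g f v)"

definition galg_diam :: "('g, 'm) monoid_scheme \<Rightarrow> 'g set \<Rightarrow> ('g \<Rightarrow> complex) \<Rightarrow> nat" where
  "galg_diam G S q = Max (insert 1 {cayley_dist G S g h | g h. g \<in> supp q \<and> h \<in> supp q})"

definition rapid_decay :: "('g, 'm) monoid_scheme \<Rightarrow> real \<Rightarrow> bool" where
  "rapid_decay G C\<^sub>1 \<longleftrightarrow> C\<^sub>1 > 0 \<and>
    (\<exists>S. fin_gen_set G S \<and>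
      (\<exists>C>0. \<forall>q\<in>group_algebra G.
         op_norm_on (carrier G) (ell2 (carrier G)) (left_reg_alg G q)
           \<le> C * real (galg_diam G S q) powr C\<^sub>1 * ell2_norm (carrier G) q))"


section \<open>Permutation representations and strong convergence\<close>

text \<open>\<open>N \<times> N\<close> matrices are functions of two indices, of which only the values on \<open>{1..N}\<close> matter.\<close>

definition mat_app :: "nat \<Rightarrow> (nat \<Rightarrow> nat \<Rightarrow> complex) \<Rightarrow> (nat \<Rightarrow> complex) \<Rightarrow> nat \<Rightarrow> complex" where
  "mat_app N M f = (\<lambda>x. if x \<in> {1..N} then \<Sum>y=1..N. M x y * f y else 0)"

definition perm_mat :: "(nat \<Rightarrow> nat) \<Rightarrow> nat \<Rightarrow> nat \<Rightarrow> complex" where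
  "perm_mat \<sigma> x y = (if x = \<sigma> y then 1 else 0)"

definition rep_mat :: "('g \<Rightarrow> nat \<Rightarrow> nat) \<Rightarrow> ('g \<Rightarrow> complex) \<Rightarrow> nat \<Rightarrow> nat \<Rightarrow> complex" where
  "rep_mat r p x y = (\<Sum>g\<in>supp p. p g * perm_mat (r g) x y)"

definition const_perp :: "nat \<Rightarrow> (nat \<Rightarrow> complex) set" where
  "const_perp N = {f \<in> ell2 {1..N}. ell2_inner {1..N} (\<lambda>_. 1) f = 0}"

text \<open>\<open>N \<rightarrow> \<infinity>\<close> along an infinite set of integers.\<close>

abbreviation along :: "nat set \<Rightarrow> nat filter" where
  "along \<N> \<equiv> inf sequentially (principal \<N>)"

definition converges_in_distribution ::
    "('g, 'm) monoid_scheme \<Rightarrow> nat set \<Rightarrow> (nat \<Rightarrow> 'g \<Rightarrow> nat \<Rightarrow> nat) \<Rightarrow> bool" where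
  "converges_in_distribution G \<N> \<rho> \<longleftrightarrow>
    (\<forall>g \<in> carrier G - {\<one>\<^bsub>G\<^esub>}.
      ((\<lambda>N. (\<Sum>x=1..N. perm_mat (\<rho> N g) x x) / of_nat N) \<longlongrightarrow> 0) (along \<N>))"

definition converges_strongly_in_distribution ::
    "('g, 'm) monoid_scheme \<Rightarrow> nat set \<Rightarrow> (nat \<Rightarrow> 'g \<Rightarrow> nat \<Rightarrow> nat) \<Rightarrow> bool" where
  "converges_strongly_in_distribution G \<N> \<rho> \<longleftrightarrow>
    converges_in_distribution G \<N> \<rho> \<and>
    (\<forall>q\<in>group_algebra G.
      ((\<lambda>N. op_norm_on {1..N} (const_perp N) (mat_app N (rep_mat (\<rho> N) q)))
        \<longlongrightarrow> op_norm_on (carrier G) (ell2 (carrier G)) (left_reg_alg G q)) (along \<N>))"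


section \<open>Spectral conditions on \<open>P = \<lambda>(p)\<close>\<close>

definition Im_res_entry ::
    "('g, 'm) monoid_scheme \<Rightarrow> ('g \<Rightarrow> complex) \<Rightarrow> complex \<Rightarrow> 'g \<Rightarrow> 'g \<Rightarrow> complex" where
  "Im_res_entry G p z g h =
    op_entry (carrier G) (op_Im (carrier G) (resolvent (carrier G) (left_reg_alg G p) z)) g h"

text \<open>The diagonal entries of the self-adjoint operator \<open>\<Im> R\<^sup>z\<close> are real; \<open>Re\<close> only changes the type.\<close>

definition cond_AC :: "('g, 'm) monoid_scheme \<Rightarrow> ('g \<Rightarrow> complex) \<Rightarrow> real set \<Rightarrow> bool" where
  "cond_AC G p I\<^sub>0 \<longleftrightarrow>
    (\<exists>C\<^sub>0\<ge>1. \<forall>E\<in>I\<^sub>0. \<forall>\<eta>. 0 < \<eta> \<and> \<eta> \<le> 1 \<longrightarrow>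
       inverse C\<^sub>0 \<le> Re (Im_res_entry G p (Complex E \<eta>) \<one>\<^bsub>G\<^esub> \<one>\<^bsub>G\<^esub>) \<and>
       Re (Im_res_entry G p (Complex E \<eta>) \<one>\<^bsub>G\<^esub> \<one>\<^bsub>G\<^esub>) \<le> C\<^sub>0)"

text \<open>The sum and supremum are taken in \<open>ennreal\<close>, so that a divergent sum is \<open>\<infinity>\<close> and not \<open>0\<close>.
  \<open>S\<close> is the generating set defining the word length.\<close>

definition cond_R4 ::
    "('g, 'm) monoid_scheme \<Rightarrow> 'g set \<Rightarrow> real \<Rightarrow> ('g \<Rightarrow> complex) \<Rightarrow> real set \<Rightarrow> bool" where
  "cond_R4 G S C\<^sub>1 p I\<^sub>0 \<longleftrightarrow>
    (\<exists>C\<^sub>1'. C\<^sub>1' > 2 * C\<^sub>1 + 1 \<and>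
      ((\<lambda>\<eta>. SUP E\<in>I\<^sub>0. \<Sum>\<^sub>\<infinity>g\<in>carrier G.
          ennreal (\<eta>\<^sup>2 * cmod (Im_res_entry G p (Complex E \<eta>) \<one>\<^bsub>G\<^esub> g) ^ 4
                   * real (word_length G S g) powr C\<^sub>1'))
        \<longlongrightarrow> 0) (at_right 0))"


section \<open>Observables, quantum ergodicity and quantum mixing\<close>

definition norm_1_inf :: "nat \<Rightarrow> (nat \<Rightarrow> nat \<Rightarrow> complex) \<Rightarrow> real" where
  "norm_1_inf N K = Max ((\<lambda>(x, y). cmod (K x y)) ` ({1..N} \<times> {1..N}))"

definition is_local ::
    "nat \<Rightarrow> ('g \<Rightarrow> nat \<Rightarrow> nat) \<Rightarrow> 'g set \<Rightarrow> (nat \<Rightarrow> nat \<Rightarrow> complex) \<Rightarrow> bool" where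
  "is_local N r T K \<longleftrightarrow>
    (\<forall>x\<in>{1..N}. \<forall>y\<in>{1..N}. (\<nexists>g. g \<in> T \<and> x = r g y) \<longrightarrow> K x y = 0)"

definition avg_coeff ::
    "nat \<Rightarrow> ('g \<Rightarrow> nat \<Rightarrow> nat) \<Rightarrow> 'g set \<Rightarrow> (nat \<Rightarrow> nat \<Rightarrow> complex) \<Rightarrow> 'g \<Rightarrow> complex" where
  "avg_coeff N r T K g = (if g \<in> T then (1 / of_nat N) * (\<Sum>x=1..N. K (r g x) x) else 0)"

definition average ::
    "nat \<Rightarrow> ('g \<Rightarrow> nat \<Rightarrow> nat) \<Rightarrow> 'g set \<Rightarrow> (nat \<Rightarrow> nat \<Rightarrow> complex) \<Rightarrow> nat \<Rightarrow> nat \<Rightarrow> complex" where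
  "average N r T K = rep_mat r (avg_coeff N r T K)"

text \<open>An orthonormal family of \<open>N\<close> vectors of \<open>\<complex>\<^sup>N\<close> is a basis. The eigenvalues \<open>\<mu>\<close> are determined by
  \<open>\<phi>\<close>, and are real when \<open>M\<close> is Hermitian.\<close>

definition orthonormal_eigenbasis ::
    "nat \<Rightarrow> (nat \<Rightarrow> nat \<Rightarrow> complex) \<Rightarrow> (nat \<Rightarrow> nat \<Rightarrow> complex) \<Rightarrow> (nat \<Rightarrow> real) \<Rightarrow> bool" where
  "orthonormal_eigenbasis N M \<phi> \<mu> \<longleftrightarrow>
    (\<forall>\<alpha>\<in>{1..N}. \<forall>\<beta>\<in>{1..N}.
       ell2_inner {1..N} (\<phi> \<alpha>) (\<phi> \<beta>) = (if \<alpha> = \<beta> then 1 else 0)) \<and>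
    (\<forall>\<alpha>\<in>{1..N}. \<forall>x\<in>{1..N}. mat_app N M (\<phi> \<alpha>) x = of_real (\<mu> \<alpha>) * \<phi> \<alpha> x)"

definition spec_window :: "nat \<Rightarrow> (nat \<Rightarrow> real) \<Rightarrow> real set \<Rightarrow> nat set" where
  "spec_window N \<mu> J = {\<alpha>\<in>{1..N}. \<mu> \<alpha> \<in> J}"

definition mat_elem ::
    "nat \<Rightarrow> (nat \<Rightarrow> complex) \<Rightarrow> (nat \<Rightarrow> nat \<Rightarrow> complex) \<Rightarrow> (nat \<Rightarrow> complex) \<Rightarrow> complex" where
  "mat_elem N f M h = ell2_inner {1..N} f (mat_app N M h)"

definition quantum_ergodicity ::
    "nat set \<Rightarrow> (nat \<Rightarrow> 'g \<Rightarrow> nat \<Rightarrow> nat) \<Rightarrow> (nat \<Rightarrow> nat \<Rightarrow> nat \<Rightarrow> complex) \<Rightarrow> (nat \<Rightarrow> nat \<Rightarrow> real)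
      \<Rightarrow> 'g set \<Rightarrow> (nat \<Rightarrow> nat \<Rightarrow> nat \<Rightarrow> complex) \<Rightarrow> real set \<Rightarrow> bool" where
  "quantum_ergodicity \<N> \<rho> \<phi> \<mu> T K I \<longleftrightarrow>
    ((\<lambda>N. (1 / real (card (spec_window N (\<mu> N) I))) *
        (\<Sum>\<alpha>\<in>spec_window N (\<mu> N) I.
          (cmod (mat_elem N (\<phi> N \<alpha>) (K N) (\<phi> N \<alpha>)
                 - mat_elem N (\<phi> N \<alpha>) (average N (\<rho> N) T (K N)) (\<phi> N \<alpha>)))\<^sup>2))
      \<longlongrightarrow> 0) (along \<N>)"

definition quantum_mixing ::
    "nat set \<Rightarrow> (nat \<Rightarrow> 'g \<Rightarrow> nat \<Rightarrow> nat) \<Rightarrow> (nat \<Rightarrow> nat \<Rightarrow> nat \<Rightarrow> complex) \<Rightarrow> (nat \<Rightarrow> nat \<Rightarrow> real)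
      \<Rightarrow> 'g set \<Rightarrow> (nat \<Rightarrow> nat \<Rightarrow> nat \<Rightarrow> complex) \<Rightarrow> real set \<Rightarrow> bool" where
  "quantum_mixing \<N> \<rho> \<phi> \<mu> T K I \<longleftrightarrow>
    ((\<lambda>\<eta>. Limsup (along \<N>) (\<lambda>N.
        SUP (E\<^sub>1, E\<^sub>2)\<in>interior I \<times> interior I. ennreal (
          (1 / real (card (spec_window N (\<mu> N) {E\<^sub>1 - \<eta>..E\<^sub>1 + \<eta>}))) *
          (\<Sum>\<alpha>\<in>spec_window N (\<mu> N) {E\<^sub>1 - \<eta>..E\<^sub>1 + \<eta>}.
           \<Sum>\<beta>\<in>spec_window N (\<mu> N) {E\<^sub>2 - \<eta>..E\<^sub>2 + \<eta>}.
             (cmod (mat_elem N (\<phi> N \<beta>) (K N) (\<phi> N \<alpha>)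
                    - mat_elem N (\<phi> N \<beta>) (average N (\<rho> N) T (K N)) (\<phi> N \<alpha>)))\<^sup>2))))
      \<longlongrightarrow> 0) (at_right 0)"

end

theory Submission
  imports Defs
begin

text \<open>
  Let \<open>M = K\<^sub>N - \<langle>K\<^sub>N\<rangle>\<close> and, for \<open>z = E + \<i> \<eta>\<close>, let \<open>F(x) = Im (1 / (x - z)) = \<eta> / ((x - E)\<^sup>2 + \<eta>\<^sup>2)\<close>
  be the Poisson kernel. As \<open>F\<close> is at least of order \<open>1 / \<eta>\<close> at distance \<open>O(\<eta>)\<close> from \<open>E\<close>, the sum of
  \<open>|\<langle>\<phi>\<^sub>\<beta>, M \<phi>\<^sub>\<alpha>\<rangle>|\<^sup>2\<close> over two spectral windows of width \<open>\<eta>\<close> is at most \<open>O(\<eta>\<^sup>2)\<close> times the sum over all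
  \<open>\<alpha>, \<beta>\<close> weighted by \<open>F\<^sub>1(\<mu>\<^sub>\<alpha>) F\<^sub>2(\<mu>\<^sub>\<beta>)\<close>, which is the trace of \<open>F\<^sub>2(P\<^sub>N) M F\<^sub>1(P\<^sub>N) M\<^sup>*\<close>.

  The trace is computed in the group. Up to a uniformly small error, \<open>F\<^sub>i\<close> is a polynomial, so that
  \<open>F\<^sub>i(P\<^sub>N)\<close> is \<open>\<rho>\<^sub>N(q\<^sub>i)\<close> with \<open>q\<^sub>i\<close> in the group algebra and close in \<open>\<ell>\<^sup>2\<close> to the vector
  \<open>v\<^sub>i = Im (P - z\<^sub>i)\<^sup>-\<^sup>1 \<delta>\<^sub>e\<close>. Such polynomials are the iterates of a contraction whose fixed point is the
  resolvent (\<open>res_exists\<close>, \<open>res_scalar_converges\<close>). Up to \<open>o(N)\<close> columns, \<open>M = \<Sum>\<^sub>t \<rho>\<^sub>N(t) D\<^sub>t\<close> over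
  \<open>t \<in> T\<close>, where \<open>D\<^sub>t\<close> is diagonal, and its diagonal \<open>m\<^sub>t\<close> is orthogonal to the constants because the average has been
  subtracted. Expanding everything, the terms indexed by group elements \<open>g, h\<close> and \<open>s, t \<in> T\<close> with
  \<open>g t h \<noteq> s\<close> only involve fixed points of a nontrivial element, of which there are \<open>o(N)\<close>. The terms with
  \<open>g t h = s\<close> sum to \<open>\<langle>m\<^sub>s, \<rho>\<^sub>N(w) m\<^sub>t\<rangle>\<close> with \<open>w(k) = q\<^sub>1(k\<inverse>) q\<^sub>2(s k t\<inverse>)\<close>
  (\<open>local_spectral_bound\<close>). Strong convergence applies, as \<open>m\<^sub>t\<close> is orthogonal to the constants, and bounds this
  by \<open>O(N)\<close> times the norm of \<open>w\<close> in the regular representation (\<open>weighted_mixing_limit\<close>).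

  Rapid decay, summed over spheres, bounds that norm by an \<open>\<ell>\<^sup>2\<close> norm with weight
  \<open>(1 + |k|)\<^sup>a\<close> (\<open>weighted_rapid_decay\<close>). As \<open>w\<close> is essentially a product of values of \<open>v\<^sub>1\<close> and \<open>v\<^sub>2\<close>, its
  square is dominated by fourth powers, so (R4) shows that the norm is \<open>o(1 / \<eta>)\<close>
  (\<open>poisson_mixing_small\<close>). Altogether the double sum over two windows is \<open>o(\<eta> N)\<close>. By (AC) a window contains at
  least \<open>c \<eta> N\<close> eigenvalues (\<open>window_count_lower\<close>); dividing yields (QM). Adding up the
  diagonal contributions of \<open>O(1 / \<eta>)\<close> windows that cover the interval yields (QE).
\<close>

section \<open>Square-summable functions\<close>

lemma L2_set_square: "(L2_set f A)\<^sup>2 = (\<Sum>x\<in>A. (f x)\<^sup>2)"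
  by (simp add: L2_set_def sum_nonneg)

lemma ell2_vanish: "f \<in> ell2 X \<Longrightarrow> x \<notin> X \<Longrightarrow> f x = 0"
  by (simp add: ell2_def)

lemma ell2_summable: "f \<in> ell2 X \<Longrightarrow> (\<lambda>x. (cmod (f x))\<^sup>2) summable_on X"
  by (simp add: ell2_def)

lemma ell2_norm_nonneg [simp]: "0 \<le> ell2_norm X f"
  by (simp add: ell2_norm_def infsum_nonneg)

lemma ell2_norm_square: "(ell2_norm X f)\<^sup>2 = (\<Sum>\<^sub>\<infinity>x\<in>X. (cmod (f x))\<^sup>2)"
  by (simp add: ell2_norm_def infsum_nonneg)

lemma L2_set_le_ell2_norm:
  assumes "f \<in> ell2 X" "finite A" "A \<subseteq> X"
  shows "L2_set (\<lambda>x. cmod (f x)) A \<le> ell2_norm X f"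
  unfolding L2_set_def ell2_norm_def
  using finite_sum_le_infsum[OF ell2_summable[OF assms(1)] assms(2,3)] by simp

text \<open>
  Square-summability and the norm are tested on finite sums, where the inequalities for
  \<^const>\<open>L2_set\<close> are available; the closure properties of \<open>ell2\<close> reduce to this.
\<close>

lemma ell2_bounded_finite_sums:
  assumes "\<And>x. x \<notin> X \<Longrightarrow> f x = 0"
    and "\<And>A. finite A \<Longrightarrow> A \<subseteq> X \<Longrightarrow> L2_set (\<lambda>x. cmod (f x)) A \<le> c"
  shows "f \<in> ell2 X" "ell2_norm X f \<le> c"
proof -
  have c0: "0 \<le> c" using assms(2)[of "{}"] by simp
  have le: "(\<Sum>x\<in>A. (cmod (f x))\<^sup>2) \<le> c\<^sup>2" if "finite A" "A \<subseteq> X" for A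
    using power_mono[OF assms(2)[OF that] L2_set_nonneg, of 2] by (simp add: L2_set_square)
  have s: "(\<lambda>x. (cmod (f x))\<^sup>2) summable_on X"
    by (rule nonneg_bdd_above_summable_on) (auto intro!: bdd_aboveI2[where M = "c\<^sup>2"] le)
  then show "f \<in> ell2 X" using assms(1) by (simp add: ell2_def)
  have "(\<Sum>\<^sub>\<infinity>x\<in>X. (cmod (f x))\<^sup>2) \<le> c\<^sup>2"
    by (rule infsum_le_finite_sums[OF s]) (use le in auto)
  then show "ell2_norm X f \<le> c"
    unfolding ell2_norm_def using c0 by (intro real_le_lsqrt infsum_nonneg) auto
qed

lemma ell2_add:
  assumes "f \<in> ell2 X" "h \<in> ell2 X"
  shows "(\<lambda>x. f x + h x) \<in> ell2 X" "ell2_norm X (\<lambda>x. f x + h x) \<le> ell2_norm X f + ell2_norm X h"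
proof -
  have "L2_set (\<lambda>x. cmod (f x + h x)) A \<le> ell2_norm X f + ell2_norm X h"
    if "finite A" "A \<subseteq> X" for A
  proof -
    have "L2_set (\<lambda>x. cmod (f x + h x)) A \<le> L2_set (\<lambda>x. cmod (f x) + cmod (h x)) A"
      by (rule L2_set_mono) (auto simp: norm_triangle_ineq)
    also have "\<dots> \<le> L2_set (\<lambda>x. cmod (f x)) A + L2_set (\<lambda>x. cmod (h x)) A"
      by (rule L2_set_triangle_ineq)
    finally show ?thesis
      using L2_set_le_ell2_norm[OF assms(1) that] L2_set_le_ell2_norm[OF assms(2) that] by simp
  qed
  from ell2_bounded_finite_sums[OF _ this, simplified]
  show "(\<lambda>x. f x + h x) \<in> ell2 X" "ell2_norm X (\<lambda>x. f x + h x) \<le> ell2_norm X f + ell2_norm X h"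
    using assms by (auto simp: ell2_vanish)
qed

lemma ell2_scale:
  assumes "f \<in> ell2 X"
  shows "(\<lambda>x. c * f x) \<in> ell2 X"
    using assms by (auto simp: ell2_def norm_mult power_mult_distrib intro!: summable_on_cmult_right)

lemma ell2_norm_scale: "ell2_norm X (\<lambda>x. c * f x) = cmod c * ell2_norm X f"
proof -
  have "(\<Sum>\<^sub>\<infinity>x\<in>X. (cmod (c * f x))\<^sup>2) = (cmod c)\<^sup>2 * (\<Sum>\<^sub>\<infinity>x\<in>X. (cmod (f x))\<^sup>2)"
    by (simp add: norm_mult power_mult_distrib infsum_cmult_right')
  then show ?thesis by (simp add: ell2_norm_def real_sqrt_mult)
qed

lemma ell2_zero [simp]: "(\<lambda>x. 0) \<in> ell2 X" "ell2_norm X (\<lambda>x. 0) = 0"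
  by (auto simp: ell2_def ell2_norm_def)

lemma ell2_diff:
  assumes "f \<in> ell2 X" "h \<in> ell2 X"
  shows "(\<lambda>x. f x - h x) \<in> ell2 X" "ell2_norm X (\<lambda>x. f x - h x) \<le> ell2_norm X f + ell2_norm X h"
proof -
  have e: "f x + (-1) * h x = f x - h x" for x by simp
  show "(\<lambda>x. f x - h x) \<in> ell2 X" "ell2_norm X (\<lambda>x. f x - h x) \<le> ell2_norm X f + ell2_norm X h"
    using ell2_add[OF assms(1) ell2_scale[OF assms(2), of "-1"]]
    unfolding ell2_norm_scale[of X "-1" h] e by simp_all
qed

lemma ell2_norm_diff_commute: "ell2_norm X (\<lambda>x. f x - h x) = ell2_norm X (\<lambda>x. h x - f x)"
  by (simp add: ell2_norm_def norm_minus_commute)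

lemma ell2_sum:
  assumes "finite A" "\<And>a. a \<in> A \<Longrightarrow> f a \<in> ell2 X"
  shows "(\<lambda>x. \<Sum>a\<in>A. f a x) \<in> ell2 X \<and>
    ell2_norm X (\<lambda>x. \<Sum>a\<in>A. f a x) \<le> (\<Sum>a\<in>A. ell2_norm X (f a))"
  using assms
proof (induction A rule: finite_induct)
  case (insert a A)
  then have "(\<lambda>x. \<Sum>a\<in>A. f a x) \<in> ell2 X \<and>
    ell2_norm X (\<lambda>x. \<Sum>a\<in>A. f a x) \<le> (\<Sum>a\<in>A. ell2_norm X (f a))" by auto
  with insert show ?case
    using ell2_add[of "f a" X "\<lambda>x. \<Sum>a\<in>A. f a x"] by auto
qed auto

lemma cmod_le_ell2_norm:
  assumes "f \<in> ell2 X"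
  shows "cmod (f x) \<le> ell2_norm X f"
proof (cases "x \<in> X")
  case True
  then show ?thesis using L2_set_le_ell2_norm[OF assms, of "{x}"] by simp
next
  case False
  then show ?thesis using ell2_vanish[OF assms] by simp
qed

lemma ell2_norm_eq_0:
  assumes "f \<in> ell2 X" "ell2_norm X f \<le> 0"
  shows "f = (\<lambda>x. 0)"
proof
  fix x
  have "cmod (f x) \<le> 0" using order_trans[OF cmod_le_ell2_norm[OF assms(1)] assms(2)] .
  then show "f x = 0" by simp
qed

lemma ell2_finite_support:
  assumes "finite A" "A \<subseteq> X" "\<And>x. x \<notin> A \<Longrightarrow> f x = 0"
  shows "f \<in> ell2 X" "ell2_norm X f = L2_set (\<lambda>x. cmod (f x)) A"
proof -
  have "(\<lambda>x. (cmod (f x))\<^sup>2) summable_on X"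
    using assms summable_on_cong_neutral[of X A "\<lambda>x. (cmod (f x))\<^sup>2" "\<lambda>x. (cmod (f x))\<^sup>2"]
    by (auto simp: subset_eq)
  then show "f \<in> ell2 X" using assms by (auto simp: ell2_def)
  have "(\<Sum>\<^sub>\<infinity>x\<in>X. (cmod (f x))\<^sup>2) = (\<Sum>\<^sub>\<infinity>x\<in>A. (cmod (f x))\<^sup>2)"
    by (rule infsum_cong_neutral) (use assms in auto)
  then show "ell2_norm X f = L2_set (\<lambda>x. cmod (f x)) A"
    using assms(1) by (simp add: ell2_norm_def L2_set_def)
qed

lemma ell2_delta [simp]: "g \<in> X \<Longrightarrow> delta g \<in> ell2 X" "g \<in> X \<Longrightarrow> ell2_norm X (delta g) = 1"
  using ell2_finite_support[of "{g}" X "delta g"] by (auto simp: delta_def)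

lemma ell2_inner_summable:
  assumes "f \<in> ell2 X" "h \<in> ell2 X"
  shows "(\<lambda>x. norm (cnj (f x) * h x)) summable_on X"
proof (rule summable_on_comparison_test)
  show "(\<lambda>x. (cmod (f x))\<^sup>2 + (cmod (h x))\<^sup>2) summable_on X"
    by (intro summable_on_add ell2_summable assms)
  fix x
  show "norm (cnj (f x) * h x) \<le> (cmod (f x))\<^sup>2 + (cmod (h x))\<^sup>2"
    using sum_squares_bound[of "cmod (f x)" "cmod (h x)"]
    using mult_nonneg_nonneg[OF norm_ge_zero[of "f x"] norm_ge_zero[of "h x"]]
    unfolding norm_mult complex_mod_cnj by linarith
qed auto

lemma ell2_inner_summable': "f \<in> ell2 X \<Longrightarrow> h \<in> ell2 X \<Longrightarrow> (\<lambda>x. cnj (f x) * h x) summable_on X"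
  by (rule abs_summable_summable) (rule ell2_inner_summable)

lemma ell2_inner_add_right:
  assumes "f \<in> ell2 X" "h \<in> ell2 X" "k \<in> ell2 X"
  shows "ell2_inner X f (\<lambda>x. h x + k x) = ell2_inner X f h + ell2_inner X f k"
  unfolding ell2_inner_def
  using infsum_add[OF ell2_inner_summable'[OF assms(1,2)] ell2_inner_summable'[OF assms(1,3)]]
  by (simp add: distrib_left)

lemma ell2_inner_scale_right: "ell2_inner X f (\<lambda>x. c * h x) = c * ell2_inner X f h"
  unfolding ell2_inner_def by (simp add: mult.left_commute infsum_cmult_right')

lemma ell2_inner_commute: "ell2_inner X f h = cnj (ell2_inner X h f)"
  unfolding ell2_inner_def by (simp add: mult.commute flip: infsum_cnj)

lemma ell2_inner_diff_right:
  assumes "f \<in> ell2 X" "h \<in> ell2 X" "k \<in> ell2 X"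
  shows "ell2_inner X f (\<lambda>x. h x - k x) = ell2_inner X f h - ell2_inner X f k"
  using ell2_inner_add_right[OF assms(1,2) ell2_scale[OF assms(3), of "-1"]]
  unfolding ell2_inner_scale_right by simp

lemma ell2_inner_add_left:
  assumes "f \<in> ell2 X" "h \<in> ell2 X" "k \<in> ell2 X"
  shows "ell2_inner X (\<lambda>x. h x + k x) f = ell2_inner X h f + ell2_inner X k f"
  by (subst (1 2 3) ell2_inner_commute) (simp add: ell2_inner_add_right[OF assms])

lemma ell2_inner_diff_left:
  assumes "f \<in> ell2 X" "h \<in> ell2 X" "k \<in> ell2 X"
  shows "ell2_inner X (\<lambda>x. h x - k x) f = ell2_inner X h f - ell2_inner X k f"
  by (subst (1 2 3) ell2_inner_commute) (simp add: ell2_inner_diff_right[OF assms])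

lemma ell2_inner_scale_left: "ell2_inner X (\<lambda>x. c * h x) f = cnj c * ell2_inner X h f"
  by (subst (1 2) ell2_inner_commute) (simp add: ell2_inner_scale_right)

lemma ell2_inner_sum_right:
  assumes "finite A" "f \<in> ell2 X" "\<And>a. a \<in> A \<Longrightarrow> h a \<in> ell2 X"
  shows "ell2_inner X f (\<lambda>x. \<Sum>a\<in>A. h a x) = (\<Sum>a\<in>A. ell2_inner X f (h a))"
  using assms
proof (induction A rule: finite_induct)
  case empty
  then show ?case by (simp add: ell2_inner_def)
next
  case (insert a A)
  then show ?case
    using ell2_inner_add_right[of f X "h a" "\<lambda>x. \<Sum>a\<in>A. h a x"] ell2_sum[of A h X] by auto
qed

lemma ell2_inner_self: "f \<in> ell2 X \<Longrightarrow> ell2_inner X f f = of_real ((ell2_norm X f)\<^sup>2)"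
proof -
  assume "f \<in> ell2 X"
  have "ell2_inner X f f = (\<Sum>\<^sub>\<infinity>x\<in>X. of_real ((cmod (f x))\<^sup>2))"
    unfolding ell2_inner_def
    by (rule infsum_cong) (simp add: complex_norm_square mult.commute flip: of_real_power)
  also have "\<dots> = of_real (\<Sum>\<^sub>\<infinity>x\<in>X. (cmod (f x))\<^sup>2)"
    using has_sum_of_real[OF has_sum_infsum[OF ell2_summable[OF \<open>f \<in> ell2 X\<close>]]]
    by (rule infsumI)
  finally show ?thesis by (simp add: ell2_norm_square)
qed

lemma ell2_cauchy_schwarz:
  assumes "f \<in> ell2 X" "h \<in> ell2 X"
  shows "cmod (ell2_inner X f h) \<le> ell2_norm X f * ell2_norm X h"
proof -
  have "cmod (ell2_inner X f h) \<le> (\<Sum>\<^sub>\<infinity>x\<in>X. norm (cnj (f x) * h x))"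
    unfolding ell2_inner_def by (rule norm_infsum_bound[OF ell2_inner_summable[OF assms]])
  also have "\<dots> \<le> ell2_norm X f * ell2_norm X h"
  proof (rule infsum_le_finite_sums[OF ell2_inner_summable[OF assms]])
    fix A assume A: "finite A" "A \<subseteq> X"
    have "(\<Sum>x\<in>A. norm (cnj (f x) * h x)) = (\<Sum>x\<in>A. \<bar>cmod (f x)\<bar> * \<bar>cmod (h x)\<bar>)"
      by (simp add: norm_mult)
    also have "\<dots> \<le> L2_set (\<lambda>x. cmod (f x)) A * L2_set (\<lambda>x. cmod (h x)) A"
      by (rule L2_set_mult_ineq)
    also have "\<dots> \<le> ell2_norm X f * ell2_norm X h"
      by (intro mult_mono L2_set_le_ell2_norm assms A) auto
    finally show "(\<Sum>x\<in>A. norm (cnj (f x) * h x)) \<le> ell2_norm X f * ell2_norm X h" .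
  qed
  finally show ?thesis .
qed

lemma ell2_inner_delta: "g \<in> X \<Longrightarrow> ell2_inner X (delta g) f = f g"
proof -
  assume "g \<in> X"
  have "ell2_inner X (delta g) f = (\<Sum>\<^sub>\<infinity>x\<in>{g}. f x)"
    unfolding ell2_inner_def
    by (rule infsum_cong_neutral) (use \<open>g \<in> X\<close> in \<open>auto simp: delta_def\<close>)
  then show ?thesis by simp
qed

lemma ell2_norm_add_square:
  assumes "f \<in> ell2 X" "h \<in> ell2 X"
  shows "(ell2_norm X (\<lambda>x. f x + h x))\<^sup>2
    = (ell2_norm X f)\<^sup>2 + 2 * Re (ell2_inner X f h) + (ell2_norm X h)\<^sup>2"
proof -
  have "complex_of_real ((ell2_norm X (\<lambda>x. f x + h x))\<^sup>2)
      = ell2_inner X f f + ell2_inner X f h + (ell2_inner X h f + ell2_inner X h h)"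
    using assms
    by (simp only: ell2_inner_self[symmetric] ell2_add ell2_inner_add_left ell2_inner_add_right)
  also have "\<dots> = of_real ((ell2_norm X f)\<^sup>2 + 2 * Re (ell2_inner X f h) + (ell2_norm X h)\<^sup>2)"
    using ell2_inner_commute[of X h f] assms
    by (simp add: ell2_inner_self complex_eq_iff)
  finally show ?thesis using of_real_eq_iff by blast
qed

text \<open>
  Completeness of \<open>ell2\<close> for geometrically convergent sequences. The limit is taken pointwise, and
  the norm bound passes to the limit because it only involves finite sums.
\<close>

lemma ell2_geometric_limit:
  assumes u: "\<And>n. u n \<in> ell2 X"
    and step: "\<And>n. ell2_norm X (\<lambda>x. u (Suc n) x - u n x) \<le> c * \<theta> ^ n"
    and \<theta>: "0 \<le> \<theta>" "\<theta> < 1"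
  obtains v where "v \<in> ell2 X" "\<And>n. ell2_norm X (\<lambda>x. v x - u n x) \<le> c * \<theta> ^ n / (1 - \<theta>)"
proof -
  have c0: "0 \<le> c" using order_trans[OF ell2_norm_nonneg step[of 0]] by simp
  have d: "(\<lambda>x. u (n + k) x - u n x) \<in> ell2 X \<and>
      ell2_norm X (\<lambda>x. u (n + k) x - u n x) \<le> (\<Sum>j<k. c * \<theta> ^ (n + j))" for n k
  proof (induction k)
    case (Suc k)
    have "(\<lambda>x. u (n + Suc k) x - u n x)
        = (\<lambda>x. (u (n + k) x - u n x) + (u (Suc (n + k)) x - u (n + k) x))" by simp
    then show ?case
      using Suc step[of "n + k"] ell2_add[of "\<lambda>x. u (n + k) x - u n x" X "\<lambda>x. u (Suc (n + k)) x - u (n + k) x"]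
        ell2_diff(1)[OF u u, of "Suc (n+k)" "n+k"]
      by simp
  qed simp
  have le: "ell2_norm X (\<lambda>x. u (n + k) x - u n x) \<le> c * \<theta> ^ n / (1 - \<theta>)" for n k
  proof -
    have "(\<Sum>j<k. c * \<theta> ^ (n + j)) = c * \<theta> ^ n * (\<Sum>j<k. \<theta> ^ j)"
      by (simp add: sum_distrib_left power_add mult.assoc)
    also have "\<dots> = c * \<theta> ^ n * ((1 - \<theta> ^ k) / (1 - \<theta>))"
      using \<theta> by (simp add: sum_gp_strict)
    also have "\<dots> \<le> c * \<theta> ^ n * (1 / (1 - \<theta>))"
      using \<theta> c0 by (intro mult_left_mono divide_right_mono) auto
    finally show ?thesis using d[of n k] by simp
  qed
  have lim0: "(\<lambda>n. c * \<theta> ^ n / (1 - \<theta>)) \<longlonglongrightarrow> 0"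
    using tendsto_mult_right_zero[OF LIMSEQ_power_zero[of \<theta>], of "c / (1 - \<theta>)"] \<theta> by simp
  have cau: "Cauchy (\<lambda>n. u n x)" for x
  proof (rule CauchyI')
    fix e :: real assume "e > 0"
    with lim0 obtain n0 where n0: "\<And>n. n \<ge> n0 \<Longrightarrow> c * \<theta> ^ n / (1 - \<theta>) < e"
      by (metis (no_types, lifting) eventually_sequentially order_tendstoD(2))
    show "\<exists>M. \<forall>m\<ge>M. \<forall>n>m. dist (u m x) (u n x) < e"
    proof (intro exI[of _ n0] allI impI)
      fix m n assume "n0 \<le> m" "m < n"
      then obtain k where k: "n = m + k" using less_imp_add_positive by blast
      have "cmod (u n x - u m x) \<le> c * \<theta> ^ m / (1 - \<theta>)"
        using cmod_le_ell2_norm[of "\<lambda>x. u n x - u m x" X x] d[of m k] le[of m k] k by auto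
      then show "dist (u m x) (u n x) < e"
        using n0[OF \<open>n0 \<le> m\<close>] by (simp add: dist_norm norm_minus_commute)
    qed
  qed
  define v where "v x = lim (\<lambda>n. u n x)" for x
  have v: "(\<lambda>n. u n x) \<longlonglongrightarrow> v x" for x
    using cau[of x] by (simp add: v_def Cauchy_convergent_iff convergent_LIMSEQ_iff)
  have v0: "v x = 0" if "x \<notin> X" for x
    using v[of x] ell2_vanish[OF u that] by (simp add: LIMSEQ_const_iff)
  have b: "L2_set (\<lambda>x. cmod (v x - u n x)) A \<le> c * \<theta> ^ n / (1 - \<theta>)" if A: "finite A" "A \<subseteq> X" for A n
  proof (rule LIMSEQ_le_const2)
    show "(\<lambda>k. L2_set (\<lambda>x. cmod (u (n + k) x - u n x)) A) \<longlonglongrightarrow> L2_set (\<lambda>x. cmod (v x - u n x)) A"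
      unfolding L2_set_def
      by (intro tendsto_intros) (use LIMSEQ_ignore_initial_segment[OF v, where k = n] in \<open>simp add: add.commute\<close>)
    show "\<exists>M. \<forall>k\<ge>M. L2_set (\<lambda>x. cmod (u (n + k) x - u n x)) A \<le> c * \<theta> ^ n / (1 - \<theta>)"
      using L2_set_le_ell2_norm[OF _ A] d le order_trans by meson
  qed
  have w: "(\<lambda>x. v x - u n x) \<in> ell2 X" "ell2_norm X (\<lambda>x. v x - u n x) \<le> c * \<theta> ^ n / (1 - \<theta>)" for n
    using ell2_bounded_finite_sums[of X "\<lambda>x. v x - u n x", OF _ b[of _ n]] v0 ell2_vanish[OF u]
    by auto
  have "v \<in> ell2 X" using ell2_add(1)[OF w(1)[of 0] u[of 0]] by simp
  with w(2) that show ?thesis by blast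
qed

section \<open>The regular representation of the group algebra\<close>

definition l1_norm :: "('g \<Rightarrow> complex) \<Rightarrow> real" where
  "l1_norm q = (\<Sum>g\<in>supp q. cmod (q g))"

lemma l1_norm_nonneg [simp]: "0 \<le> l1_norm q"
  by (simp add: l1_norm_def sum_nonneg)

lemma group_algebraD:
  assumes "q \<in> group_algebra G"
  shows "finite (supp q)" "supp q \<subseteq> carrier G" "x \<in> supp q \<Longrightarrow> x \<in> carrier G"
    "x \<notin> carrier G \<Longrightarrow> q x = 0"
  using assms by (auto simp: group_algebra_def supp_def)

lemma group_algebraI:
  assumes "finite A" "A \<subseteq> carrier G" "\<And>x. x \<notin> A \<Longrightarrow> q x = 0"
  shows "q \<in> group_algebra G"
proof -
  have "supp q \<subseteq> A" using assms(3) by (auto simp: supp_def)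
  with assms(1,2) show ?thesis by (auto simp: group_algebra_def finite_subset)
qed

lemma group_algebra_ell2: "q \<in> group_algebra G \<Longrightarrow> q \<in> ell2 (carrier G)"
  using ell2_finite_support(1)[of "supp q"] by (auto simp: group_algebra_def supp_def)

lemma group_algebra_lincomb:
  assumes "q \<in> group_algebra G" "r \<in> group_algebra G"
  shows "(\<lambda>x. a * q x + b * r x) \<in> group_algebra G"
  by (rule group_algebraI[of "supp q \<union> supp r"])
    (use assms in \<open>auto simp: group_algebra_def supp_def\<close>)

context group
begin

lemma left_reg_ell2:
  assumes "g \<in> carrier G" "f \<in> ell2 (carrier G)"
  shows "left_reg G g f \<in> ell2 (carrier G)"
    "ell2_norm (carrier G) (left_reg G g f) \<le> ell2_norm (carrier G) f"
proof -
  have "L2_set (\<lambda>x. cmod (left_reg G g f x)) A \<le> ell2_norm (carrier G) f"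
    if A: "finite A" "A \<subseteq> carrier G" for A
  proof -
    have inj: "inj_on (\<lambda>v. inv g \<otimes> v) A"
      using assms(1) A(2) by (intro inj_onI) (auto simp: subset_eq)
    have "L2_set (\<lambda>x. cmod (left_reg G g f x)) A = L2_set (\<lambda>x. cmod (f x)) ((\<lambda>v. inv g \<otimes> v) ` A)"
      unfolding L2_set_def using A(2)
      by (simp add: sum.reindex[OF inj] left_reg_def subset_eq cong: sum.cong)
    also have "\<dots> \<le> ell2_norm (carrier G) f"
      by (rule L2_set_le_ell2_norm[OF assms(2)]) (use A assms(1) in auto)
    finally show ?thesis .
  qed
  from ell2_bounded_finite_sums[OF _ this]
  show "left_reg G g f \<in> ell2 (carrier G)"
    "ell2_norm (carrier G) (left_reg G g f) \<le> ell2_norm (carrier G) f"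
    by (auto simp: left_reg_def)
qed

lemma left_reg_alg_ell2:
  assumes "q \<in> group_algebra G" "f \<in> ell2 (carrier G)"
  shows "left_reg_alg G q f \<in> ell2 (carrier G)"
    "ell2_norm (carrier G) (left_reg_alg G q f) \<le> l1_norm q * ell2_norm (carrier G) f"
proof -
  have s: "(\<lambda>x. q g * left_reg G g f x) \<in> ell2 (carrier G)"
      "ell2_norm (carrier G) (\<lambda>x. q g * left_reg G g f x) \<le> cmod (q g) * ell2_norm (carrier G) f"
    if "g \<in> supp q" for g
    using left_reg_ell2[OF group_algebraD(3)[OF assms(1) that] assms(2)]
    by (auto simp: ell2_scale ell2_norm_scale mult_left_mono)
  have t: "(\<lambda>x. \<Sum>g\<in>supp q. q g * left_reg G g f x) \<in> ell2 (carrier G) \<and>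
      ell2_norm (carrier G) (\<lambda>x. \<Sum>g\<in>supp q. q g * left_reg G g f x)
        \<le> (\<Sum>g\<in>supp q. ell2_norm (carrier G) (\<lambda>x. q g * left_reg G g f x))"
    by (rule ell2_sum[OF group_algebraD(1)[OF assms(1)] s(1)])
  then show "left_reg_alg G q f \<in> ell2 (carrier G)"
    unfolding left_reg_alg_def by blast
  have "(\<Sum>g\<in>supp q. ell2_norm (carrier G) (\<lambda>x. q g * left_reg G g f x))
      \<le> (\<Sum>g\<in>supp q. cmod (q g) * ell2_norm (carrier G) f)"
    by (rule sum_mono[OF s(2)])
  with t show "ell2_norm (carrier G) (left_reg_alg G q f) \<le> l1_norm q * ell2_norm (carrier G) f"
    unfolding left_reg_alg_def l1_norm_def sum_distrib_right by linarith
qed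

lemma left_reg_alg_lincomb:
  "left_reg_alg G q (\<lambda>x. a * u x + b * v x) = (\<lambda>x. a * left_reg_alg G q u x + b * left_reg_alg G q v x)"
  by (rule ext) (auto simp: left_reg_alg_def left_reg_def sum_distrib_left algebra_simps
      sum.distrib[symmetric] intro!: sum.cong)

lemma left_reg_alg_diff:
  "left_reg_alg G q (\<lambda>x. u x - v x) = (\<lambda>x. left_reg_alg G q u x - left_reg_alg G q v x)"
  using left_reg_alg_lincomb[of q 1 u "-1" v] by simp

lemma left_reg_alg_group_algebra:
  assumes "q \<in> group_algebra G" "r \<in> group_algebra G"
  shows "left_reg_alg G q r \<in> group_algebra G"
proof (rule group_algebraI)
  show "finite ((\<lambda>(g, h). g \<otimes> h) ` (supp q \<times> supp r))"
    using assms by (auto simp: group_algebra_def)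
  show "(\<lambda>(g, h). g \<otimes> h) ` (supp q \<times> supp r) \<subseteq> carrier G"
    using assms by (auto simp: group_algebra_def)
  fix x assume x: "x \<notin> (\<lambda>(g, h). g \<otimes> h) ` (supp q \<times> supp r)"
  have "left_reg G g r x = 0" if "g \<in> supp q" for g
  proof (cases "x \<in> carrier G")
    case True
    have g: "g \<in> carrier G" using that assms(1) group_algebraD by blast
    have "x = g \<otimes> (inv g \<otimes> x)" using True g by (simp add: m_assoc[symmetric])
    then have "inv g \<otimes> x \<notin> supp r" using x that by force
    then show ?thesis by (simp add: left_reg_def supp_def)
  qed (simp add: left_reg_def)
  then show "left_reg_alg G q r x = 0" by (simp add: left_reg_alg_def)
qed

lemma ell2_inner_left_reg:
  assumes "g \<in> carrier G"
  shows "ell2_inner (carrier G) u (left_reg G g v) = ell2_inner (carrier G) (left_reg G (inv g) u) v"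
proof -
  have bij: "bij_betw (\<lambda>x. g \<otimes> x) (carrier G) (carrier G)"
    by (rule bij_betw_byWitness[where f' = "\<lambda>x. inv g \<otimes> x"])
      (use assms in \<open>auto simp: m_assoc[symmetric]\<close>)
  have "ell2_inner (carrier G) u (left_reg G g v)
      = (\<Sum>\<^sub>\<infinity>x\<in>carrier G. cnj (u (g \<otimes> x)) * left_reg G g v (g \<otimes> x))"
    unfolding ell2_inner_def
    by (rule infsum_reindex_bij_betw[OF bij, of "\<lambda>x. cnj (u x) * left_reg G g v x", symmetric])
  also have "\<dots> = ell2_inner (carrier G) (left_reg G (inv g) u) v"
    unfolding ell2_inner_def
    by (rule infsum_cong) (use assms in \<open>simp add: left_reg_def m_assoc[symmetric]\<close>)
  finally show ?thesis .
qed

lemma self_adjoint_coeff: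
  assumes "p = galg_star G p" "g \<in> carrier G"
  shows "p (inv g) = cnj (p g)"
proof -
  have "p (inv g) = galg_star G p (inv g)" using assms(1) by simp
  then show ?thesis using assms(2) by (simp add: galg_star_def)
qed

text \<open>
  Translation by \<open>g\<close> and by \<open>g\<inverse>\<close> are adjoint to each other, and \<open>p = p\<^sup>*\<close> exchanges their
  coefficients.
\<close>

lemma left_reg_alg_symmetric:
  assumes p: "p \<in> group_algebra G" "p = galg_star G p"
    and u: "u \<in> ell2 (carrier G)" and v: "v \<in> ell2 (carrier G)"
  shows "ell2_inner (carrier G) u (left_reg_alg G p v) = ell2_inner (carrier G) (left_reg_alg G p u) v"
proof -
  let ?X = "carrier G"
  have S: "finite (supp p)" "\<And>g. g \<in> supp p \<Longrightarrow> g \<in> ?X" using group_algebraD[OF p(1)] by auto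
  have exp: "ell2_inner ?X a (left_reg_alg G p b) = (\<Sum>g\<in>supp p. p g * ell2_inner ?X a (left_reg G g b))"
    if "a \<in> ell2 ?X" "b \<in> ell2 ?X" for a b
    unfolding left_reg_alg_def
    using ell2_inner_sum_right[OF S(1) that(1), of "\<lambda>g x. p g * left_reg G g b x"]
    by (simp add: ell2_scale left_reg_ell2(1)[OF S(2) that(2)] ell2_inner_scale_right)
  have bij: "bij_betw (\<lambda>g. inv g) (supp p) (supp p)"
    by (rule bij_betw_byWitness[where f' = "\<lambda>g. inv g"])
      (use S(2) self_adjoint_coeff[OF p(2)] in \<open>auto simp: supp_def\<close>)
  have "ell2_inner ?X (left_reg_alg G p u) v = cnj (ell2_inner ?X v (left_reg_alg G p u))"
    by (rule ell2_inner_commute)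
  also have "\<dots> = (\<Sum>g\<in>supp p. p (inv g) * cnj (ell2_inner ?X v (left_reg G g u)))"
    unfolding exp[OF v u] using self_adjoint_coeff[OF p(2) S(2)] by (simp add: cnj_sum)
  also have "\<dots> = (\<Sum>g\<in>supp p. p (inv g) * ell2_inner ?X u (left_reg G (inv g) v))"
  proof (rule sum.cong[OF refl])
    fix g assume "g \<in> supp p"
    then have g: "g \<in> ?X" by (rule S(2))
    have "cnj (ell2_inner ?X v (left_reg G g u)) = ell2_inner ?X u (left_reg G (inv g) v)"
      by (subst ell2_inner_left_reg[OF g]) (rule ell2_inner_commute[symmetric])
    then show "p (inv g) * cnj (ell2_inner ?X v (left_reg G g u))
        = p (inv g) * ell2_inner ?X u (left_reg G (inv g) v)" by simp
  qed
  also have "\<dots> = (\<Sum>g\<in>supp p. p g * ell2_inner ?X u (left_reg G g v))"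
    by (rule sum.reindex_bij_betw[OF bij, of "\<lambda>g. p g * ell2_inner ?X u (left_reg G g v)"])
  finally show ?thesis unfolding exp[OF u v] by simp
qed

end

section \<open>The resolvent as the limit of polynomials\<close>

text \<open>
  The equation \<open>(P - z) u = f\<close> is solved by iterating \<open>u \<mapsto> u - m ((P - z) u - f)\<close> with
  \<open>m = \<i> \<kappa>\<close>, \<open>\<kappa> = Im z / M\<^sup>2\<close>, where \<open>M = l1_norm p + |z|\<close> bounds the norm of \<open>P - z\<close>.
  For real \<open>x\<close> with \<open>|x - z| \<le> M\<close>,
  \<open>|1 - m (x - z)|\<^sup>2 = 1 - 2 \<kappa> Im z + \<kappa>\<^sup>2 |x - z|\<^sup>2 \<le> 1 - (Im z)\<^sup>2 / M\<^sup>2\<close>,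
  and this value of \<open>\<kappa>\<close> minimises the bound. Started at \<open>0\<close> with \<open>f = \<delta>\<^sub>e\<close>, the iterates are polynomials in
  \<open>P\<close> applied to \<open>\<delta>\<^sub>e\<close>, hence elements of the group algebra; the same recursion for numbers yields
  polynomials that converge to \<open>1 / (x - z)\<close> uniformly on the interval that contains all spectra.
\<close>

definition res_bound :: "('g \<Rightarrow> complex) \<Rightarrow> complex \<Rightarrow> real" where
  "res_bound p z = l1_norm p + cmod z"

definition res_rate :: "('g \<Rightarrow> complex) \<Rightarrow> complex \<Rightarrow> real" where
  "res_rate p z = sqrt (1 - (Im z)\<^sup>2 / (res_bound p z)\<^sup>2)"

definition res_mult :: "('g \<Rightarrow> complex) \<Rightarrow> complex \<Rightarrow> complex" where
  "res_mult p z = \<i> * of_real (Im z / (res_bound p z)\<^sup>2)"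

primrec res_iter ::
    "('g, 'm) monoid_scheme \<Rightarrow> ('g \<Rightarrow> complex) \<Rightarrow> complex \<Rightarrow> ('g \<Rightarrow> complex) \<Rightarrow> nat \<Rightarrow> 'g \<Rightarrow> complex" where
  "res_iter G p z f 0 = (\<lambda>x. 0)"
| "res_iter G p z f (Suc n) = (\<lambda>x. res_iter G p z f n x
     - res_mult p z * (left_reg_alg G p (res_iter G p z f n) x - z * res_iter G p z f n x - f x))"

primrec res_scalar :: "('g \<Rightarrow> complex) \<Rightarrow> complex \<Rightarrow> nat \<Rightarrow> real \<Rightarrow> complex" where
  "res_scalar p z 0 = (\<lambda>x. 0)"
| "res_scalar p z (Suc n) = (\<lambda>x. res_scalar p z n x
     - res_mult p z * (of_real x * res_scalar p z n x - z * res_scalar p z n x - 1))"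

lemma res_bound_pos:
  assumes "Im z \<noteq> 0" shows "0 < res_bound p z" "\<bar>Im z\<bar> \<le> res_bound p z"
proof -
  have "0 < cmod z" using assms by auto
  then show "0 < res_bound p z" by (simp add: res_bound_def add_nonneg_pos)
  show "\<bar>Im z\<bar> \<le> res_bound p z"
    using abs_Im_le_cmod[of z] by (simp add: res_bound_def add_increasing)
qed

lemma res_rate_bounds:
  assumes "Im z \<noteq> 0"
  shows "0 \<le> res_rate p z" "res_rate p z < 1" "(res_rate p z)\<^sup>2 = 1 - (Im z)\<^sup>2 / (res_bound p z)\<^sup>2"
proof -
  have "(Im z)\<^sup>2 \<le> (res_bound p z)\<^sup>2"
    using power_mono[OF res_bound_pos(2)[OF assms, of p] abs_ge_zero, of 2] by simp
  then have le: "(Im z)\<^sup>2 / (res_bound p z)\<^sup>2 \<le> 1"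
    using res_bound_pos(1)[OF assms, of p] by simp
  have pos: "0 < (Im z)\<^sup>2 / (res_bound p z)\<^sup>2"
    using res_bound_pos(1)[OF assms, of p] assms by simp
  show "0 \<le> res_rate p z" "res_rate p z < 1" "(res_rate p z)\<^sup>2 = 1 - (Im z)\<^sup>2 / (res_bound p z)\<^sup>2"
    using le pos by (simp_all add: res_rate_def)
qed

lemma res_scalar_converges:
  assumes z: "Im z \<noteq> 0" and x: "\<bar>x\<bar> \<le> l1_norm p"
  shows "cmod (1 / (of_real x - z) - res_scalar p z n x) \<le> res_rate p z ^ n / \<bar>Im z\<bar>"
proof -
  let ?M = "res_bound p z" and ?y = "Im z"
  define k where "k = ?y / ?M\<^sup>2"
  define w where "w = of_real x - z"
  have w: "Im w = - ?y" "w \<noteq> 0" using z by (auto simp: w_def complex_eq_iff)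
  have wM: "cmod w \<le> ?M"
    using norm_triangle_ineq4[of "of_real x" z] x by (simp add: w_def res_bound_def)
  have wy: "\<bar>?y\<bar> \<le> cmod w" using abs_Im_le_cmod[of w] w(1) by simp
  have M: "0 < ?M" by (rule res_bound_pos(1)[OF z])
  have "(cmod (1 - res_mult p z * w))\<^sup>2 = (1 - k * ?y)\<^sup>2 + (k * Re w)\<^sup>2"
    using w(1) by (simp add: cmod_power2 res_mult_def k_def)
  also have "\<dots> = 1 - 2 * k * ?y + k\<^sup>2 * (cmod w)\<^sup>2"
    using w(1) by (simp only: cmod_power2) (simp add: power2_eq_square algebra_simps)
  also have "\<dots> \<le> 1 - 2 * k * ?y + k\<^sup>2 * ?M\<^sup>2"
    using wM by (simp add: mult_left_mono power_mono)
  also have "\<dots> = (res_rate p z)\<^sup>2"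
    unfolding res_rate_bounds(3)[OF z] k_def using M by (simp add: field_simps power2_eq_square)
  finally have c: "cmod (1 - res_mult p z * w) \<le> res_rate p z"
    using res_rate_bounds(1)[OF z] power2_le_imp_le by blast
  show ?thesis
  proof (induction n)
    case 0
    have "1 / cmod w \<le> 1 / \<bar>?y\<bar>" using wy z by (simp add: frac_le)
    then show ?case by (simp add: norm_divide w_def)
  next
    case (Suc n)
    have "1 / w - res_scalar p z (Suc n) x = (1 - res_mult p z * w) * (1 / w - res_scalar p z n x)"
      using w(2) by (simp add: w_def field_simps)
    then have "cmod (1 / w - res_scalar p z (Suc n) x)
        = cmod (1 - res_mult p z * w) * cmod (1 / w - res_scalar p z n x)"
      by (simp only: norm_mult)
    also have "\<dots> \<le> res_rate p z * (res_rate p z ^ n / \<bar>?y\<bar>)"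
      using Suc c res_rate_bounds(1)[OF z] unfolding w_def[symmetric] by (intro mult_mono) auto
    finally show ?case unfolding w_def by simp
  qed
qed

locale regular_operator = group G for G (structure) +
  fixes p :: "'a \<Rightarrow> complex"
  assumes p_alg: "p \<in> group_algebra G" and p_star: "p = galg_star G p"
begin

abbreviation "X \<equiv> carrier G"
abbreviation "P \<equiv> left_reg_alg G p"

lemma P_ell2: "u \<in> ell2 X \<Longrightarrow> P u \<in> ell2 X"
  by (rule left_reg_alg_ell2(1)[OF p_alg])

lemma res_shift_ell2: "u \<in> ell2 X \<Longrightarrow> (\<lambda>x. P u x - z * u x) \<in> ell2 X"
  by (intro ell2_diff(1) P_ell2 ell2_scale)

text \<open>
  The computation for numbers carries over to \<open>P\<close>, since \<open>\<langle>u, P u\<rangle>\<close> is real.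
\<close>

lemma res_contraction:
  assumes z: "Im z \<noteq> 0" and u: "u \<in> ell2 X"
  shows "ell2_norm X (\<lambda>x. u x - res_mult p z * (P u x - z * u x)) \<le> res_rate p z * ell2_norm X u"
proof -
  let ?M = "res_bound p z" and ?y = "Im z"
  define k where "k = ?y / ?M\<^sup>2"
  define w where "w = (\<lambda>x. P u x - z * u x)"
  have M: "0 < ?M" by (rule res_bound_pos(1)[OF z])
  have w: "w \<in> ell2 X" unfolding w_def by (rule res_shift_ell2[OF u])
  have wM: "ell2_norm X w \<le> ?M * ell2_norm X u"
    using ell2_diff(2)[OF P_ell2[OF u] ell2_scale[OF u, of z]] left_reg_alg_ell2(2)[OF p_alg u]
    unfolding ell2_norm_scale w_def res_bound_def by (simp add: algebra_simps)
  have "ell2_inner X u (P u) = cnj (ell2_inner X u (P u))"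
    by (subst (2) ell2_inner_commute) (simp add: left_reg_alg_symmetric[OF p_alg p_star u u])
  then have im: "Im (ell2_inner X u (P u)) = 0"
    by (simp add: complex_eq_iff)
  have uw: "ell2_inner X u w = ell2_inner X u (P u) - z * of_real ((ell2_norm X u)\<^sup>2)"
    unfolding w_def using u
    by (simp only: ell2_inner_diff_right[OF u P_ell2[OF u] ell2_scale[OF u]] ell2_inner_scale_right ell2_inner_self)
  have re: "Re (ell2_inner X u (\<lambda>x. - res_mult p z * w x)) = - (k * ?y) * (ell2_norm X u)\<^sup>2"
    unfolding ell2_inner_scale_right uw res_mult_def k_def[symmetric] using im by simp
  have "(ell2_norm X (\<lambda>x. u x + (- res_mult p z) * w x))\<^sup>2
      = (ell2_norm X u)\<^sup>2 + 2 * (- (k * ?y) * (ell2_norm X u)\<^sup>2) + k\<^sup>2 * (ell2_norm X w)\<^sup>2"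
    unfolding ell2_norm_add_square[OF u ell2_scale[OF w]] re ell2_norm_scale
    by (simp add: res_mult_def k_def norm_mult norm_divide norm_power power_mult_distrib power_divide)
  also have "\<dots> \<le> (ell2_norm X u)\<^sup>2 + 2 * (- (k * ?y) * (ell2_norm X u)\<^sup>2) + k\<^sup>2 * (?M * ell2_norm X u)\<^sup>2"
    using wM by (simp add: mult_left_mono power_mono)
  also have "\<dots> = (1 - 2 * k * ?y + k\<^sup>2 * ?M\<^sup>2) * (ell2_norm X u)\<^sup>2"
    by (simp add: algebra_simps power_mult_distrib)
  also have "1 - 2 * k * ?y + k\<^sup>2 * ?M\<^sup>2 = (res_rate p z)\<^sup>2"
    unfolding res_rate_bounds(3)[OF z] k_def using M by (simp add: field_simps power2_eq_square)
  finally have "(ell2_norm X (\<lambda>x. u x + (- res_mult p z) * w x))\<^sup>2 \<le> (res_rate p z * ell2_norm X u)\<^sup>2"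
    by (simp add: power_mult_distrib)
  then have "ell2_norm X (\<lambda>x. u x + (- res_mult p z) * w x) \<le> res_rate p z * ell2_norm X u"
    using res_rate_bounds(1)[OF z] power2_le_imp_le ell2_norm_nonneg mult_nonneg_nonneg by blast
  then show ?thesis by (simp add: w_def)
qed

lemma res_unique:
  assumes z: "Im z \<noteq> 0" and u: "u \<in> ell2 X" "v \<in> ell2 X"
    and eq: "(\<lambda>x. P u x - z * u x) = (\<lambda>x. P v x - z * v x)"
  shows "u = v"
proof -
  define w where "w = (\<lambda>x. u x - v x)"
  have w: "w \<in> ell2 X" unfolding w_def by (rule ell2_diff(1)[OF u])
  have "P w x - z * w x = 0" for x
    using fun_cong[OF eq, of x] unfolding w_def left_reg_alg_diff by (simp add: algebra_simps)
  then have "ell2_norm X w \<le> res_rate p z * ell2_norm X w"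
    using res_contraction[OF z w] by simp
  then have "(1 - res_rate p z) * ell2_norm X w \<le> 0" by (simp add: algebra_simps)
  then have "ell2_norm X w \<le> 0"
    using res_rate_bounds(2)[OF z, of p] by (simp add: mult_le_0_iff)
  then have "w = (\<lambda>x. 0)" by (rule ell2_norm_eq_0[OF w])
  then show ?thesis unfolding w_def by (metis eq_iff_diff_eq_0 ext)
qed

lemma res_iter_ell2:
  assumes "f \<in> ell2 X" shows "res_iter G p z f n \<in> ell2 X"
proof (induction n)
  case (Suc n)
  then show ?case
    using ell2_diff(1)[OF Suc ell2_scale[OF ell2_diff(1)[OF res_shift_ell2[OF Suc] assms]]] by simp
qed simp

text \<open>
  The step sizes of the iteration decay geometrically, and the limit is a fixed point.
\<close>

lemma res_exists:
  assumes z: "Im z \<noteq> 0" and f: "f \<in> ell2 X"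
  obtains u c where "u \<in> ell2 X" "(\<lambda>x. P u x - z * u x) = f"
    "\<And>n. ell2_norm X (\<lambda>x. u x - res_iter G p z f n x) \<le> c * res_rate p z ^ n"
proof -
  let ?u = "res_iter G p z f" and ?th = "res_rate p z" and ?m = "res_mult p z"
  note th = res_rate_bounds(1,2)[OF z, of p]
  \<comment> \<open>the iteration map is affine, so it maps differences by the linear contraction\<close>
  have diff: "(\<lambda>x. v x - ?m * (P v x - z * v x - f x) - ?u (Suc n) x)
      = (\<lambda>x. (v x - ?u n x) - ?m * (P (\<lambda>x. v x - ?u n x) x - z * (v x - ?u n x)))" for v n
    unfolding left_reg_alg_diff by (auto simp: algebra_simps)
  define c where "c = ell2_norm X (\<lambda>x. ?u 1 x - ?u 0 x)"
  have step: "ell2_norm X (\<lambda>x. ?u (Suc n) x - ?u n x) \<le> c * ?th ^ n" for n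
  proof (induction n)
    case (Suc n)
    have "ell2_norm X (\<lambda>x. ?u (Suc (Suc n)) x - ?u (Suc n) x)
        \<le> ?th * ell2_norm X (\<lambda>x. ?u (Suc n) x - ?u n x)"
      using res_contraction[OF z ell2_diff(1)[OF res_iter_ell2[OF f, of z "Suc n"] res_iter_ell2[OF f, of z n]]]
        diff[of "?u (Suc n)" n] by (simp only: res_iter.simps(2)[of G p z f "Suc n"])
    also have "\<dots> \<le> ?th * (c * ?th ^ n)" using Suc th by (intro mult_left_mono)
    finally show ?case by (simp add: mult_ac)
  qed (simp add: c_def)
  from ell2_geometric_limit[of ?u X c ?th, OF res_iter_ell2[OF f] step th]
  obtain v where v: "v \<in> ell2 X" "\<And>n. ell2_norm X (\<lambda>x. v x - ?u n x) \<le> c * ?th ^ n / (1 - ?th)"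
    by blast
  define w where "w = (\<lambda>x. v x - ?m * (P v x - z * v x - f x))"
  have w: "w \<in> ell2 X" unfolding w_def
    by (intro ell2_diff(1) ell2_scale res_shift_ell2 v f)
  have le: "ell2_norm X (\<lambda>x. w x - v x) \<le> 2 * (c * ?th ^ n / (1 - ?th))" for n
  proof -
    have "(\<lambda>x. w x - v x) = (\<lambda>x. (w x - ?u (Suc n) x) + (?u (Suc n) x - v x))" by simp
    then have "ell2_norm X (\<lambda>x. w x - v x)
        \<le> ell2_norm X (\<lambda>x. w x - ?u (Suc n) x) + ell2_norm X (\<lambda>x. ?u (Suc n) x - v x)"
      using ell2_add(2)[OF ell2_diff(1)[OF w res_iter_ell2[OF f, of z "Suc n"]]
          ell2_diff(1)[OF res_iter_ell2[OF f, of z "Suc n"] v(1)]] by simp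
    also have "ell2_norm X (\<lambda>x. w x - ?u (Suc n) x) \<le> ?th * ell2_norm X (\<lambda>x. v x - ?u n x)"
      unfolding w_def diff by (rule res_contraction[OF z ell2_diff(1)[OF v(1) res_iter_ell2[OF f]]])
    also have "\<dots> \<le> 1 * ell2_norm X (\<lambda>x. v x - ?u n x)"
      using th by (intro mult_right_mono) auto
    finally have 1: "ell2_norm X (\<lambda>x. w x - v x)
        \<le> ell2_norm X (\<lambda>x. v x - ?u n x) + ell2_norm X (\<lambda>x. ?u (Suc n) x - v x)" by simp
    have "ell2_norm X (\<lambda>x. ?u (Suc n) x - v x) \<le> c * ?th ^ Suc n / (1 - ?th)"
      using v(2)[of "Suc n"] by (subst ell2_norm_diff_commute)
    also have "\<dots> \<le> c * ?th ^ n / (1 - ?th)"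
      using th by (intro divide_right_mono mult_left_mono power_decreasing) (auto simp: c_def)
    finally show ?thesis
      unfolding mult_2 using 1 v(2)[of n] by (meson add_mono order_trans)
  qed
  have eq: "2 * (c * ?th ^ n / (1 - ?th)) = 2 * c / (1 - ?th) * ?th ^ n" for n by simp
  have "(\<lambda>n. 2 * (c * ?th ^ n / (1 - ?th))) \<longlonglongrightarrow> 0"
    unfolding eq by (rule tendsto_mult_right_zero[OF LIMSEQ_power_zero]) (use th in simp)
  then have "ell2_norm X (\<lambda>x. w x - v x) \<le> 0"
    by (rule LIMSEQ_le_const) (use le in auto)
  then have "(\<lambda>x. w x - v x) = (\<lambda>x. 0)" by (rule ell2_norm_eq_0[OF ell2_diff(1)[OF w v(1)]])
  then have "?m * (P v x - z * v x - f x) = 0" for x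
    using fun_cong[of "\<lambda>x. w x - v x" "\<lambda>x. 0" x] by (simp add: w_def)
  moreover have "?m \<noteq> 0" using z res_bound_pos(1)[OF z, of p] by (simp add: res_mult_def)
  ultimately have "(\<lambda>x. P v x - z * v x) = f" by auto
  with v that[of v "c / (1 - ?th)"] show ?thesis by (simp add: mult.commute)
qed

lemma resolvent_eqI:
  assumes "Im z \<noteq> 0" "u \<in> ell2 X" "(\<lambda>x. P u x - z * u x) = f"
  shows "resolvent X P z f = u"
  unfolding resolvent_def
  by (rule inv_into_f_eq) (use assms res_unique[OF assms(1)] in \<open>auto simp: inj_on_def\<close>)

lemma resolvent_ell2:
  assumes "Im z \<noteq> 0" "f \<in> ell2 X"
  shows "resolvent X P z f \<in> ell2 X" "(\<lambda>x. P (resolvent X P z f) x - z * resolvent X P z f x) = f"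
proof -
  obtain u where u: "u \<in> ell2 X" "(\<lambda>x. P u x - z * u x) = f"
    using res_exists[OF assms] by metis
  then show "resolvent X P z f \<in> ell2 X" "(\<lambda>x. P (resolvent X P z f) x - z * resolvent X P z f x) = f"
    using resolvent_eqI[OF assms(1) u] by auto
qed

lemma resolvent_adjoint:
  assumes z: "Im z \<noteq> 0" and f: "f \<in> ell2 X" and h: "h \<in> ell2 X"
  shows "ell2_inner X (resolvent X P (cnj z) h) f = ell2_inner X h (resolvent X P z f)"
proof -
  have z': "Im (cnj z) \<noteq> 0" using z by simp
  let ?a = "resolvent X P (cnj z) h" and ?b = "resolvent X P z f"
  note a = resolvent_ell2[OF z' h] and b = resolvent_ell2[OF z f]
  have "ell2_inner X ?a f = ell2_inner X ?a (P ?b) - z * ell2_inner X ?a ?b"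
    by (subst b(2)[symmetric])
      (simp only: ell2_inner_diff_right[OF a(1) P_ell2[OF b(1)] ell2_scale[OF b(1)]] ell2_inner_scale_right)
  also have "\<dots> = ell2_inner X (P ?a) ?b - cnj (cnj z) * ell2_inner X ?a ?b"
    by (simp add: left_reg_alg_symmetric[OF p_alg p_star a(1) b(1)])
  also have "\<dots> = ell2_inner X h ?b"
    by (subst (3) a(2)[symmetric])
      (simp only: ell2_inner_diff_left[OF b(1) P_ell2[OF a(1)] ell2_scale[OF a(1)]] ell2_inner_scale_left)
  finally show ?thesis .
qed

lemma op_adjoint_resolvent:
  assumes z: "Im z \<noteq> 0" and h: "h \<in> ell2 X"
  shows "op_adjoint X (resolvent X P z) h = resolvent X P (cnj z) h"
  unfolding op_adjoint_def
proof (rule the_equality, intro conjI ballI)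
  have z': "Im (cnj z) \<noteq> 0" using z by simp
  let ?a = "resolvent X P (cnj z) h"
  show a: "?a \<in> ell2 X" by (rule resolvent_ell2(1)[OF z' h])
  show "ell2_inner X ?a f = ell2_inner X h (resolvent X P z f)" if "f \<in> ell2 X" for f
    by (rule resolvent_adjoint[OF z that h])
  fix u assume u: "u \<in> ell2 X \<and> (\<forall>f\<in>ell2 X. ell2_inner X u f = ell2_inner X h (resolvent X P z f))"
  have "u x = ?a x" for x
  proof (cases "x \<in> X")
    case True
    then have "ell2_inner X u (delta x) = ell2_inner X ?a (delta x)"
      using u resolvent_adjoint[OF z _ h, of "delta x"] by simp
    then have "ell2_inner X (delta x) u = ell2_inner X (delta x) ?a"
      by (subst (1 2) ell2_inner_commute) simp
    then show ?thesis using True by (simp add: ell2_inner_delta)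
  next
    case False
    then show ?thesis using u a ell2_vanish by metis
  qed
  then show "u = ?a" by blast
qed

text \<open>
  The vector \<open>Im (P - z)\<^sup>-\<^sup>1 \<delta>\<^sub>e\<close>. Working with this single vector of \<open>ell2\<close> instead of the operator
  \<open>Im (P - z)\<^sup>-\<^sup>1\<close> is possible since only the matrix entries in the row of the unit enter (AC) and (R4).
\<close>

definition green :: "complex \<Rightarrow> 'a \<Rightarrow> complex" where
  "green z g = (resolvent X P z (delta \<one>) g - resolvent X P (cnj z) (delta \<one>) g) / (2 * \<i>)"

lemma Im_res_entry_green:
  assumes z: "Im z \<noteq> 0" and g: "g \<in> X"
  shows "Im_res_entry G p z \<one> g = cnj (green z g)"
proof -
  have e: "resolvent X P w (delta g) \<one> = cnj (resolvent X P (cnj w) (delta \<one>) g)" if "Im w \<noteq> 0" for w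
  proof -
    have "resolvent X P w (delta g) \<one> = ell2_inner X (delta \<one>) (resolvent X P w (delta g))"
      by (simp add: ell2_inner_delta)
    also have "\<dots> = ell2_inner X (resolvent X P (cnj w) (delta \<one>)) (delta g)"
      by (rule resolvent_adjoint[OF that, symmetric]) (use g in auto)
    also have "\<dots> = cnj (resolvent X P (cnj w) (delta \<one>) g)"
      by (subst ell2_inner_commute) (simp add: ell2_inner_delta g)
    finally show ?thesis .
  qed
  have "Im_res_entry G p z \<one> g
      = (resolvent X P z (delta g) \<one> - resolvent X P (cnj z) (delta g) \<one>) / (2 * \<i>)"
    unfolding Im_res_entry_def op_entry_def op_Im_def
    by (simp add: ell2_inner_delta op_adjoint_resolvent[OF z] g)
  also have "\<dots> = cnj (green z g)"
    using z by (simp add: e green_def field_simps)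
  finally show ?thesis .
qed

end

section \<open>Operator norms\<close>

text \<open>
  A real supremum is an upper bound only for a set that is bounded above, so every use of
  \<^const>\<open>op_norm_on\<close> needs some bound \<open>B\<close>, however crude.
\<close>

lemma op_norm_on_upper:
  assumes "\<And>f. f \<in> V \<Longrightarrow> ell2_norm X f \<le> 1 \<Longrightarrow> ell2_norm X (A f) \<le> B"
    and "f \<in> V" "ell2_norm X f \<le> 1"
  shows "ell2_norm X (A f) \<le> op_norm_on X V A"
  unfolding op_norm_on_def
  by (rule cSup_upper) (use assms in \<open>auto intro!: bdd_aboveI[where M = B]\<close>)

lemma op_norm_on_least:
  assumes "(\<lambda>x. 0) \<in> V" "\<And>f. f \<in> V \<Longrightarrow> ell2_norm X f \<le> 1 \<Longrightarrow> ell2_norm X (A f) \<le> B"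
  shows "op_norm_on X V A \<le> B"
  unfolding op_norm_on_def
proof (rule cSup_least)
  have "ell2_norm X (A (\<lambda>x. 0)) \<in> {ell2_norm X (A f) |f. f \<in> V \<and> ell2_norm X f \<le> 1}"
    using assms(1) ell2_zero(2)[of X] by fastforce
  then show "{ell2_norm X (A f) |f. f \<in> V \<and> ell2_norm X f \<le> 1} \<noteq> {}" by blast
qed (use assms(2) in auto)

section \<open>Word length and weighted rapid decay\<close>

abbreviation (in group) "word_prod ws \<equiv> foldr (\<lambda>s h. s \<otimes> h) ws \<one>"

abbreviation (in group) "sym_gens S \<equiv> S \<union> (\<lambda>s. inv s) ` S"

context group
begin

lemma sym_gens_carrier: "S \<subseteq> carrier G \<Longrightarrow> sym_gens S \<subseteq> carrier G"
  by auto

lemma word_prod_closed: "set ws \<subseteq> carrier G \<Longrightarrow> word_prod ws \<in> carrier G"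
  by (induction ws) auto

lemma word_prod_append:
  "set us \<subseteq> carrier G \<Longrightarrow> set ws \<subseteq> carrier G \<Longrightarrow> word_prod (us @ ws) = word_prod us \<otimes> word_prod ws"
  by (induction us) (auto simp: m_assoc word_prod_closed simp del: foldr_append)

lemma word_prod_inv:
  "set ws \<subseteq> carrier G \<Longrightarrow> word_prod (rev (map (\<lambda>s. inv s) ws)) = inv (word_prod ws)"
proof (induction ws)
  case (Cons s ws)
  have 1: "set (rev (map (\<lambda>s. inv s) ws)) \<subseteq> carrier G" "set [inv s] \<subseteq> carrier G"
    using Cons.prems by auto
  have "word_prod (rev (map (\<lambda>s. inv s) (s # ws))) = word_prod (rev (map (\<lambda>s. inv s) ws)) \<otimes> word_prod [inv s]"
    using word_prod_append[OF 1] by (simp del: foldr_append)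
  then show ?case
    using Cons by (simp add: inv_mult_group word_prod_closed)
qed simp

lemma word_exists:
  assumes "fin_gen_set G S" "g \<in> carrier G"
  shows "\<exists>ws. set ws \<subseteq> sym_gens S \<and> word_prod ws = g"
proof -
  have S: "S \<subseteq> carrier G" and "g \<in> generate G S" using assms by (auto simp: fin_gen_set_def)
  from this(2) show ?thesis
  proof (induction rule: generate.induct)
    case one
    show ?case by (rule exI[of _ "[]"]) simp
  next
    case (incl h)
    then show ?case using S by (intro exI[of _ "[h]"]) auto
  next
    case (inv h)
    then show ?case using S by (intro exI[of _ "[inv h]"]) auto
  next
    case (eng h1 h2)
    then obtain us ws where w: "set us \<subseteq> sym_gens S" "word_prod us = h1"
      "set ws \<subseteq> sym_gens S" "word_prod ws = h2" by blast
    have "word_prod (us @ ws) = h1 \<otimes> h2"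
      using w(2,4) word_prod_append[OF order_trans[OF w(1) sym_gens_carrier[OF S]]
        order_trans[OF w(3) sym_gens_carrier[OF S]]] by (simp del: foldr_append)
    with w show ?case by (intro exI[of _ "us @ ws"]) (auto simp del: foldr_append)
  qed
qed

lemma word_length_le:
  assumes "set ws \<subseteq> sym_gens S" "word_prod ws = g"
  shows "word_length G S g \<le> length ws"
  unfolding word_length_def by (rule Least_le) (use assms in blast)

lemma word_length_word:
  assumes "fin_gen_set G S" "g \<in> carrier G"
  obtains ws where "length ws = word_length G S g" "set ws \<subseteq> sym_gens S" "word_prod ws = g"
proof -
  obtain ws where "set ws \<subseteq> sym_gens S" "word_prod ws = g" using word_exists[OF assms] by blast
  then have "\<exists>n ws. length ws = n \<and> set ws \<subseteq> sym_gens S \<and> word_prod ws = g" by blast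
  from LeastI_ex[OF this] show ?thesis using that unfolding word_length_def by blast
qed

lemma word_length_mult:
  assumes "fin_gen_set G S" "g \<in> carrier G" "h \<in> carrier G"
  shows "word_length G S (g \<otimes> h) \<le> word_length G S g + word_length G S h"
proof -
  have S: "S \<subseteq> carrier G" using assms by (auto simp: fin_gen_set_def)
  obtain us where us: "length us = word_length G S g" "set us \<subseteq> sym_gens S" "word_prod us = g"
    using word_length_word[OF assms(1,2)] .
  obtain ws where ws: "length ws = word_length G S h" "set ws \<subseteq> sym_gens S" "word_prod ws = h"
    using word_length_word[OF assms(1,3)] .
  have "word_prod (us @ ws) = g \<otimes> h"
    using us(3) ws(3) word_prod_append[OF order_trans[OF us(2) sym_gens_carrier[OF S]]
        order_trans[OF ws(2) sym_gens_carrier[OF S]]] by simp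
  then show ?thesis using word_length_le[of "us @ ws" S "g \<otimes> h"] us ws by simp
qed

lemma word_length_inv:
  assumes "fin_gen_set G S" "g \<in> carrier G"
  shows "word_length G S (inv g) \<le> word_length G S g"
proof -
  have S: "S \<subseteq> carrier G" using assms by (auto simp: fin_gen_set_def)
  obtain ws where ws: "length ws = word_length G S g" "set ws \<subseteq> sym_gens S" "word_prod ws = g"
    using word_length_word[OF assms] .
  have "set (rev (map (\<lambda>s. inv s) ws)) \<subseteq> sym_gens S"
  proof
    fix x assume "x \<in> set (rev (map (\<lambda>s. inv s) ws))"
    then obtain s where "s \<in> set ws" "x = inv s" by auto
    with ws(2) have "s \<in> sym_gens S" "x = inv s" by blast+
    then show "x \<in> sym_gens S" using S by auto
  qed
  moreover have "word_prod (rev (map (\<lambda>s. inv s) ws)) = inv g"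
    using word_prod_inv[OF order_trans[OF ws(2) sym_gens_carrier[OF S]]] ws(3) by simp
  ultimately show ?thesis
    using word_length_le[of "rev (map (\<lambda>s. inv s) ws)" S "inv g"] ws(1) by simp
qed

lemma word_length_pos:
  assumes "fin_gen_set G S" "g \<in> carrier G" "g \<noteq> \<one>"
  shows "1 \<le> word_length G S g"
proof -
  obtain ws where ws: "length ws = word_length G S g" "word_prod ws = g"
    using word_length_word[OF assms(1,2)] .
  then have "ws \<noteq> []" using assms(3) by auto
  then have "0 < length ws" by simp
  then show ?thesis using ws(1) by simp
qed

text \<open>
  The length \<open>n\<close> can be chosen independently of the starting point \<open>k\<close>, because right translations are
  automorphisms of the Cayley graph.
\<close>

lemma cayley_path_exists:
  assumes "fin_gen_set G S" "g \<in> carrier G"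
  shows "\<exists>n. \<forall>k\<in>carrier G. (k, g \<otimes> k) \<in> (cayley_edges G S \<union> (cayley_edges G S)\<inverse>) ^^ n"
proof -
  let ?E = "cayley_edges G S \<union> (cayley_edges G S)\<inverse>"
  have S: "S \<subseteq> carrier G" and "g \<in> generate G S" using assms by (auto simp: fin_gen_set_def)
  from this(2) show ?thesis
  proof (induction rule: generate.induct)
    case one
    show ?case by (rule exI[of _ 0]) simp
  next
    case (incl h)
    then have "(k, h \<otimes> k) \<in> ?E" if "k \<in> carrier G" for k
      using that by (auto simp: cayley_edges_def)
    then show ?case by (intro exI[of _ 1]) auto
  next
    case (inv h)
    have "(k, inv h \<otimes> k) \<in> ?E" if "k \<in> carrier G" for k
    proof -
      have "k = h \<otimes> (inv h \<otimes> k)" using inv S that by (auto simp: m_assoc[symmetric] subset_eq)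
      then have "(inv h \<otimes> k, k) \<in> cayley_edges G S"
        unfolding cayley_edges_def using inv S that by (auto simp: subset_eq)
      then show ?thesis by blast
    qed
    then show ?case by (intro exI[of _ 1]) auto
  next
    case (eng h1 h2)
    have h: "h1 \<in> carrier G" "h2 \<in> carrier G" using eng(1,2) generate_in_carrier[OF S] by auto
    from eng obtain m n where
      m: "\<And>k. k \<in> carrier G \<Longrightarrow> (k, h1 \<otimes> k) \<in> ?E ^^ m" and
      n: "\<And>k. k \<in> carrier G \<Longrightarrow> (k, h2 \<otimes> k) \<in> ?E ^^ n" by blast
    have "(k, h1 \<otimes> h2 \<otimes> k) \<in> ?E ^^ (n + m)" if "k \<in> carrier G" for k
      using n[OF that] m[of "h2 \<otimes> k"] that h by (auto simp: relpow_add m_assoc)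
    then show ?case by blast
  qed
qed

text \<open>
  Rapid decay refers to the Cayley graph of some generating set, the fourth moments to the word
  length of another one. The constant \<open>c\<close> bounds the lengths of paths in the Cayley graph of the first set that
  replace one generator from the second.
\<close>

lemma cayley_dist_le_word_length:
  assumes S': "fin_gen_set G S'" and S: "fin_gen_set G S"
  obtains c where "\<And>g h. g \<in> carrier G \<Longrightarrow> h \<in> carrier G \<Longrightarrow>
    cayley_dist G S' g h \<le> c * (word_length G S g + word_length G S h)"
proof -
  let ?E = "cayley_edges G S' \<union> (cayley_edges G S')\<inverse>"
  have Sc: "S \<subseteq> carrier G" "finite S" using S by (auto simp: fin_gen_set_def)
  obtain n where n: "\<And>g k. g \<in> carrier G \<Longrightarrow> k \<in> carrier G \<Longrightarrow> (k, g \<otimes> k) \<in> ?E ^^ n g"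
    using cayley_path_exists[OF S'] by metis
  define c where "c = Max (insert 0 (n ` sym_gens S))"
  have c: "n s \<le> c" if "s \<in> sym_gens S" for s
    unfolding c_def by (rule Max_ge) (use that Sc in auto)
  have path: "\<exists>m \<le> c * length ws. (k, word_prod ws \<otimes> k) \<in> ?E ^^ m"
    if "set ws \<subseteq> sym_gens S" "k \<in> carrier G" for ws k
    using that
  proof (induction ws)
    case (Cons s ws)
    then obtain m where m: "m \<le> c * length ws" "(k, word_prod ws \<otimes> k) \<in> ?E ^^ m" by auto
    have s: "s \<in> sym_gens S" "s \<in> carrier G" "set ws \<subseteq> carrier G"
      using Cons.prems sym_gens_carrier[OF Sc(1)] by auto
    note w = word_prod_closed[OF s(3)]
    have "(word_prod ws \<otimes> k, s \<otimes> (word_prod ws \<otimes> k)) \<in> ?E ^^ n s"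
      using n[of s "word_prod ws \<otimes> k"] s(2) w Cons.prems by auto
    with m have "(k, word_prod (s # ws) \<otimes> k) \<in> ?E ^^ (m + n s)"
      using s w Cons.prems by (auto simp: relpow_add m_assoc)
    moreover have "m + n s \<le> c * length (s # ws)" using m(1) c[OF s(1)] by simp
    ultimately show ?case by blast
  qed (auto intro!: exI[of _ 0])
  show ?thesis
  proof (rule that[of c])
    fix g h assume gh: "g \<in> carrier G" "h \<in> carrier G"
    then have gh': "h \<otimes> inv g \<in> carrier G" by simp
    obtain ws where ws: "length ws = word_length G S (h \<otimes> inv g)" "set ws \<subseteq> sym_gens S"
      "word_prod ws = h \<otimes> inv g" using word_length_word[OF S gh'] .
    obtain m where m: "m \<le> c * length ws" "(g, h \<otimes> inv g \<otimes> g) \<in> ?E ^^ m"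
      using path[OF ws(2) gh(1)] ws(3) by auto
    have "(g, h) \<in> ?E ^^ m" using m(2) gh by (simp add: m_assoc)
    then have "cayley_dist G S' g h \<le> m" unfolding cayley_dist_def by (rule Least_le)
    also have "\<dots> \<le> c * length ws" by (rule m(1))
    also have "\<dots> \<le> c * (word_length G S g + word_length G S h)"
      unfolding ws(1)
      using word_length_mult[OF S gh(2), of "inv g"] word_length_inv[OF S gh(1)] gh(1)
      by (intro mult_le_mono2) simp
    finally show "cayley_dist G S' g h \<le> c * (word_length G S g + word_length G S h)" .
  qed
qed

lemma left_reg_alg_superset:
  assumes "finite A" "supp q \<subseteq> A"
  shows "left_reg_alg G q f v = (\<Sum>g\<in>A. q g * left_reg G g f v)"
  unfolding left_reg_alg_def
  by (rule sum.mono_neutral_left) (use assms in \<open>auto simp: supp_def\<close>)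

lemma left_reg_alg_le_op_norm:
  assumes "q \<in> group_algebra G" "f \<in> ell2 (carrier G)" "ell2_norm (carrier G) f \<le> 1"
  shows "ell2_norm (carrier G) (left_reg_alg G q f) \<le> op_norm_on (carrier G) (ell2 (carrier G)) (left_reg_alg G q)"
proof (rule op_norm_on_upper[OF _ assms(2,3)])
  fix h assume h: "h \<in> ell2 (carrier G)" "ell2_norm (carrier G) h \<le> 1"
  show "ell2_norm (carrier G) (left_reg_alg G q h) \<le> l1_norm q"
    using left_reg_alg_ell2(2)[OF assms(1) h(1)] mult_left_mono[OF h(2) l1_norm_nonneg[of q]] by simp
qed

text \<open>
  Rapid decay turned into a bound by a weighted \<open>\<ell>\<^sup>2\<close> norm. The element \<open>q\<close> is cut into its
  restrictions \<open>q\<^sub>n\<close> to spheres of radius \<open>n\<close>, each of which has diameter \<open>O(n + 1)\<close>. The resulting sum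
  of \<open>(n + 1)\<^sup>C \<parallel>q\<^sub>n\<parallel>\<close> is estimated with the Cauchy-Schwarz inequality: writing \<open>a = 2 C + s\<close> with
  \<open>s > 1\<close>, one factor is the convergent series of \<open>(n + 1)\<^sup>-\<^sup>s\<close> and the other one the weighted norm.
\<close>

lemma weighted_rapid_decay:
  assumes S: "fin_gen_set G S" and rd: "rapid_decay G C" and a: "a > 2 * C + 1"
  obtains D where "D \<ge> 0" "\<And>q. q \<in> group_algebra G \<Longrightarrow>
    op_norm_on (carrier G) (ell2 (carrier G)) (left_reg_alg G q)
      \<le> D * sqrt (\<Sum>g\<in>supp q. (1 + real (word_length G S g)) powr a * (cmod (q g))\<^sup>2)"
proof -
  let ?X = "carrier G" and ?l = "word_length G S"
  obtain S' B where S': "fin_gen_set G S'" and B: "B > 0" and C: "C > 0" and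
    RD: "\<And>q. q \<in> group_algebra G \<Longrightarrow>
      op_norm_on ?X (ell2 ?X) (left_reg_alg G q) \<le> B * real (galg_diam G S' q) powr C * ell2_norm ?X q"
    using rd unfolding rapid_decay_def by blast
  obtain c where c: "\<And>g h. g \<in> ?X \<Longrightarrow> h \<in> ?X \<Longrightarrow> cayley_dist G S' g h \<le> c * (?l g + ?l h)"
    using cayley_dist_le_word_length[OF S' S] by metis
  \<comment> \<open>the summand \<open>1\<close> covers the \<open>1\<close> in the definition of the diameter\<close>
  define d where "d = 2 * c + 1"
  have diam: "galg_diam G S' q \<le> d * Suc n"
    if q: "q \<in> group_algebra G" and n: "\<And>g. g \<in> supp q \<Longrightarrow> ?l g = n" for q n
  proof -
    have e: "{cayley_dist G S' g h |g h. g \<in> supp q \<and> h \<in> supp q}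
        = (\<lambda>(g, h). cayley_dist G S' g h) ` (supp q \<times> supp q)" by auto
    have "cayley_dist G S' g h \<le> d * Suc n" if "g \<in> supp q" "h \<in> supp q" for g h
    proof -
      have "cayley_dist G S' g h \<le> c * (n + n)"
        using c[of g h] n that group_algebraD(3)[OF q] by force
      also have "\<dots> \<le> d * Suc n" by (simp add: d_def algebra_simps)
      finally show ?thesis .
    qed
    then show ?thesis
      unfolding galg_diam_def e using group_algebraD(1)[OF q]
      by (subst Max_le_iff) (auto simp: d_def)
  qed
  define s where "s = a - 2 * C"
  have s: "s > 1" using a by (simp add: s_def)
  have "summable (\<lambda>n. real n powr (- s))" using s by (simp add: summable_real_powr_iff)
  then have sm: "summable (\<lambda>n. real (Suc n) powr (- s))"
    by (subst summable_Suc_iff)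
  define Z where "Z = (\<Sum>n. real (Suc n) powr (- s))"
  define D where "D = B * real d powr C * sqrt Z"
  have Z0: "Z \<ge> 0" unfolding Z_def by (rule suminf_nonneg[OF sm]) simp
  show ?thesis
  proof (rule that[of D])
    show "D \<ge> 0" using B Z0 by (simp add: D_def)
    fix q assume q: "q \<in> group_algebra G"
    define W where "W = (\<Sum>g\<in>supp q. (1 + real (?l g)) powr a * (cmod (q g))\<^sup>2)"
    define qn where "qn n = (\<lambda>g. if ?l g = n then q g else 0)" for n
    define ns where "ns = ?l ` supp q"
    have fin: "finite ns" "finite (supp q)" using group_algebraD(1)[OF q] by (auto simp: ns_def)
    have sq: "supp (qn n) \<subseteq> supp q" "\<And>g. g \<in> supp (qn n) \<Longrightarrow> ?l g = n" for n
      by (auto simp: supp_def qn_def split: if_splits)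
    have qn: "qn n \<in> group_algebra G" for n
      by (rule group_algebraI[of "supp q"]) (use group_algebraD(1,2)[OF q] in \<open>auto simp: qn_def supp_def\<close>)
    have nq: "ell2_norm ?X (qn n) = sqrt (\<Sum>g | g \<in> supp q \<and> ?l g = n. (cmod (q g))\<^sup>2)" for n
    proof -
      have "ell2_norm ?X (qn n) = L2_set (\<lambda>x. cmod (qn n x)) {g. g \<in> supp q \<and> ?l g = n}"
        by (rule ell2_finite_support(2))
          (use fin group_algebraD(2)[OF q] in \<open>auto simp: qn_def supp_def\<close>)
      also have "\<dots> = sqrt (\<Sum>g | g \<in> supp q \<and> ?l g = n. (cmod (q g))\<^sup>2)"
        unfolding L2_set_def by (intro arg_cong[of _ _ sqrt] sum.cong) (auto simp: qn_def)
      finally show ?thesis .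
    qed
    have opn: "op_norm_on ?X (ell2 ?X) (left_reg_alg G (qn n))
        \<le> B * real d powr C * (real (Suc n) powr C * ell2_norm ?X (qn n))" for n
    proof -
      have "real (galg_diam G S' (qn n)) powr C \<le> real (d * Suc n) powr C"
        using C of_nat_mono[OF diam[OF qn sq(2)], of n n] by (intro powr_mono2) auto
      also have "\<dots> = real d powr C * real (Suc n) powr C"
        by (simp only: of_nat_mult powr_mult)
      finally have "B * real (galg_diam G S' (qn n)) powr C * ell2_norm ?X (qn n)
          \<le> B * (real d powr C * real (Suc n) powr C) * ell2_norm ?X (qn n)"
        using B by (intro mult_right_mono mult_left_mono) auto
      with RD[OF qn[of n]] show ?thesis by (simp add: mult_ac)
    qed
    have cs: "(\<Sum>n\<in>ns. real (Suc n) powr C * ell2_norm ?X (qn n)) \<le> sqrt Z * sqrt W"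
    proof -
      have "real (Suc n) powr C = real (Suc n) powr (- s / 2) * real (Suc n) powr (a / 2)" for n
        by (simp add: s_def powr_add[symmetric] field_simps del: of_nat_Suc)
      then have "(\<Sum>n\<in>ns. real (Suc n) powr C * ell2_norm ?X (qn n))
          = (\<Sum>n\<in>ns. \<bar>real (Suc n) powr (- s / 2)\<bar> * \<bar>real (Suc n) powr (a / 2) * ell2_norm ?X (qn n)\<bar>)"
        by (simp add: mult.assoc abs_mult)
      also have "\<dots> \<le> L2_set (\<lambda>n. real (Suc n) powr (- s / 2)) ns
          * L2_set (\<lambda>n. real (Suc n) powr (a / 2) * ell2_norm ?X (qn n)) ns"
        by (rule L2_set_mult_ineq)
      also have "\<dots> \<le> sqrt Z * sqrt W"
      proof (rule mult_mono)
        have "(\<Sum>n\<in>ns. (real (Suc n) powr (- s / 2))\<^sup>2) = (\<Sum>n\<in>ns. real (Suc n) powr (- s))"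
          by (rule sum.cong) (simp_all add: power2_eq_square powr_add[symmetric] del: of_nat_Suc)
        also have "\<dots> \<le> Z" unfolding Z_def by (rule sum_le_suminf[OF sm fin(1)]) simp
        finally show "L2_set (\<lambda>n. real (Suc n) powr (- s / 2)) ns \<le> sqrt Z"
          by (simp add: L2_set_def)
        have "(\<Sum>n\<in>ns. (real (Suc n) powr (a / 2) * ell2_norm ?X (qn n))\<^sup>2)
            = (\<Sum>n\<in>ns. \<Sum>g | g \<in> supp q \<and> ?l g = n. (1 + real (?l g)) powr a * (cmod (q g))\<^sup>2)"
        proof (rule sum.cong[OF refl])
          fix n
          have "(real (Suc n) powr (a / 2))\<^sup>2 = (1 + real n) powr a"
            by (simp add: power2_eq_square powr_add[symmetric])
          then show "(real (Suc n) powr (a / 2) * ell2_norm ?X (qn n))\<^sup>2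
            = (\<Sum>g | g \<in> supp q \<and> ?l g = n. (1 + real (?l g)) powr a * (cmod (q g))\<^sup>2)"
            by (simp add: nq power_mult_distrib sum_nonneg sum_distrib_left)
        qed
        also have "\<dots> = W" unfolding W_def ns_def by (rule sum.image_gen[OF fin(2), symmetric])
        finally show "L2_set (\<lambda>n. real (Suc n) powr (a / 2) * ell2_norm ?X (qn n)) ns \<le> sqrt W"
          by (simp add: L2_set_def)
      qed (use Z0 in auto)
      finally show ?thesis .
    qed
    show "op_norm_on ?X (ell2 ?X) (left_reg_alg G q) \<le> D * sqrt W"
    proof (rule op_norm_on_least)
      fix f assume f: "f \<in> ell2 ?X" "ell2_norm ?X f \<le> 1"
      have "left_reg_alg G q f = (\<lambda>v. \<Sum>n\<in>ns. left_reg_alg G (qn n) f v)"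
      proof
        fix v
        have "(\<Sum>n\<in>ns. left_reg_alg G (qn n) f v) = (\<Sum>n\<in>ns. \<Sum>g\<in>supp q. qn n g * left_reg G g f v)"
          by (rule sum.cong[OF refl]) (rule left_reg_alg_superset[OF fin(2) sq(1)])
        also have "\<dots> = (\<Sum>g\<in>supp q. (\<Sum>n\<in>ns. qn n g) * left_reg G g f v)"
          by (subst sum.swap) (simp add: sum_distrib_right)
        also have "\<dots> = left_reg_alg G q f v"
          unfolding left_reg_alg_def
          by (rule sum.cong[OF refl]) (use fin in \<open>auto simp: qn_def ns_def\<close>)
        finally show "left_reg_alg G q f v = (\<Sum>n\<in>ns. left_reg_alg G (qn n) f v)" by simp
      qed
      then have "ell2_norm ?X (left_reg_alg G q f) \<le> (\<Sum>n\<in>ns. ell2_norm ?X (left_reg_alg G (qn n) f))"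
        using ell2_sum[of ns "\<lambda>n. left_reg_alg G (qn n) f" ?X] fin left_reg_alg_ell2(1)[OF qn f(1)] by simp
      also have "\<dots> \<le> (\<Sum>n\<in>ns. B * real d powr C * (real (Suc n) powr C * ell2_norm ?X (qn n)))"
        using left_reg_alg_le_op_norm[OF qn f] opn order_trans by (intro sum_mono) blast
      also have "\<dots> = B * real d powr C * (\<Sum>n\<in>ns. real (Suc n) powr C * ell2_norm ?X (qn n))"
        by (simp only: sum_distrib_left)
      also have "\<dots> \<le> B * real d powr C * (sqrt Z * sqrt W)"
        using B by (intro mult_left_mono[OF cs]) auto
      finally show "ell2_norm ?X (left_reg_alg G q f) \<le> D * sqrt W" by (simp add: D_def mult.assoc)
    qed simp
  qed
qed

end

section \<open>Orthonormal bases of finite-dimensional space\<close>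

lemma ell2_inner_finite: "ell2_inner {1..N::nat} f h = (\<Sum>x=1..N. cnj (f x) * h x)"
  by (simp add: ell2_inner_def)

lemma ell2_norm_finite: "(ell2_norm {1..N::nat} f)\<^sup>2 = (\<Sum>x=1..N. (cmod (f x))\<^sup>2)"
  by (simp add: ell2_norm_square)

lemma ell2_finite_iff: "f \<in> ell2 {1..N::nat} \<longleftrightarrow> (\<forall>x. x \<notin> {1..N} \<longrightarrow> f x = 0)"
  by (simp add: ell2_def)

definition orthonormal_family :: "nat \<Rightarrow> (nat \<Rightarrow> nat \<Rightarrow> complex) \<Rightarrow> bool" where
  "orthonormal_family N \<phi> \<longleftrightarrow> (\<forall>i\<in>{1..N}. \<forall>j\<in>{1..N}.
     ell2_inner {1..N} (\<phi> i) (\<phi> j) = (if i = j then 1 else 0))"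

text \<open>
  By Bessel's inequality the numbers \<open>s x = \<Sum>\<^sub>\<alpha> |\<phi>\<^sub>\<alpha>(x)|\<^sup>2\<close> are at most \<open>1\<close>. They add up to \<open>N\<close>, so each of
  them is \<open>1\<close>, and equality in Bessel's inequality puts every \<open>\<delta>\<^sub>x\<close> in the span.
\<close>

lemma orthonormal_family_complete:
  assumes on: "orthonormal_family N \<phi>" and x: "x \<in> {1..N}" and y: "y \<in> {1..N}"
  shows "(\<Sum>i=1..N. \<phi> i x * cnj (\<phi> i y)) = (if x = y then 1 else 0)"
proof -
  let ?X = "{1..N}"
  define \<psi> where "\<psi> i = (\<lambda>y. if y \<in> ?X then \<phi> i y else 0)" for i
  have \<psi>: "\<psi> i \<in> ell2 ?X" for i unfolding ell2_finite_iff by (auto simp: \<psi>_def)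
  have on\<psi>: "ell2_inner ?X (\<psi> i) (\<psi> j) = (if i = j then 1 else 0)" if "i \<in> ?X" "j \<in> ?X" for i j
  proof -
    have "ell2_inner ?X (\<psi> i) (\<psi> j) = ell2_inner ?X (\<phi> i) (\<phi> j)"
      unfolding ell2_inner_finite by (rule sum.cong) (auto simp: \<psi>_def)
    then show ?thesis using on that by (simp add: orthonormal_family_def)
  qed
  define s where "s x = (\<Sum>i\<in>?X. (cmod (\<psi> i x))\<^sup>2)" for x
  \<comment> \<open>the orthogonal projection of \<open>\<delta>\<^sub>x\<close> onto the span of the family\<close>
  define h where "h x = (\<lambda>y. \<Sum>i\<in>?X. cnj (\<psi> i x) * \<psi> i y)" for x
  have c\<psi>: "(\<lambda>y. cnj (\<psi> i x) * \<psi> i y) \<in> ell2 ?X" for i x by (rule ell2_scale[OF \<psi>])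
  have h: "h x \<in> ell2 ?X" for x
    unfolding h_def using ell2_sum[of ?X "\<lambda>i y. cnj (\<psi> i x) * \<psi> i y", OF _ c\<psi>] by simp
  have hx: "h x x = of_real (s x)" for x
    unfolding h_def s_def of_real_sum
    by (rule sum.cong) (simp_all add: complex_norm_square mult.commute del: of_real_power)
  have hh: "(ell2_norm ?X (h x))\<^sup>2 = s x" for x
  proof -
    have in\<psi>: "ell2_inner ?X (\<psi> j) (h x) = cnj (\<psi> j x)" if "j \<in> ?X" for j
    proof -
      have "ell2_inner ?X (\<psi> j) (h x) = (\<Sum>i\<in>?X. ell2_inner ?X (\<psi> j) (\<lambda>y. cnj (\<psi> i x) * \<psi> i y))"
        unfolding h_def by (rule ell2_inner_sum_right[OF _ \<psi> c\<psi>]) simp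
      also have "\<dots> = (\<Sum>i\<in>?X. if j = i then cnj (\<psi> i x) else 0)"
        by (rule sum.cong[OF refl]) (use that on\<psi> in \<open>auto simp: ell2_inner_scale_right\<close>)
      also have "\<dots> = cnj (\<psi> j x)" using that by simp
      finally show ?thesis .
    qed
    have "ell2_inner ?X (h x) (h x) = (\<Sum>i\<in>?X. ell2_inner ?X (h x) (\<lambda>y. cnj (\<psi> i x) * \<psi> i y))"
      by (subst (2) h_def, rule ell2_inner_sum_right[OF _ h c\<psi>]) simp
    also have "\<dots> = (\<Sum>i\<in>?X. cnj (\<psi> i x) * \<psi> i x)"
    proof (rule sum.cong[OF refl])
      fix i assume "i \<in> ?X"
      then have "ell2_inner ?X (h x) (\<psi> i) = \<psi> i x"
        by (subst ell2_inner_commute) (simp only: in\<psi> complex_cnj_cnj)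
      then show "ell2_inner ?X (h x) (\<lambda>y. cnj (\<psi> i x) * \<psi> i y) = cnj (\<psi> i x) * \<psi> i x"
        by (simp only: ell2_inner_scale_right)
    qed
    also have "\<dots> = of_real (s x)" using hx[of x] by (simp add: h_def)
    finally show ?thesis
      unfolding ell2_inner_self[OF h] of_real_eq_iff .
  qed
  have dist: "(ell2_norm ?X (\<lambda>y. delta x y + (-1) * h x y))\<^sup>2 = 1 - s x" if "x \<in> ?X" for x
  proof -
    have d: "delta x \<in> ell2 ?X" "ell2_norm ?X (delta x) = 1" by (rule ell2_delta[OF that])+
    have "Re (ell2_inner ?X (delta x) (\<lambda>y. (-1) * h x y)) = - s x"
      unfolding ell2_inner_scale_right ell2_inner_delta[OF that] hx by simp
    then show ?thesis
      unfolding ell2_norm_add_square[OF d(1) ell2_scale[OF h]] ell2_norm_scale d(2)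
      by (simp add: hh del: One_nat_def)
  qed
  have le: "s x \<le> 1" if "x \<in> ?X" for x
    using dist[OF that] zero_le_power2[of "ell2_norm ?X (\<lambda>y. delta x y + (-1) * h x y)"] by linarith
  have "(\<Sum>x\<in>?X. s x) = (\<Sum>i\<in>?X. (ell2_norm ?X (\<psi> i))\<^sup>2)"
    unfolding s_def ell2_norm_finite by (rule sum.swap)
  also have "\<dots> = (\<Sum>i\<in>?X. 1)"
  proof (rule sum.cong[OF refl])
    fix i assume "i \<in> ?X"
    then have "complex_of_real ((ell2_norm ?X (\<psi> i))\<^sup>2) = of_real 1"
      using on\<psi> ell2_inner_self[OF \<psi>, of i] by simp
    then show "(ell2_norm ?X (\<psi> i))\<^sup>2 = 1" unfolding of_real_eq_iff .
  qed
  finally have "(\<Sum>x\<in>?X. 1 - s x) = 0" by (simp add: sum_subtractf)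
  then have "s x = 1" if "x \<in> ?X" for x
    using sum_nonneg_eq_0_iff[of ?X "\<lambda>x. 1 - s x"] le that by force
  then have "(ell2_norm ?X (\<lambda>y. delta y' y + (-1) * h y' y))\<^sup>2 = 0" if "y' \<in> ?X" for y'
    using dist[OF that] that by simp
  then have "ell2_norm ?X (\<lambda>z. delta y z + (-1) * h y z) \<le> 0" using y by simp
  then have "(\<lambda>z. delta y z + (-1) * h y z) = (\<lambda>z. 0)"
    by (rule ell2_norm_eq_0[OF ell2_add(1)[OF ell2_delta(1)[OF y] ell2_scale[OF h]]])
  from fun_cong[OF this, of x] have "h y x = delta y x" by simp
  then show ?thesis
    using x y by (simp add: h_def \<psi>_def delta_def mult.commute cong: sum.cong)
qed

section \<open>Permutation representations\<close>

abbreviation perp_norm :: "nat \<Rightarrow> ('a \<Rightarrow> nat \<Rightarrow> nat) \<Rightarrow> ('a \<Rightarrow> complex) \<Rightarrow> real" where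
  "perp_norm N r q \<equiv> op_norm_on {1..N} (const_perp N) (mat_app N (rep_mat r q))"

definition fixpts :: "nat \<Rightarrow> ('a \<Rightarrow> nat \<Rightarrow> nat) \<Rightarrow> 'a \<Rightarrow> nat" where
  "fixpts N r g = card {y \<in> {1..N}. r g y = y}"

locale perm_action = group G for G (structure) +
  fixes N :: nat and r :: "'a \<Rightarrow> nat \<Rightarrow> nat"
  assumes hom: "r \<in> hom G (sym_group N)"
begin

lemma r_permutes: "g \<in> carrier G \<Longrightarrow> r g permutes {1..N}"
  using hom unfolding sym_group_carrier[symmetric] by (auto simp: hom_def)

lemma r_mult: "g \<in> carrier G \<Longrightarrow> h \<in> carrier G \<Longrightarrow> r (g \<otimes> h) x = r g (r h x)"
  using hom by (auto simp: hom_def sym_group_mult)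

lemma r_one: "r \<one> x = x"
  using hom_one[OF hom is_group sym_group_is_group] by (simp add: sym_group_one)

lemma r_inv [simp]: "g \<in> carrier G \<Longrightarrow> r (inv g) (r g x) = x" "g \<in> carrier G \<Longrightarrow> r g (r (inv g) x) = x"
  by (simp_all add: r_one flip: r_mult)

lemma r_in [simp]: "g \<in> carrier G \<Longrightarrow> r g x \<in> {1..N} \<longleftrightarrow> x \<in> {1..N}"
  using permutes_in_image[OF r_permutes] .

lemma r_eq_iff: "g \<in> carrier G \<Longrightarrow> x = r g y \<longleftrightarrow> y = r (inv g) x"
  by (metis r_inv)

lemma sum_r: "g \<in> carrier G \<Longrightarrow> (\<Sum>x=1..N. f (r g x)) = (\<Sum>x=1..N. f x)"
  by (rule sum.permute[OF r_permutes, symmetric, unfolded comp_def])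

lemma rep_mat_superset:
  assumes "finite A" "supp q \<subseteq> A"
  shows "rep_mat r q x y = (\<Sum>g\<in>A. q g * perm_mat (r g) x y)"
  unfolding rep_mat_def
  by (rule sum.mono_neutral_left) (use assms in \<open>auto simp: supp_def\<close>)

text \<open>
  Since \<open>\<rho>(g)(x, y) = 1\<close> exactly for \<open>y = g\<inverse>.x\<close>, a representation matrix acts by composition with
  inverses. A summation range larger than the support lets several elements share one range.
\<close>

lemma rep_apply_superset:
  assumes "finite A" "supp q \<subseteq> A" "A \<subseteq> carrier G" "x \<in> {1..N}"
  shows "mat_app N (rep_mat r q) f x = (\<Sum>g\<in>A. q g * f (r (inv g) x))"
proof -
  have "mat_app N (rep_mat r q) f x = (\<Sum>y=1..N. \<Sum>g\<in>A. q g * (perm_mat (r g) x y * f y))"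
    using assms(4) by (simp add: mat_app_def rep_mat_superset[OF assms(1,2)] sum_distrib_right mult.assoc)
  also have "\<dots> = (\<Sum>g\<in>A. q g * (\<Sum>y=1..N. perm_mat (r g) x y * f y))"
    by (subst sum.swap) (simp add: sum_distrib_left)
  also have "\<dots> = (\<Sum>g\<in>A. q g * f (r (inv g) x))"
  proof (rule sum.cong[OF refl])
    fix g assume "g \<in> A"
    then have g: "g \<in> carrier G" using assms(3) by blast
    have "(\<Sum>y=1..N. perm_mat (r g) x y * f y) = (\<Sum>y=1..N. if y = r (inv g) x then f y else 0)"
      by (rule sum.cong[OF refl]) (use r_eq_iff[OF g] in \<open>auto simp: perm_mat_def\<close>)
    also have "\<dots> = f (r (inv g) x)" using assms(4) r_in[of "inv g" x] g by simp
    finally show "q g * (\<Sum>y=1..N. perm_mat (r g) x y * f y) = q g * f (r (inv g) x)" by simp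
  qed
  finally show ?thesis .
qed

lemma rep_apply:
  assumes "q \<in> group_algebra G" "x \<in> {1..N}"
  shows "mat_app N (rep_mat r q) f x = (\<Sum>g\<in>supp q. q g * f (r (inv g) x))"
  by (rule rep_apply_superset) (use assms group_algebraD in auto)

lemma rep_lincomb:
  assumes "q \<in> group_algebra G" "s \<in> group_algebra G" "x \<in> {1..N}"
  shows "mat_app N (rep_mat r (\<lambda>x. a * q x + b * s x)) f x
    = a * mat_app N (rep_mat r q) f x + b * mat_app N (rep_mat r s) f x"
proof -
  let ?A = "supp q \<union> supp s"
  have A: "finite ?A" "?A \<subseteq> carrier G" using assms group_algebraD by auto
  have "supp (\<lambda>x. a * q x + b * s x) \<subseteq> ?A" by (auto simp: supp_def)
  from rep_apply_superset[OF A(1) this A(2) assms(3)]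
    rep_apply_superset[OF A(1) _ A(2) assms(3), of q] rep_apply_superset[OF A(1) _ A(2) assms(3), of s]
  show ?thesis by (simp add: sum_distrib_left sum.distrib algebra_simps)
qed

lemma rep_mult:
  assumes p: "p \<in> group_algebra G" and q: "q \<in> group_algebra G" and x: "x \<in> {1..N}"
  shows "mat_app N (rep_mat r (left_reg_alg G p q)) f x
    = mat_app N (rep_mat r p) (mat_app N (rep_mat r q) f) x"
proof -
  let ?A = "(\<lambda>(g, h). g \<otimes> h) ` (supp p \<times> supp q)"
  have A: "finite ?A" "?A \<subseteq> carrier G" using p q by (auto simp: group_algebra_def)
  have inv_in: "inv g \<otimes> k \<in> carrier G" "k = g \<otimes> (inv g \<otimes> k)"
    if "g \<in> carrier G" "k \<in> carrier G" for g k using that by (simp_all add: m_assoc[symmetric])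
  have out: "left_reg G g q k = 0" if "g \<in> supp p" "k \<notin> (\<lambda>h. g \<otimes> h) ` supp q" for g k
  proof (cases "k \<in> carrier G")
    case True
    then have "inv g \<otimes> k \<notin> supp q"
      using that inv_in[of g k] group_algebraD(3)[OF p] by (metis image_eqI)
    then show ?thesis by (simp add: left_reg_def supp_def)
  qed (simp add: left_reg_def)
  have "supp (left_reg_alg G p q) \<subseteq> ?A"
  proof
    fix k assume "k \<in> supp (left_reg_alg G p q)"
    then have "(\<Sum>g\<in>supp p. p g * left_reg G g q k) \<noteq> 0" by (simp add: supp_def left_reg_alg_def)
    then obtain g where g: "g \<in> supp p" "p g * left_reg G g q k \<noteq> 0" by (meson sum.neutral)
    then have "k \<in> (\<lambda>h. g \<otimes> h) ` supp q" using out by fastforce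
    then show "k \<in> ?A" using g(1) by auto
  qed
  from rep_apply_superset[OF A(1) this A(2) x]
  have "mat_app N (rep_mat r (left_reg_alg G p q)) f x
      = (\<Sum>k\<in>?A. \<Sum>g\<in>supp p. p g * (left_reg G g q k * f (r (inv k) x)))"
    by (simp add: left_reg_alg_def sum_distrib_right mult.assoc)
  also have "\<dots> = (\<Sum>g\<in>supp p. p g * (\<Sum>k\<in>?A. left_reg G g q k * f (r (inv k) x)))"
    by (subst sum.swap) (simp add: sum_distrib_left)
  also have "\<dots> = (\<Sum>g\<in>supp p. p g * mat_app N (rep_mat r q) f (r (inv g) x))"
  proof (rule sum.cong[OF refl])
    fix g assume g: "g \<in> supp p"
    then have gc: "g \<in> carrier G" using group_algebraD(3)[OF p] by blast
    have inj: "inj_on (\<lambda>h. g \<otimes> h) (supp q)"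
      using gc group_algebraD(3)[OF q] by (auto simp: inj_on_def)
    have "(\<Sum>k\<in>?A. left_reg G g q k * f (r (inv k) x))
        = (\<Sum>k\<in>(\<lambda>h. g \<otimes> h) ` supp q. left_reg G g q k * f (r (inv k) x))"
      by (rule sum.mono_neutral_right) (use A g out in auto)
    also have "\<dots> = (\<Sum>h\<in>supp q. q h * f (r (inv h) (r (inv g) x)))"
      unfolding sum.reindex[OF inj] comp_def
    proof (rule sum.cong[OF refl])
      fix h assume "h \<in> supp q"
      then have h: "h \<in> carrier G" using group_algebraD(3)[OF q] by blast
      have "inv g \<otimes> (g \<otimes> h) = h" using gc h by (simp add: m_assoc[symmetric])
      then show "left_reg G g q (g \<otimes> h) * f (r (inv (g \<otimes> h)) x) = q h * f (r (inv h) (r (inv g) x))"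
        using gc h by (simp add: left_reg_def inv_mult_group r_mult)
    qed
    also have "\<dots> = mat_app N (rep_mat r q) f (r (inv g) x)"
      by (rule rep_apply[OF q, symmetric]) (use gc x r_in[of "inv g" x] in simp)
    finally show "p g * (\<Sum>k\<in>?A. left_reg G g q k * f (r (inv k) x))
        = p g * mat_app N (rep_mat r q) f (r (inv g) x)" by simp
  qed
  also have "\<dots> = mat_app N (rep_mat r p) (mat_app N (rep_mat r q) f) x"
    by (rule rep_apply[OF p x, symmetric])
  finally show ?thesis .
qed

lemma rep_ell2:
  assumes q: "q \<in> group_algebra G" and f: "f \<in> ell2 {1..N}"
  shows "mat_app N (rep_mat r q) f \<in> ell2 {1..N}"
    "ell2_norm {1..N} (mat_app N (rep_mat r q) f) \<le> l1_norm q * ell2_norm {1..N} f"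
proof -
  show "mat_app N (rep_mat r q) f \<in> ell2 {1..N}" unfolding ell2_finite_iff by (auto simp: mat_app_def)
  have gc: "g \<in> carrier G" if "g \<in> supp q" for g using that group_algebraD(3)[OF q] by blast
  have s: "(\<lambda>x. q g * f (r (inv g) x)) \<in> ell2 {1..N}"
    "ell2_norm {1..N} (\<lambda>x. q g * f (r (inv g) x)) = cmod (q g) * ell2_norm {1..N} f"
    if "g \<in> supp q" for g
  proof -
    show "(\<lambda>x. q g * f (r (inv g) x)) \<in> ell2 {1..N}"
      using f gc[OF that] r_in[of "inv g"] unfolding ell2_finite_iff by auto
    have "(ell2_norm {1..N} (\<lambda>x. f (r (inv g) x)))\<^sup>2 = (ell2_norm {1..N} f)\<^sup>2"
      unfolding ell2_norm_finite by (rule sum_r) (use gc[OF that] in simp)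
    then show "ell2_norm {1..N} (\<lambda>x. q g * f (r (inv g) x)) = cmod (q g) * ell2_norm {1..N} f"
      unfolding ell2_norm_scale by (simp add: power2_eq_iff_nonneg)
  qed
  have "ell2_norm {1..N} (mat_app N (rep_mat r q) f)
      = ell2_norm {1..N} (\<lambda>x. \<Sum>g\<in>supp q. q g * f (r (inv g) x))"
    unfolding ell2_norm_def
    by (intro arg_cong[of _ _ sqrt] infsum_cong) (simp only: rep_apply[OF q])
  also have "\<dots> \<le> (\<Sum>g\<in>supp q. ell2_norm {1..N} (\<lambda>x. q g * f (r (inv g) x)))"
    using ell2_sum[of "supp q" "\<lambda>g x. q g * f (r (inv g) x)", OF group_algebraD(1)[OF q] s(1)] by blast
  also have "\<dots> = l1_norm q * ell2_norm {1..N} f"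
    by (simp add: s(2) l1_norm_def sum_distrib_right del: One_nat_def)
  finally show "ell2_norm {1..N} (mat_app N (rep_mat r q) f) \<le> l1_norm q * ell2_norm {1..N} f" .
qed

lemma mat_app_scale: "mat_app N M (\<lambda>x. c * f x) = (\<lambda>x. c * mat_app N M f x)"
  by (auto simp: mat_app_def sum_distrib_left mult_ac)

lemma mat_app_cong: "(\<And>x. x \<in> {1..N} \<Longrightarrow> f x = h x) \<Longrightarrow> mat_app N M f = mat_app N M h"
  by (auto simp: mat_app_def intro!: sum.cong)

lemma eigenvalue_bound:
  assumes p: "p \<in> group_algebra G"
    and ev: "\<And>x. x \<in> {1..N} \<Longrightarrow> mat_app N (rep_mat r p) f x = of_real c * f x"
    and nz: "ell2_inner {1..N} f f = 1"
  shows "\<bar>c\<bar> \<le> l1_norm p"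
proof -
  define h where "h x = (if x \<in> {1..N} then f x else 0)" for x
  have h: "h \<in> ell2 {1..N}" unfolding ell2_finite_iff by (auto simp: h_def)
  have "ell2_inner {1..N} h h = ell2_inner {1..N} f f"
    unfolding ell2_inner_finite by (rule sum.cong) (auto simp: h_def)
  then have "complex_of_real ((ell2_norm {1..N} h)\<^sup>2) = of_real 1"
    using ell2_inner_self[OF h] nz by simp
  then have n1: "ell2_norm {1..N} h = 1"
    unfolding of_real_eq_iff power2_eq_1_iff using ell2_norm_nonneg[of "{1..N}" h] by linarith
  have "mat_app N (rep_mat r p) h = mat_app N (rep_mat r p) f"
    by (rule mat_app_cong) (simp add: h_def)
  then have "mat_app N (rep_mat r p) h = (\<lambda>x. of_real c * h x)"
    using ev by (auto simp: h_def mat_app_def)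
  then have "\<bar>c\<bar> = ell2_norm {1..N} (mat_app N (rep_mat r p) h)"
    by (simp add: ell2_norm_scale n1 del: One_nat_def)
  also have "\<dots> \<le> l1_norm p" using rep_ell2(2)[OF p h] by (simp add: n1 del: One_nat_def)
  finally show ?thesis .
qed

lemma rep_le_op_norm_perp:
  assumes q: "q \<in> group_algebra G" and f: "f \<in> const_perp N"
  shows "ell2_norm {1..N} (mat_app N (rep_mat r q) f)
    \<le> perp_norm N r q * ell2_norm {1..N} f"
proof (cases "ell2_norm {1..N} f = 0")
  case True
  have "f \<in> ell2 {1..N}" using f by (simp add: const_perp_def)
  then show ?thesis using rep_ell2(2)[OF q, of f] True by simp
next
  case False
  define n where "n = ell2_norm {1..N} f"
  have n: "n > 0" using False ell2_norm_nonneg[of "{1..N}" f] by (simp add: n_def order_less_le)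
  define h where "h = (\<lambda>x. of_real (1 / n) * f x)"
  have h: "h \<in> const_perp N" "ell2_norm {1..N} h \<le> 1"
    using f n by (auto simp: const_perp_def h_def ell2_scale ell2_inner_scale_right ell2_norm_scale
        norm_divide n_def simp del: of_real_divide)
  have "ell2_norm {1..N} (mat_app N (rep_mat r q) h)
      \<le> perp_norm N r q"
  proof (rule op_norm_on_upper[OF _ h])
    fix k assume k: "k \<in> const_perp N" "ell2_norm {1..N} k \<le> 1"
    then have "k \<in> ell2 {1..N}" by (simp add: const_perp_def)
    from rep_ell2(2)[OF q this]
    show "ell2_norm {1..N} (mat_app N (rep_mat r q) k) \<le> l1_norm q"
      using mult_left_mono[OF k(2) l1_norm_nonneg[of q]] by simp
  qed
  moreover have "ell2_norm {1..N} (mat_app N (rep_mat r q) h)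
      = ell2_norm {1..N} (mat_app N (rep_mat r q) f) / n"
    unfolding h_def mat_app_scale ell2_norm_scale using n by (simp add: norm_divide)
  ultimately show ?thesis using n by (simp add: field_simps n_def)
qed

lemma trace_perm_mat: "(\<Sum>x=1..N. perm_mat (r g) x x) = of_nat (fixpts N r g)"
proof -
  have "(\<Sum>x=1..N. perm_mat (r g) x x) = (\<Sum>x\<in>{1..N}. if r g x = x then 1 else 0)"
    by (rule sum.cong) (auto simp: perm_mat_def)
  also have "\<dots> = of_nat (fixpts N r g)"
    unfolding fixpts_def by (subst sum.If_cases) (auto simp: Int_def)
  finally show ?thesis .
qed

lemma trace_rep_mat:
  "(\<Sum>x=1..N. rep_mat r q x x) = (\<Sum>g\<in>supp q. q g * of_nat (fixpts N r g))"
proof -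
  have "(\<Sum>x=1..N. rep_mat r q x x) = (\<Sum>g\<in>supp q. q g * (\<Sum>x=1..N. perm_mat (r g) x x))"
    unfolding rep_mat_def by (subst sum.swap) (simp add: sum_distrib_left)
  then show ?thesis by (simp only: trace_perm_mat)
qed

end

section \<open>Functions of the operator realised in the group algebra\<close>

context regular_operator
begin

text \<open>
  Encodes that \<open>q = H(p)\<close> for a polynomial \<open>H\<close> through its effect on eigenvectors in all permutation
  representations, which is how polynomials of \<open>P\<^sub>N\<close> enter the traces below.
\<close>

definition poly_pair :: "('a \<Rightarrow> complex) \<Rightarrow> (real \<Rightarrow> complex) \<Rightarrow> bool" where
  "poly_pair q H \<longleftrightarrow> q \<in> group_algebra G \<and>
    (\<forall>N r f c. r \<in> hom G (sym_group N) \<longrightarrow>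
      (\<forall>x\<in>{1..N}. mat_app N (rep_mat r p) f x = of_real c * f x) \<longrightarrow>
      (\<forall>x\<in>{1..N}. mat_app N (rep_mat r q) f x = H c * f x))"

lemma poly_pair_one: "poly_pair (delta \<one>) (\<lambda>x. 1)"
proof -
  have d: "supp (delta \<one>) = {\<one>}" by (auto simp: supp_def delta_def)
  then have "delta \<one> \<in> group_algebra G" by (simp add: group_algebra_def)
  moreover have "mat_app N (rep_mat r (delta \<one>)) f x = f x"
    if "r \<in> hom G (sym_group N)" "x \<in> {1..N}" for N r f x
  proof -
    interpret perm_action G N r using that(1) by unfold_locales
    show ?thesis
      unfolding rep_apply[OF \<open>delta \<one> \<in> group_algebra G\<close> that(2)] d by (simp add: r_one delta_def)
  qed
  ultimately show ?thesis by (simp add: poly_pair_def)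
qed

lemma poly_pair_lincomb:
  assumes "poly_pair q H" "poly_pair s J"
  shows "poly_pair (\<lambda>x. a * q x + b * s x) (\<lambda>x. a * H x + b * J x)"
proof -
  have q: "q \<in> group_algebra G" and s: "s \<in> group_algebra G" using assms by (auto simp: poly_pair_def)
  have "mat_app N (rep_mat r (\<lambda>x. a * q x + b * s x)) f x = (a * H c + b * J c) * f x"
    if r: "r \<in> hom G (sym_group N)"
      and f: "\<forall>x\<in>{1..N}. mat_app N (rep_mat r p) f x = of_real c * f x" and x: "x \<in> {1..N}" for N r f c x
  proof -
    interpret perm_action G N r using r by unfold_locales
    have "mat_app N (rep_mat r q) f x = H c * f x" "mat_app N (rep_mat r s) f x = J c * f x"
      using assms r f x unfolding poly_pair_def by blast+
    then show ?thesis using rep_lincomb[OF q s x, of a b f] by (simp add: algebra_simps)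
  qed
  then show ?thesis using group_algebra_lincomb[OF q s] by (simp add: poly_pair_def)
qed

lemma poly_pair_mult:
  assumes "poly_pair q H"
  shows "poly_pair (P q) (\<lambda>x. of_real x * H x)"
proof -
  have q: "q \<in> group_algebra G" using assms by (auto simp: poly_pair_def)
  have "mat_app N (rep_mat r (P q)) f x = (of_real c * H c) * f x"
    if r: "r \<in> hom G (sym_group N)"
      and f: "\<forall>x\<in>{1..N}. mat_app N (rep_mat r p) f x = of_real c * f x" and x: "x \<in> {1..N}" for N r f c x
  proof -
    interpret perm_action G N r using r by unfold_locales
    have "mat_app N (rep_mat r (P q)) f x = mat_app N (rep_mat r p) (mat_app N (rep_mat r q) f) x"
      by (rule rep_mult[OF p_alg q x])
    also have "mat_app N (rep_mat r p) (mat_app N (rep_mat r q) f) = mat_app N (rep_mat r p) (\<lambda>x. H c * f x)"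
      by (rule mat_app_cong) (use assms r f in \<open>simp add: poly_pair_def\<close>)
    also have "\<dots> x = (of_real c * H c) * f x"
      unfolding mat_app_scale using f x by simp
    finally show ?thesis .
  qed
  then show ?thesis using left_reg_alg_group_algebra[OF p_alg q] by (simp add: poly_pair_def)
qed

lemma poly_pair_res_iter: "poly_pair (res_iter G p z (delta \<one>) n) (res_scalar p z n)"
proof (induction n)
  case 0
  then show ?case using poly_pair_lincomb[OF poly_pair_one poly_pair_one, of 0 0] by simp
next
  case (Suc n)
  let ?q = "res_iter G p z (delta \<one>) n" and ?H = "res_scalar p z n" and ?m = "res_mult p z"
  from poly_pair_lincomb[OF poly_pair_lincomb[OF Suc poly_pair_mult[OF Suc], of "1 + ?m * z" "- ?m"]
      poly_pair_one, of 1 ?m]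
  show ?case by (simp add: algebra_simps)
qed

text \<open>
  Encodes \<open>v = F(P) \<delta>\<^sub>e\<close> for a function \<open>F\<close> that need not be a polynomial. The same polynomials approximate
  \<open>F\<close> uniformly on \<open>[-l1_norm p, l1_norm p]\<close>, which contains the spectra of all \<open>P\<^sub>N\<close>, and \<open>v\<close> in \<open>ell2\<close>; this
  is what transports statements about \<open>F(P\<^sub>N)\<close> to statements about \<open>v\<close>.
\<close>

definition spectral_pair :: "('a \<Rightarrow> complex) \<Rightarrow> (real \<Rightarrow> complex) \<Rightarrow> bool" where
  "spectral_pair v F \<longleftrightarrow> v \<in> ell2 X \<and> (\<forall>\<epsilon>>0. \<exists>q H. poly_pair q H \<and> ell2_norm X (\<lambda>x. v x - q x) \<le> \<epsilon> \<and>
     (\<forall>x. \<bar>x\<bar> \<le> l1_norm p \<longrightarrow> cmod (F x - H x) \<le> \<epsilon>))"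

lemma spectral_pair_resolvent:
  assumes z: "Im z \<noteq> 0"
  shows "spectral_pair (resolvent X P z (delta \<one>)) (\<lambda>x. 1 / (of_real x - z))"
  unfolding spectral_pair_def
proof (intro conjI allI impI)
  let ?th = "res_rate p z"
  have d: "delta \<one> \<in> ell2 X" by simp
  show "resolvent X P z (delta \<one>) \<in> ell2 X" by (rule resolvent_ell2(1)[OF z d])
  obtain u c where u: "u \<in> ell2 X" "(\<lambda>x. P u x - z * u x) = delta \<one>"
    "\<And>n. ell2_norm X (\<lambda>x. u x - res_iter G p z (delta \<one>) n x) \<le> c * ?th ^ n"
    using res_exists[OF z d] by blast
  have R: "resolvent X P z (delta \<one>) = u" by (rule resolvent_eqI[OF z u(1,2)])
  fix \<epsilon> :: real assume e: "\<epsilon> > 0"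
  have l: "(\<lambda>n. c' * ?th ^ n) \<longlonglongrightarrow> 0" for c'
    by (rule tendsto_mult_right_zero[OF LIMSEQ_power_zero]) (use res_rate_bounds[OF z, of p] in simp)
  have "\<forall>\<^sub>F n in sequentially. c * ?th ^ n < \<epsilon> \<and> (1 / \<bar>Im z\<bar>) * ?th ^ n < \<epsilon>"
    by (intro eventually_conj order_tendstoD(2)[OF l e])
  then obtain n where n: "c * ?th ^ n < \<epsilon>" "(1 / \<bar>Im z\<bar>) * ?th ^ n < \<epsilon>"
    by (metis (mono_tags, lifting) eventually_happens trivial_limit_sequentially)
  show "\<exists>q H. poly_pair q H \<and> ell2_norm X (\<lambda>x. resolvent X P z (delta \<one>) x - q x) \<le> \<epsilon> \<and>
     (\<forall>x. \<bar>x\<bar> \<le> l1_norm p \<longrightarrow> cmod (1 / (of_real x - z) - H x) \<le> \<epsilon>)"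
    using poly_pair_res_iter[of z n] u(3)[of n] n res_scalar_converges[OF z, of _ p n]
    by (intro exI[of _ "res_iter G p z (delta \<one>) n"] exI[of _ "res_scalar p z n"]) (fastforce simp: R)
qed

lemma spectral_pair_lincomb:
  assumes "spectral_pair v F" "spectral_pair w J"
  shows "spectral_pair (\<lambda>x. a * v x + b * w x) (\<lambda>x. a * F x + b * J x)"
  unfolding spectral_pair_def
proof (intro conjI allI impI)
  have v: "v \<in> ell2 X" and w: "w \<in> ell2 X" using assms by (auto simp: spectral_pair_def)
  show "(\<lambda>x. a * v x + b * w x) \<in> ell2 X" by (intro ell2_add(1) ell2_scale v w)
  fix \<epsilon> :: real assume e: "\<epsilon> > 0"
  define d where "d = \<epsilon> / (cmod a + cmod b + 1)"
  have pos: "0 < cmod a + cmod b + 1" using norm_ge_zero[of a] norm_ge_zero[of b] by linarith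
  have d: "d > 0" "(cmod a + cmod b) * d \<le> \<epsilon>"
    using e pos by (auto simp: d_def field_simps)
  obtain q H where q: "poly_pair q H" "ell2_norm X (\<lambda>x. v x - q x) \<le> d"
    "\<And>x. \<bar>x\<bar> \<le> l1_norm p \<Longrightarrow> cmod (F x - H x) \<le> d"
    using assms(1) d(1) unfolding spectral_pair_def by blast
  obtain s K where s: "poly_pair s K" "ell2_norm X (\<lambda>x. w x - s x) \<le> d"
    "\<And>x. \<bar>x\<bar> \<le> l1_norm p \<Longrightarrow> cmod (J x - K x) \<le> d"
    using assms(2) d(1) unfolding spectral_pair_def by blast
  have qe: "q \<in> ell2 X" "s \<in> ell2 X" using q(1) s(1) by (auto simp: poly_pair_def group_algebra_ell2)
  have "ell2_norm X (\<lambda>x. (a * v x + b * w x) - (a * q x + b * s x))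
      = ell2_norm X (\<lambda>x. a * (v x - q x) + b * (w x - s x))" by (simp add: algebra_simps)
  also have "\<dots> \<le> cmod a * ell2_norm X (\<lambda>x. v x - q x) + cmod b * ell2_norm X (\<lambda>x. w x - s x)"
    using ell2_add(2)[OF ell2_scale[OF ell2_diff(1)[OF v qe(1)], of a] ell2_scale[OF ell2_diff(1)[OF w qe(2)], of b]]
    by (simp only: ell2_norm_scale)
  also have "\<dots> \<le> cmod a * d + cmod b * d"
    by (intro add_mono mult_left_mono q s norm_ge_zero)
  finally have n: "ell2_norm X (\<lambda>x. (a * v x + b * w x) - (a * q x + b * s x)) \<le> \<epsilon>"
    using d(2) by (simp add: distrib_right)
  have "cmod ((a * F x + b * J x) - (a * H x + b * K x)) \<le> \<epsilon>" if x: "\<bar>x\<bar> \<le> l1_norm p" for x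
  proof -
    have "cmod ((a * F x + b * J x) - (a * H x + b * K x)) = cmod (a * (F x - H x) + b * (J x - K x))"
      by (simp add: algebra_simps)
    also have "\<dots> \<le> cmod a * cmod (F x - H x) + cmod b * cmod (J x - K x)"
      by (metis norm_mult norm_triangle_ineq)
    also have "\<dots> \<le> cmod a * d + cmod b * d"
      by (intro add_mono mult_left_mono q(3) s(3) x norm_ge_zero)
    finally show ?thesis using d(2) by (simp add: distrib_right)
  qed
  with n poly_pair_lincomb[OF q(1) s(1), of a b]
  show "\<exists>q H. poly_pair q H \<and> ell2_norm X (\<lambda>x. a * v x + b * w x - q x) \<le> \<epsilon> \<and>
     (\<forall>x. \<bar>x\<bar> \<le> l1_norm p \<longrightarrow> cmod (a * F x + b * J x - H x) \<le> \<epsilon>)" by blast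
qed

text \<open>
  The function \<open>Im (1 / (x - z))\<close> with \<open>z = E + \<i> \<eta>\<close>.
\<close>

definition poisson :: "real \<Rightarrow> real \<Rightarrow> real \<Rightarrow> real" where
  "poisson E \<eta> x = \<eta> / ((x - E)\<^sup>2 + \<eta>\<^sup>2)"

lemma spectral_pair_green:
  assumes "\<eta> > 0"
  shows "spectral_pair (green (Complex E \<eta>)) (\<lambda>x. of_real (poisson E \<eta> x))"
proof -
  let ?z = "Complex E \<eta>"
  have z: "Im ?z \<noteq> 0" "Im (cnj ?z) \<noteq> 0" using assms by auto
  have a: "1 / (2 * \<i>) * x + - 1 / (2 * \<i>) * y = (x - y) / (2 * \<i>)" for x y :: complex
    by (simp add: field_simps)
  have "(1 / (of_real x - ?z) - 1 / (of_real x - cnj ?z)) / (2 * \<i>) = of_real (poisson E \<eta> x)" for x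
  proof -
    have nz: "of_real x - ?z \<noteq> 0" "of_real x - cnj ?z \<noteq> 0" using assms by (auto simp: complex_eq_iff)
    have "1 / (of_real x - ?z) - 1 / (of_real x - cnj ?z)
        = (?z - cnj ?z) / ((of_real x - ?z) * (of_real x - cnj ?z))"
      using nz by (simp add: field_simps)
    also have "(of_real x - ?z) * (of_real x - cnj ?z) = of_real ((x - E)\<^sup>2 + \<eta>\<^sup>2)"
      by (simp add: complex_eq_iff power2_eq_square algebra_simps)
    also have "?z - cnj ?z = 2 * \<i> * of_real \<eta>" by (simp add: complex_eq_iff)
    finally have "1 / (of_real x - ?z) - 1 / (of_real x - cnj ?z) = 2 * \<i> * of_real (poisson E \<eta> x)"
      by (simp add: poisson_def)
    then show ?thesis by simp
  qed
  with spectral_pair_lincomb[OF spectral_pair_resolvent[OF z(1)] spectral_pair_resolvent[OF z(2)], of "1 / (2 * \<i>)" "- 1 / (2 * \<i>)"]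
  show ?thesis unfolding a green_def by simp
qed

end

section \<open>Weighted sums of matrix elements as traces\<close>

lemma sum_rotate3:
  "(\<Sum>h\<in>B. \<Sum>s\<in>C. \<Sum>t\<in>D. f h s t) = (\<Sum>s\<in>C. \<Sum>t\<in>D. \<Sum>h\<in>B. f h s t)"
  by (subst sum.swap, rule sum.cong[OF refl], rule sum.swap)

lemma sum_rotate4:
  "(\<Sum>g\<in>A. \<Sum>h\<in>B. \<Sum>s\<in>C. \<Sum>t\<in>D. f g h s t) = (\<Sum>h\<in>B. \<Sum>s\<in>C. \<Sum>t\<in>D. \<Sum>g\<in>A. f g h s t)"
  by (subst sum.swap, rule sum.cong[OF refl], rule sum_rotate3)

text \<open>
  This is \<open>Tr (F\<^sub>2(P\<^sub>N) M F\<^sub>1(P\<^sub>N) M\<^sup>*)\<close>, written in an eigenbasis.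
\<close>

definition weighted_sum :: "nat \<Rightarrow> (nat \<Rightarrow> nat \<Rightarrow> complex) \<Rightarrow> (nat \<Rightarrow> real)
    \<Rightarrow> (real \<Rightarrow> real) \<Rightarrow> (real \<Rightarrow> real) \<Rightarrow> (nat \<Rightarrow> nat \<Rightarrow> complex) \<Rightarrow> real" where
  "weighted_sum N \<phi> \<mu> F1 F2 M =
    (\<Sum>i=1..N. \<Sum>j=1..N. F1 (\<mu> i) * F2 (\<mu> j) * (cmod (mat_elem N (\<phi> j) M (\<phi> i)))\<^sup>2)"

text \<open>
  The matrix \<open>\<Sum>\<^sub>t \<rho>(t) D\<^sub>t\<close> with \<open>D\<^sub>t\<close> the diagonal matrix of \<open>m t\<close>. Unlike the entries of a local matrix, the
  functions \<open>m t\<close> can be prescribed separately for each \<open>t\<close> even where several \<open>t\<close> agree.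
\<close>

definition local_mat ::
    "('a \<Rightarrow> nat \<Rightarrow> nat) \<Rightarrow> 'a set \<Rightarrow> ('a \<Rightarrow> nat \<Rightarrow> complex) \<Rightarrow> nat \<Rightarrow> nat \<Rightarrow> complex" where
  "local_mat r T m x y = (\<Sum>t\<in>T. perm_mat (r t) x y * m t y)"

context group
begin

text \<open>
  The coefficients in front of \<open>\<langle>m\<^sub>s, \<rho>(k) m\<^sub>t\<rangle>\<close> that remain when the trace of
  \<open>\<rho>(q\<^sub>2) M \<rho>(q\<^sub>1) M\<^sup>*\<close> is restricted to pairs \<open>g, h\<close> with \<open>g t h = s\<close>: there \<open>k = h\<inverse>\<close> and
  \<open>g = s k t\<inverse>\<close>.
\<close>

definition conv_kernel :: "('a \<Rightarrow> complex) \<Rightarrow> ('a \<Rightarrow> complex) \<Rightarrow> 'a \<Rightarrow> 'a \<Rightarrow> 'a \<Rightarrow> complex" where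
  "conv_kernel q1 q2 s t k = (if k \<in> carrier G then q1 (inv k) * q2 (s \<otimes> k \<otimes> inv t) else 0)"

lemma conv_kernel_supp:
  assumes "q1 \<in> group_algebra G"
  shows "finite ((\<lambda>g. inv g) ` supp q1)" "(\<lambda>g. inv g) ` supp q1 \<subseteq> carrier G"
    "supp (conv_kernel q1 q2 s t) \<subseteq> (\<lambda>g. inv g) ` supp q1"
    "conv_kernel q1 q2 s t \<in> group_algebra G"
proof -
  show 1: "finite ((\<lambda>g. inv g) ` supp q1)" "(\<lambda>g. inv g) ` supp q1 \<subseteq> carrier G"
    using assms by (auto simp: group_algebra_def)
  show 2: "supp (conv_kernel q1 q2 s t) \<subseteq> (\<lambda>g. inv g) ` supp q1"
  proof
    fix k assume "k \<in> supp (conv_kernel q1 q2 s t)"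
    then have "k \<in> carrier G" "inv k \<in> supp q1"
      by (auto simp: supp_def conv_kernel_def split: if_splits)
    then show "k \<in> (\<lambda>g. inv g) ` supp q1" by (intro image_eqI[of _ _ "inv k"]) auto
  qed
  show "conv_kernel q1 q2 s t \<in> group_algebra G"
    by (rule group_algebraI[OF 1]) (use 2 in \<open>auto simp: supp_def\<close>)
qed

end

locale eigen_action = perm_action G N r + regular_operator G p
  for G (structure) and N r p +
  fixes \<phi> :: "nat \<Rightarrow> nat \<Rightarrow> complex" and \<mu> :: "nat \<Rightarrow> real"
  assumes onb: "orthonormal_eigenbasis N (rep_mat r p) \<phi> \<mu>"
begin

lemma orth: "orthonormal_family N \<phi>"
  using onb by (simp add: orthonormal_eigenbasis_def orthonormal_family_def)

lemma poly_eigen: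
  assumes "poly_pair q H" "i \<in> {1..N}" "x \<in> {1..N}"
  shows "mat_app N (rep_mat r q) (\<phi> i) x = H (\<mu> i) * \<phi> i x"
proof -
  have "\<forall>x\<in>{1..N}. mat_app N (rep_mat r p) (\<phi> i) x = of_real (\<mu> i) * \<phi> i x"
    using onb assms(2) unfolding orthonormal_eigenbasis_def by blast
  then show ?thesis using assms(1,3) hom unfolding poly_pair_def by blast
qed

lemma eigenvalue_le: "i \<in> {1..N} \<Longrightarrow> \<bar>\<mu> i\<bar> \<le> l1_norm p"
  using onb unfolding orthonormal_eigenbasis_def
  by (intro eigenvalue_bound[OF p_alg, of "\<phi> i"]) auto

lemma spectral_kernel:
  assumes q: "poly_pair q H" and xy: "x \<in> {1..N}" "y \<in> {1..N}"
  shows "(\<Sum>i=1..N. H (\<mu> i) * \<phi> i x * cnj (\<phi> i y)) = rep_mat r q x y"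
proof -
  have "H (\<mu> i) * \<phi> i x * cnj (\<phi> i y) = (\<Sum>z=1..N. rep_mat r q x z * (\<phi> i z * cnj (\<phi> i y)))"
    if "i \<in> {1..N}" for i
    using poly_eigen[OF q that xy(1), symmetric] xy(1)
    by (simp add: mat_app_def sum_distrib_right mult.assoc)
  then have "(\<Sum>i=1..N. H (\<mu> i) * \<phi> i x * cnj (\<phi> i y))
      = (\<Sum>z=1..N. rep_mat r q x z * (\<Sum>i=1..N. \<phi> i z * cnj (\<phi> i y)))"
    by (subst sum_distrib_left, subst sum.swap) (rule sum.cong[OF refl])
  also have "\<dots> = (\<Sum>z=1..N. if z = y then rep_mat r q x z else 0)"
    by (rule sum.cong[OF refl]) (simp add: orthonormal_family_complete[OF orth _ xy(2)] del: One_nat_def)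
  also have "\<dots> = rep_mat r q x y" using xy(2) by simp
  finally show ?thesis .
qed

lemma spectral_trace:
  assumes q: "poly_pair q H"
  shows "(\<Sum>i=1..N. H (\<mu> i)) = (\<Sum>g\<in>supp q. q g * of_nat (fixpts N r g))"
proof -
  have "(\<Sum>x=1..N. \<phi> i x * cnj (\<phi> i x)) = 1" if "i \<in> {1..N}" for i
  proof -
    have "ell2_inner {1..N} (\<phi> i) (\<phi> i) = 1"
      using orth that unfolding orthonormal_family_def by auto
    then show ?thesis unfolding ell2_inner_finite by (simp add: mult.commute)
  qed
  then have "(\<Sum>i=1..N. H (\<mu> i)) = (\<Sum>i=1..N. \<Sum>x=1..N. H (\<mu> i) * \<phi> i x * cnj (\<phi> i x))"
    by (intro sum.cong[OF refl]) (simp add: mult.assoc flip: sum_distrib_left)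
  also have "\<dots> = (\<Sum>x=1..N. rep_mat r q x x)"
    by (subst sum.swap) (rule sum.cong[OF refl], rule spectral_kernel[OF q])
  finally show ?thesis by (simp only: trace_rep_mat)
qed

lemma spectral_quadratic:
  assumes q: "poly_pair q H"
  shows "(\<Sum>i=1..N. H (\<mu> i) * ((\<Sum>y=1..N. b y * \<phi> i y) * cnj (\<Sum>z=1..N. c z * \<phi> i z)))
    = (\<Sum>y=1..N. \<Sum>z=1..N. b y * cnj (c z) * rep_mat r q y z)"
proof -
  have "(\<Sum>i=1..N. H (\<mu> i) * ((\<Sum>y=1..N. b y * \<phi> i y) * cnj (\<Sum>z=1..N. c z * \<phi> i z)))
     = (\<Sum>i=1..N. \<Sum>y=1..N. \<Sum>z=1..N. b y * cnj (c z) * (H (\<mu> i) * \<phi> i y * cnj (\<phi> i z)))"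
    unfolding cnj_sum sum_product unfolding sum_distrib_left
    by (intro sum.cong refl) (simp add: mult_ac)
  also have "\<dots> = (\<Sum>y=1..N. \<Sum>i=1..N. \<Sum>z=1..N. b y * cnj (c z) * (H (\<mu> i) * \<phi> i y * cnj (\<phi> i z)))"
    by (rule sum.swap)
  also have "\<dots> = (\<Sum>y=1..N. \<Sum>z=1..N. b y * cnj (c z) * rep_mat r q y z)"
  proof (rule sum.cong[OF refl])
    fix y assume y: "y \<in> {1..N}"
    show "(\<Sum>i=1..N. \<Sum>z=1..N. b y * cnj (c z) * (H (\<mu> i) * \<phi> i y * cnj (\<phi> i z)))
      = (\<Sum>z=1..N. b y * cnj (c z) * rep_mat r q y z)"
      by (subst sum.swap, rule sum.cong[OF refl])
        (simp only: sum_distrib_left[symmetric] spectral_kernel[OF q y])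
  qed
  finally show ?thesis .
qed

lemma sum_rep_mat:
  assumes "q \<in> group_algebra G"
  shows "(\<Sum>y=1..N. \<Sum>z=1..N. f y z * rep_mat r q y z) = (\<Sum>h\<in>supp q. q h * (\<Sum>z=1..N. f (r h z) z))"
proof -
  have "(\<Sum>y=1..N. \<Sum>z=1..N. f y z * rep_mat r q y z)
      = (\<Sum>z=1..N. \<Sum>y=1..N. \<Sum>h\<in>supp q. q h * (f y z * perm_mat (r h) y z))"
    unfolding rep_mat_def sum_distrib_left by (subst sum.swap) (simp add: mult_ac)
  also have "\<dots> = (\<Sum>z=1..N. \<Sum>h\<in>supp q. q h * f (r h z) z)"
  proof (rule sum.cong[OF refl])
    fix z assume z: "z \<in> {1..N}"
    have "(\<Sum>y=1..N. f y z * perm_mat (r h) y z) = f (r h z) z" if "h \<in> supp q" for h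
    proof -
      have h: "h \<in> carrier G" using that group_algebraD(3)[OF assms] by blast
      have "(\<Sum>y=1..N. f y z * perm_mat (r h) y z) = (\<Sum>y=1..N. if y = r h z then f y z else 0)"
        by (rule sum.cong) (auto simp: perm_mat_def)
      then show ?thesis using r_in[OF h, of z] z by simp
    qed
    then show "(\<Sum>y=1..N. \<Sum>h\<in>supp q. q h * (f y z * perm_mat (r h) y z)) = (\<Sum>h\<in>supp q. q h * f (r h z) z)"
      by (subst sum.swap) (simp add: sum_distrib_left[symmetric])
  qed
  also have "\<dots> = (\<Sum>h\<in>supp q. q h * (\<Sum>z=1..N. f (r h z) z))"
    by (subst sum.swap) (simp only: sum_distrib_left)
  finally show ?thesis .
qed

abbreviation "matel M j i \<equiv> mat_elem N (\<phi> j) M (\<phi> i)"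

text \<open>
  The trace of \<open>\<rho>(q\<^sub>2) M \<rho>(q\<^sub>1) M\<^sup>*\<close> evaluated in the eigenbasis and in the standard basis.
\<close>

lemma spectral_double_sum:
  assumes q1: "poly_pair q1 H1" and q2: "poly_pair q2 H2"
  shows "(\<Sum>i=1..N. \<Sum>j=1..N. H1 (\<mu> i) * H2 (\<mu> j) * of_real ((cmod (matel M j i))\<^sup>2))
    = (\<Sum>g\<in>supp q2. \<Sum>h\<in>supp q1. q2 g * q1 h * (\<Sum>x=1..N. \<Sum>y=1..N. M x (r h y) * cnj (M (r g x) y)))"
proof -
  have g1: "q1 \<in> group_algebra G" and g2: "q2 \<in> group_algebra G" using q1 q2 by (auto simp: poly_pair_def)
  define a where "a i x = (\<Sum>y=1..N. M x y * \<phi> i y)" for i x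
  have el: "of_real ((cmod (matel M j i))\<^sup>2)
      = (\<Sum>x=1..N. cnj (a i x) * \<phi> j x) * cnj (\<Sum>x=1..N. cnj (a i x) * \<phi> j x)" for i j
  proof -
    have "matel M j i = cnj (\<Sum>x=1..N. cnj (a i x) * \<phi> j x)"
      unfolding mat_elem_def ell2_inner_finite cnj_sum
      by (rule sum.cong) (auto simp: mat_app_def a_def mult.commute)
    then show ?thesis unfolding complex_norm_square complex_cnj_cnj by (simp only: complex_cnj_cnj mult.commute)
  qed
  have "(\<Sum>i=1..N. \<Sum>j=1..N. H1 (\<mu> i) * H2 (\<mu> j) * of_real ((cmod (matel M j i))\<^sup>2))
      = (\<Sum>i=1..N. H1 (\<mu> i) * (\<Sum>x'=1..N. \<Sum>x=1..N. cnj (a i x') * a i x * rep_mat r q2 x' x))"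
    unfolding mult.assoc sum_distrib_left[symmetric] el spectral_quadratic[OF q2] by simp
  also have "\<dots> = (\<Sum>x'=1..N. \<Sum>x=1..N. (\<Sum>i=1..N. H1 (\<mu> i) * (a i x * cnj (a i x'))) * rep_mat r q2 x' x)"
    unfolding sum_distrib_left sum_distrib_right
    by (subst sum.swap, rule sum.cong[OF refl], subst sum.swap) (simp add: mult_ac)
  also have "\<dots> = (\<Sum>x'=1..N. \<Sum>x=1..N. (\<Sum>h\<in>supp q1. q1 h * (\<Sum>y=1..N. M x (r h y) * cnj (M x' y))) * rep_mat r q2 x' x)"
    unfolding a_def spectral_quadratic[OF q1] sum_rep_mat[OF g1] by simp
  also have "\<dots> = (\<Sum>g\<in>supp q2. q2 g * (\<Sum>x=1..N. (\<Sum>h\<in>supp q1. q1 h * (\<Sum>y=1..N. M x (r h y) * cnj (M (r g x) y)))))"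
    by (rule sum_rep_mat[OF g2])
  also have "\<dots> = (\<Sum>g\<in>supp q2. \<Sum>h\<in>supp q1. q2 g * q1 h * (\<Sum>x=1..N. \<Sum>y=1..N. M x (r h y) * cnj (M (r g x) y)))"
    by (rule sum.cong[OF refl], subst sum.swap) (simp only: sum_distrib_left mult.assoc)
  finally show ?thesis .
qed

lemma supp_delta_one: "supp (delta \<one>) = {\<one>}"
  by (auto simp: supp_def delta_def)

lemma spectral_parseval:
  "(\<Sum>i=1..N. \<Sum>j=1..N. (cmod (matel M j i))\<^sup>2) = (\<Sum>x=1..N. \<Sum>y=1..N. (cmod (M x y))\<^sup>2)"
proof -
  have "complex_of_real (\<Sum>i=1..N. \<Sum>j=1..N. (cmod (matel M j i))\<^sup>2)
      = (\<Sum>x=1..N. \<Sum>y=1..N. M x y * cnj (M x y))"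
    using spectral_double_sum[OF poly_pair_one poly_pair_one, of M]
    unfolding supp_delta_one by (simp add: r_one delta_def)
  also have "\<dots> = of_real (\<Sum>x=1..N. \<Sum>y=1..N. (cmod (M x y))\<^sup>2)"
    unfolding of_real_sum complex_norm_square ..
  finally show ?thesis unfolding of_real_eq_iff .
qed

lemma local_mat_product:
  assumes T: "finite T" "T \<subseteq> carrier G" and h: "h \<in> carrier G" and g: "g \<in> carrier G"
  shows "(\<Sum>x=1..N. \<Sum>y=1..N. local_mat r T m x (r h y) * cnj (local_mat r T m (r g x) y))
    = (\<Sum>s\<in>T. \<Sum>t\<in>T. \<Sum>y=1..N. if r g (r t (r h y)) = r s y then m t (r h y) * cnj (m s y) else 0)"
proof -
  have "(\<Sum>x=1..N. \<Sum>y=1..N. local_mat r T m x (r h y) * cnj (local_mat r T m (r g x) y))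
      = (\<Sum>y=1..N. \<Sum>s\<in>T. \<Sum>t\<in>T. \<Sum>x=1..N.
          (perm_mat (r t) x (r h y) * m t (r h y)) * cnj (perm_mat (r s) (r g x) y * m s y))"
    unfolding local_mat_def cnj_sum sum_product
    by (subst sum_rotate4[where A = "{1..N}"], subst sum.swap) (intro sum.cong refl sum.swap)
  also have "\<dots> = (\<Sum>y=1..N. \<Sum>s\<in>T. \<Sum>t\<in>T.
      if r g (r t (r h y)) = r s y then m t (r h y) * cnj (m s y) else 0)"
  proof (intro sum.cong refl)
    fix y s t assume y: "y \<in> {1..N}" and "s \<in> T" and t: "t \<in> T"
    have "(\<Sum>x=1..N. (perm_mat (r t) x (r h y) * m t (r h y)) * cnj (perm_mat (r s) (r g x) y * m s y))
        = (\<Sum>x=1..N. if x = r t (r h y) then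
            (if r g x = r s y then m t (r h y) * cnj (m s y) else 0) else 0)"
      by (rule sum.cong) (auto simp: perm_mat_def)
    moreover have "r t (r h y) \<in> {1..N}" 
      unfolding r_in[OF subsetD[OF T(2) t]] r_in[OF h] by (rule y)
    ultimately show "(\<Sum>x=1..N. (perm_mat (r t) x (r h y) * m t (r h y)) * cnj (perm_mat (r s) (r g x) y * m s y))
        = (if r g (r t (r h y)) = r s y then m t (r h y) * cnj (m s y) else 0)"
      by simp
  qed
  also have "\<dots> = (\<Sum>s\<in>T. \<Sum>y=1..N. \<Sum>t\<in>T.
      if r g (r t (r h y)) = r s y then m t (r h y) * cnj (m s y) else 0)"
    by (rule sum.swap)
  also have "\<dots> = (\<Sum>s\<in>T. \<Sum>t\<in>T. \<Sum>y=1..N.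
      if r g (r t (r h y)) = r s y then m t (r h y) * cnj (m s y) else 0)"
    by (rule sum.cong[OF refl]) (rule sum.swap)
  finally show ?thesis .
qed

text \<open>
  Only the part \<open>u\<close> of \<open>w\<close> is measured in the norm on the complement of the constants; the rest is
  paid for in \<open>\<ell>\<^sup>1\<close>. The orthogonality \<open>f \<bottom> 1\<close> is what brings in that norm.
\<close>

lemma perp_pairing_bound:
  assumes w: "w \<in> group_algebra G" and u: "u \<in> group_algebra G"
    and f: "f \<in> const_perp N" "\<And>y. cmod (f y) \<le> b" and h: "h \<in> ell2 {1..N}" "\<And>y. cmod (h y) \<le> b"
  shows "cmod (ell2_inner {1..N} h (mat_app N (rep_mat r w) f))
    \<le> b\<^sup>2 * real N * (perp_norm N r u + l1_norm (\<lambda>k. w k - u k))"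
proof -
  let ?X = "{1..N}"
  let ?d = "\<lambda>k. w k - u k" and ?op = "perp_norm N r u"
  have b0: "0 \<le> b" using f(2)[of 0] norm_ge_zero order_trans by blast
  have d: "?d \<in> group_algebra G" using group_algebra_lincomb[OF w u, of 1 "-1"] by simp
  have fe: "f \<in> ell2 ?X" using f(1) by (simp add: const_perp_def)
  have n: "ell2_norm ?X k \<le> b * sqrt (real N)" if "\<And>y. cmod (k y) \<le> b" for k
  proof -
    have "(ell2_norm ?X k)\<^sup>2 \<le> (\<Sum>x=1..N. b\<^sup>2)"
      unfolding ell2_norm_finite by (intro sum_mono power_mono that norm_ge_zero)
    also have "\<dots> = (b * sqrt (real N))\<^sup>2" by (simp add: power_mult_distrib)
    finally show ?thesis using b0 by (intro power2_le_imp_le[where x = "ell2_norm ?X k"]) auto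
  qed
  have split: "mat_app N (rep_mat r w) f = (\<lambda>x. mat_app N (rep_mat r u) f x + mat_app N (rep_mat r ?d) f x)"
  proof
    fix x show "mat_app N (rep_mat r w) f x = mat_app N (rep_mat r u) f x + mat_app N (rep_mat r ?d) f x"
      using rep_lincomb[OF u d, of x 1 1 f] by (cases "x \<in> ?X") (auto simp: mat_app_def)
  qed
  have "cmod (ell2_inner ?X h (mat_app N (rep_mat r w) f))
      \<le> ell2_norm ?X h * ell2_norm ?X (mat_app N (rep_mat r w) f)"
    by (rule ell2_cauchy_schwarz[OF h(1) rep_ell2(1)[OF w fe]])
  also have "ell2_norm ?X (mat_app N (rep_mat r w) f)
      \<le> ell2_norm ?X (mat_app N (rep_mat r u) f) + ell2_norm ?X (mat_app N (rep_mat r ?d) f)"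
    unfolding split by (rule ell2_add(2)[OF rep_ell2(1)[OF u fe] rep_ell2(1)[OF d fe]])
  also have "\<dots> \<le> ?op * ell2_norm ?X f + l1_norm ?d * ell2_norm ?X f"
    by (intro add_mono rep_le_op_norm_perp[OF u f(1)] rep_ell2(2)[OF d fe])
  finally have 1: "cmod (ell2_inner ?X h (mat_app N (rep_mat r w) f))
      \<le> ell2_norm ?X h * (?op * ell2_norm ?X f + l1_norm ?d * ell2_norm ?X f)"
    by (simp add: mult_left_mono)
  have op0: "0 \<le> ?op"
  proof -
    have "(\<lambda>x. 0) \<in> const_perp N" by (simp add: const_perp_def ell2_inner_def)
    then have "ell2_norm ?X (mat_app N (rep_mat r u) (\<lambda>x. 0)) \<le> ?op"
    proof (intro op_norm_on_upper)
      fix k assume k: "k \<in> const_perp N" "ell2_norm ?X k \<le> 1"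
      then have "k \<in> ell2 ?X" by (simp add: const_perp_def)
      from rep_ell2(2)[OF u this]
      show "ell2_norm ?X (mat_app N (rep_mat r u) k) \<le> l1_norm u"
        using mult_left_mono[OF k(2) l1_norm_nonneg[of u]] by simp
    qed auto
    then show ?thesis using ell2_norm_nonneg order_trans by blast
  qed
  have "ell2_norm ?X h * (?op * ell2_norm ?X f + l1_norm ?d * ell2_norm ?X f)
      = (ell2_norm ?X h * ell2_norm ?X f) * (?op + l1_norm ?d)" by (simp add: algebra_simps)
  also have "\<dots> \<le> ((b * sqrt (real N)) * (b * sqrt (real N))) * (?op + l1_norm ?d)"
    using op0 b0 by (intro mult_right_mono mult_mono n f(2) h(2)) auto
  also have "(b * sqrt (real N)) * (b * sqrt (real N)) = b\<^sup>2 * real N"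
    by (simp add: power2_eq_square)
  finally show ?thesis using 1 by simp
qed

text \<open>
  In the expanded trace a quadruple \<open>(g, h, s, t)\<close> contributes a sum over the points \<open>y\<close> with
  \<open>g t h.y = s.y\<close>. If \<open>g t h \<noteq> s\<close> these are the fixed points of a nontrivial element; otherwise all points
  contribute, and the terms of this second kind combine into the pairings
  \<open>\<langle>m\<^sub>s, \<rho>(w) m\<^sub>t\<rangle>\<close> with \<open>w\<close> the convolution kernel of \<open>s\<close> and \<open>t\<close>.
\<close>

lemma local_spectral_bound:
  assumes q1: "poly_pair q1 H1" and q2: "poly_pair q2 H2"
    and T: "finite T" "T \<subseteq> carrier G"
    and m: "\<And>t y. t \<in> T \<Longrightarrow> cmod (m t y) \<le> b" "\<And>t. t \<in> T \<Longrightarrow> m t \<in> const_perp N"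
    and u: "\<And>s t. u s t \<in> group_algebra G"
  shows "cmod (\<Sum>i=1..N. \<Sum>j=1..N. H1 (\<mu> i) * H2 (\<mu> j) * of_real ((cmod (matel (local_mat r T m) j i))\<^sup>2))
    \<le> (\<Sum>g\<in>supp q2. \<Sum>h\<in>supp q1. \<Sum>s\<in>T. \<Sum>t\<in>T. if g \<otimes> t \<otimes> h = s then 0 else
          cmod (q2 g * q1 h) * (b\<^sup>2 * real (fixpts N r (inv s \<otimes> (g \<otimes> t \<otimes> h)))))
      + (\<Sum>s\<in>T. \<Sum>t\<in>T. b\<^sup>2 * real N *
          (perp_norm N r (u s t)
            + l1_norm (\<lambda>k. conv_kernel q1 q2 s t k - u s t k)))"
proof -
  have g1: "q1 \<in> group_algebra G" and g2: "q2 \<in> group_algebra G" using q1 q2 by (auto simp: poly_pair_def)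
  define Y where "Y g h s t = (\<Sum>y=1..N. if r g (r t (r h y)) = r s y then m t (r h y) * cnj (m s y) else 0)"
    for g h s t
  define Z where "Z h s t = (\<Sum>y=1..N. m t (r h y) * cnj (m s y))" for h s t
  define A where "A g h s t = (if g \<otimes> t \<otimes> h = s then 0 else q2 g * q1 h * Y g h s t)" for g h s t
  define B where "B g h s t = (if g \<otimes> t \<otimes> h = s then q2 g * q1 h * Z h s t else 0)" for g h s t
  have c1: "h \<in> carrier G" if "h \<in> supp q1" for h using that group_algebraD(3)[OF g1] by blast
  have c2: "g \<in> carrier G" if "g \<in> supp q2" for g using that group_algebraD(3)[OF g2] by blast
  have cT: "t \<in> carrier G" if "t \<in> T" for t using that T by blast
  have AB: "q2 g * q1 h * Y g h s t = A g h s t + B g h s t"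
    if "g \<in> supp q2" "h \<in> supp q1" "s \<in> T" "t \<in> T" for g h s t
  proof (cases "g \<otimes> t \<otimes> h = s")
    case True
    then have "r g (r t (r h y)) = r s y" for y
      using c1 c2 cT that by (simp flip: True add: r_mult m_assoc)
    then show ?thesis using True by (simp add: A_def B_def Y_def Z_def)
  qed (simp add: A_def B_def)
  have "(\<Sum>i=1..N. \<Sum>j=1..N. H1 (\<mu> i) * H2 (\<mu> j) * of_real ((cmod (matel (local_mat r T m) j i))\<^sup>2))
      = (\<Sum>g\<in>supp q2. \<Sum>h\<in>supp q1. q2 g * q1 h * (\<Sum>s\<in>T. \<Sum>t\<in>T. Y g h s t))"
    unfolding spectral_double_sum[OF q1 q2] Y_def
    by (intro sum.cong refl) (simp only: local_mat_product[OF T c1 c2])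
  also have "\<dots> = (\<Sum>g\<in>supp q2. \<Sum>h\<in>supp q1. \<Sum>s\<in>T. \<Sum>t\<in>T. A g h s t + B g h s t)"
    unfolding sum_distrib_left by (intro sum.cong refl AB)
  also have "\<dots> = (\<Sum>g\<in>supp q2. \<Sum>h\<in>supp q1. \<Sum>s\<in>T. \<Sum>t\<in>T. A g h s t)
      + (\<Sum>g\<in>supp q2. \<Sum>h\<in>supp q1. \<Sum>s\<in>T. \<Sum>t\<in>T. B g h s t)"
    by (simp only: sum.distrib)
  also have "cmod \<dots> \<le> cmod (\<Sum>g\<in>supp q2. \<Sum>h\<in>supp q1. \<Sum>s\<in>T. \<Sum>t\<in>T. A g h s t)
      + cmod (\<Sum>g\<in>supp q2. \<Sum>h\<in>supp q1. \<Sum>s\<in>T. \<Sum>t\<in>T. B g h s t)"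
    by (rule norm_triangle_ineq)
  also have "cmod (\<Sum>g\<in>supp q2. \<Sum>h\<in>supp q1. \<Sum>s\<in>T. \<Sum>t\<in>T. A g h s t)
      \<le> (\<Sum>g\<in>supp q2. \<Sum>h\<in>supp q1. \<Sum>s\<in>T. \<Sum>t\<in>T. if g \<otimes> t \<otimes> h = s then 0 else
          cmod (q2 g * q1 h) * (b\<^sup>2 * real (fixpts N r (inv s \<otimes> (g \<otimes> t \<otimes> h)))))"
  proof (intro sum_norm_le)
    fix g h s t assume in': "g \<in> supp q2" "h \<in> supp q1" "s \<in> T" "t \<in> T"
    note cc = c2[OF in'(1)] c1[OF in'(2)] cT[OF in'(3)] cT[OF in'(4)]
    have "cmod (Y g h s t) \<le> (\<Sum>y=1..N. if r (inv s \<otimes> (g \<otimes> t \<otimes> h)) y = y then b\<^sup>2 else 0)"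
      unfolding Y_def
    proof (intro sum_norm_le)
      fix y
      have "r (inv s \<otimes> (g \<otimes> t \<otimes> h)) y = y" if "r g (r t (r h y)) = r s y"
        using that cc by (simp add: r_mult)
      moreover have "cmod (m t (r h y) * cnj (m s y)) \<le> b\<^sup>2"
        unfolding norm_mult complex_mod_cnj power2_eq_square
        using m(1) in' order_trans[OF norm_ge_zero m(1)[OF in'(3)]] by (intro mult_mono) auto
      ultimately show "cmod (if r g (r t (r h y)) = r s y then m t (r h y) * cnj (m s y) else 0)
          \<le> (if r (inv s \<otimes> (g \<otimes> t \<otimes> h)) y = y then b\<^sup>2 else 0)"
        by auto
    qed
    also have "\<dots> = b\<^sup>2 * real (fixpts N r (inv s \<otimes> (g \<otimes> t \<otimes> h)))"
      unfolding fixpts_def by (subst sum.If_cases) (auto simp: Int_def)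
    finally show "cmod (A g h s t) \<le> (if g \<otimes> t \<otimes> h = s then 0 else
          cmod (q2 g * q1 h) * (b\<^sup>2 * real (fixpts N r (inv s \<otimes> (g \<otimes> t \<otimes> h)))))"
      by (auto simp: A_def norm_mult intro!: mult_left_mono)
  qed
  also have "(\<Sum>g\<in>supp q2. \<Sum>h\<in>supp q1. \<Sum>s\<in>T. \<Sum>t\<in>T. B g h s t)
      = (\<Sum>s\<in>T. \<Sum>t\<in>T. ell2_inner {1..N} (m s) (mat_app N (rep_mat r (conv_kernel q1 q2 s t)) (m t)))"
  proof -
    have "(\<Sum>g\<in>supp q2. \<Sum>h\<in>supp q1. \<Sum>s\<in>T. \<Sum>t\<in>T. B g h s t)
        = (\<Sum>h\<in>supp q1. \<Sum>s\<in>T. \<Sum>t\<in>T. \<Sum>g\<in>supp q2. B g h s t)"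
      by (rule sum_rotate4)
    also have "\<dots> = (\<Sum>h\<in>supp q1. \<Sum>s\<in>T. \<Sum>t\<in>T. q1 h * q2 (s \<otimes> inv h \<otimes> inv t) * Z h s t)"
    proof (intro sum.cong refl)
      fix h s t assume in': "h \<in> supp q1" "s \<in> T" "t \<in> T"
      note cc = c1[OF in'(1)] cT[OF in'(2)] cT[OF in'(3)]
      have "g \<otimes> t \<otimes> h = s \<longleftrightarrow> g = s \<otimes> inv h \<otimes> inv t" if "g \<in> carrier G" for g
        using that cc by (metis inv_closed inv_solve_right m_closed)
      then have "(\<Sum>g\<in>supp q2. B g h s t)
          = (\<Sum>g\<in>supp q2. if g = s \<otimes> inv h \<otimes> inv t then q2 g * q1 h * Z h s t else 0)"
        using c2 by (intro sum.cong refl) (simp add: B_def)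
      also have "\<dots> = q1 h * q2 (s \<otimes> inv h \<otimes> inv t) * Z h s t"
        using group_algebraD(1)[OF g2] by (simp add: supp_def)
      finally show "(\<Sum>g\<in>supp q2. B g h s t) = q1 h * q2 (s \<otimes> inv h \<otimes> inv t) * Z h s t" .
    qed
    also have "\<dots> = (\<Sum>s\<in>T. \<Sum>t\<in>T. \<Sum>h\<in>supp q1. q1 h * q2 (s \<otimes> inv h \<otimes> inv t) * Z h s t)"
      by (rule sum_rotate3)
    also have "\<dots> = (\<Sum>s\<in>T. \<Sum>t\<in>T. ell2_inner {1..N} (m s) (mat_app N (rep_mat r (conv_kernel q1 q2 s t)) (m t)))"
    proof (intro sum.cong refl)
      fix s t assume st: "s \<in> T" "t \<in> T"
      let ?w = "conv_kernel q1 q2 s t"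
      have inj: "inj_on (\<lambda>g. inv g) (supp q1)" by (intro inj_onI) (metis c1 inv_inv)
      have "ell2_inner {1..N} (m s) (mat_app N (rep_mat r ?w) (m t))
          = (\<Sum>y=1..N. \<Sum>k\<in>(\<lambda>g. inv g) ` supp q1. cnj (m s y) * (?w k * m t (r (inv k) y)))"
        unfolding ell2_inner_finite
        by (intro sum.cong refl)
          (simp only: rep_apply_superset[OF conv_kernel_supp(1)[OF g1] conv_kernel_supp(3)[OF g1] conv_kernel_supp(2)[OF g1]]
            sum_distrib_left)
      also have "\<dots> = (\<Sum>h\<in>supp q1. \<Sum>y=1..N. cnj (m s y) * (?w (inv h) * m t (r (inv (inv h)) y)))"
        unfolding sum.reindex[OF inj] comp_def by (rule sum.swap)
      also have "\<dots> = (\<Sum>h\<in>supp q1. q1 h * q2 (s \<otimes> inv h \<otimes> inv t) * Z h s t)"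
        unfolding Z_def sum_distrib_left
        by (intro sum.cong refl) (simp add: c1 conv_kernel_def mult_ac)
      finally show "(\<Sum>h\<in>supp q1. q1 h * q2 (s \<otimes> inv h \<otimes> inv t) * Z h s t)
        = ell2_inner {1..N} (m s) (mat_app N (rep_mat r ?w) (m t))" by simp
    qed
    finally show ?thesis .
  qed
  also have "cmod \<dots> \<le> (\<Sum>s\<in>T. \<Sum>t\<in>T. b\<^sup>2 * real N *
          (perp_norm N r (u s t)
            + l1_norm (\<lambda>k. conv_kernel q1 q2 s t k - u s t k)))"
  proof (intro sum_norm_le)
    fix s t assume st: "s \<in> T" "t \<in> T"
    have "m s \<in> ell2 {1..N}" using m(2)[OF st(1)] by (simp add: const_perp_def)
    then show "cmod (ell2_inner {1..N} (m s) (mat_app N (rep_mat r (conv_kernel q1 q2 s t)) (m t)))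
      \<le> b\<^sup>2 * real N * (perp_norm N r (u s t)
            + l1_norm (\<lambda>k. conv_kernel q1 q2 s t k - u s t k))"
      by (rule perp_pairing_bound[OF conv_kernel_supp(4)[OF g1] u m(2)[OF st(2)] m(1)[OF st(2)] _ m(1)[OF st(1)]])
  qed
  finally show ?thesis by simp
qed

lemma local_mat_hs_bound:
  assumes T: "finite T" "T \<subseteq> carrier G"
    and m: "\<And>t y. t \<in> T \<Longrightarrow> cmod (m t y) \<le> b"
  shows "(\<Sum>i=1..N. \<Sum>j=1..N. (cmod (matel (local_mat r T m) j i))\<^sup>2) \<le> b\<^sup>2 * (real (card T))\<^sup>2 * real N"
proof -
  have "complex_of_real (\<Sum>i=1..N. \<Sum>j=1..N. (cmod (matel (local_mat r T m) j i))\<^sup>2)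
      = (\<Sum>x=1..N. \<Sum>y=1..N. local_mat r T m x (r \<one> y) * cnj (local_mat r T m (r \<one> x) y))"
    unfolding spectral_parseval of_real_sum complex_norm_square r_one ..
  also have "\<dots> = (\<Sum>s\<in>T. \<Sum>t\<in>T. \<Sum>y=1..N. if r \<one> (r t (r \<one> y)) = r s y then m t (r \<one> y) * cnj (m s y) else 0)"
    by (rule local_mat_product[OF T]) auto
  also have "cmod \<dots> \<le> (\<Sum>s\<in>T. \<Sum>t\<in>T. \<Sum>y=1..N. b\<^sup>2)"
  proof (intro sum_norm_le)
    fix s t y assume st: "s \<in> T" "t \<in> T"
    have "cmod (m t (r \<one> y) * cnj (m s y)) \<le> b\<^sup>2"
      unfolding norm_mult complex_mod_cnj power2_eq_square
      using m st order_trans[OF norm_ge_zero m[OF st(1)]] by (intro mult_mono) auto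
    then show "cmod (if r \<one> (r t (r \<one> y)) = r s y then m t (r \<one> y) * cnj (m s y) else 0) \<le> b\<^sup>2"
      by auto
  qed
  also have "\<dots> = b\<^sup>2 * (real (card T))\<^sup>2 * real N" by (simp add: power2_eq_square)
  finally have "\<bar>\<Sum>i=1..N. \<Sum>j=1..N. (cmod (matel (local_mat r T m) j i))\<^sup>2\<bar> \<le> b\<^sup>2 * (real (card T))\<^sup>2 * real N"
    unfolding norm_of_real .
  then show ?thesis by linarith
qed

lemma matel_add: "matel (\<lambda>x y. M x y + M' x y) j i = matel M j i + matel M' j i"
proof -
  have "mat_app N (\<lambda>x y. M x y + M' x y) f = (\<lambda>x. mat_app N M f x + mat_app N M' f x)" for f
    by (auto simp: mat_app_def sum.distrib distrib_right)
  then show ?thesis unfolding mat_elem_def ell2_inner_finite by (simp add: sum.distrib distrib_left)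
qed

abbreviation "wsum \<equiv> weighted_sum N \<phi> \<mu>"

lemma wsum_add_le:
  assumes "\<And>x. 0 \<le> F1 x" "\<And>x. 0 \<le> F2 x"
  shows "wsum F1 F2 (\<lambda>x y. M x y + M' x y) \<le> 2 * wsum F1 F2 M + 2 * wsum F1 F2 M'"
  unfolding weighted_sum_def sum_distrib_left sum.distrib[symmetric]
proof (intro sum_mono)
  fix i j
  have "(cmod (matel (\<lambda>x y. M x y + M' x y) j i))\<^sup>2 \<le> (cmod (matel M j i) + cmod (matel M' j i))\<^sup>2"
    unfolding matel_add by (intro power_mono norm_triangle_ineq) auto
  also have "\<dots> \<le> 2 * (cmod (matel M j i))\<^sup>2 + 2 * (cmod (matel M' j i))\<^sup>2"
    using sum_squares_bound[of "cmod (matel M j i)" "cmod (matel M' j i)"] by (simp only: power2_sum)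
  finally have "F1 (\<mu> i) * F2 (\<mu> j) * (cmod (matel (\<lambda>x y. M x y + M' x y) j i))\<^sup>2
      \<le> F1 (\<mu> i) * F2 (\<mu> j) * (2 * (cmod (matel M j i))\<^sup>2 + 2 * (cmod (matel M' j i))\<^sup>2)"
    using assms by (intro mult_left_mono) auto
  then show "F1 (\<mu> i) * F2 (\<mu> j) * (cmod (matel (\<lambda>x y. M x y + M' x y) j i))\<^sup>2
      \<le> 2 * (F1 (\<mu> i) * F2 (\<mu> j) * (cmod (matel M j i))\<^sup>2) + 2 * (F1 (\<mu> i) * F2 (\<mu> j) * (cmod (matel M' j i))\<^sup>2)"
    by (simp only: distrib_left mult_ac)
qed

lemma wsum_le_hs:
  assumes F: "\<And>x. 0 \<le> F1 x" "\<And>x. F1 x \<le> B" "\<And>x. 0 \<le> F2 x" "\<And>x. F2 x \<le> B"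
  shows "wsum F1 F2 M \<le> B\<^sup>2 * (\<Sum>x=1..N. \<Sum>y=1..N. (cmod (M x y))\<^sup>2)"
proof -
  have "0 \<le> B" using F(1,2) order_trans by blast
  then have "wsum F1 F2 M \<le> (\<Sum>i=1..N. \<Sum>j=1..N. B\<^sup>2 * (cmod (matel M j i))\<^sup>2)"
    unfolding weighted_sum_def power2_eq_square[of B]
    using F by (intro sum_mono mult_right_mono mult_mono) auto
  then show ?thesis unfolding sum_distrib_left[symmetric] spectral_parseval .
qed

lemma wsum_perturb:
  assumes F: "\<And>x. 0 \<le> F1 x" "\<And>x. F1 x \<le> B" "\<And>x. 0 \<le> F2 x" "\<And>x. F2 x \<le> B"
    and d: "0 \<le> \<delta>" "\<delta> \<le> 1"
    and H1: "\<And>x. \<bar>x\<bar> \<le> l1_norm p \<Longrightarrow> cmod (of_real (F1 x) - H1 x) \<le> \<delta>"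
    and H2: "\<And>x. \<bar>x\<bar> \<le> l1_norm p \<Longrightarrow> cmod (of_real (F2 x) - H2 x) \<le> \<delta>"
  shows "wsum F1 F2 M
    \<le> cmod (\<Sum>i=1..N. \<Sum>j=1..N. H1 (\<mu> i) * H2 (\<mu> j) * of_real ((cmod (matel M j i))\<^sup>2))
      + \<delta> * (2 * B + 1) * (\<Sum>i=1..N. \<Sum>j=1..N. (cmod (matel M j i))\<^sup>2)"
proof -
  have B0: "0 \<le> B" using F(1,2) order_trans by blast
  define SH where "SH = (\<Sum>i=1..N. \<Sum>j=1..N. H1 (\<mu> i) * H2 (\<mu> j) * of_real ((cmod (matel M j i))\<^sup>2))"
  have "cmod (of_real (wsum F1 F2 M) - SH)
      = cmod (\<Sum>i=1..N. \<Sum>j=1..N. (of_real (F1 (\<mu> i)) * of_real (F2 (\<mu> j)) - H1 (\<mu> i) * H2 (\<mu> j))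
          * of_real ((cmod (matel M j i))\<^sup>2))"
    unfolding weighted_sum_def SH_def of_real_sum of_real_mult sum_subtractf[symmetric] left_diff_distrib ..
  also have "\<dots> \<le> (\<Sum>i=1..N. \<Sum>j=1..N. \<delta> * (2 * B + 1) * (cmod (matel M j i))\<^sup>2)"
  proof (intro sum_norm_le)
    fix i j assume ij: "i \<in> {1..N}" "j \<in> {1..N}"
    let ?x = "of_real (F1 (\<mu> i)) :: complex" and ?y = "of_real (F2 (\<mu> j)) :: complex"
    let ?x' = "H1 (\<mu> i)" and ?y' = "H2 (\<mu> j)"
    have x: "cmod (?x - ?x') \<le> \<delta>" by (rule H1[OF eigenvalue_le[OF ij(1)]])
    have y: "cmod (?y - ?y') \<le> \<delta>" by (rule H2[OF eigenvalue_le[OF ij(2)]])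
    have xB: "cmod ?x \<le> B" "cmod ?y \<le> B" using F by (simp_all add: norm_of_real)
    have "cmod ?y' \<le> cmod ?y + cmod (?y - ?y')"
      using norm_triangle_sub[of ?y' ?y] by (simp only: norm_minus_commute)
    then have h: "cmod ?y' \<le> B + 1" using xB y d(2) by linarith
    have "cmod (?x * ?y - ?x' * ?y') = cmod (?x * (?y - ?y') + (?x - ?x') * ?y')"
      by (simp add: algebra_simps)
    also have "\<dots> \<le> cmod ?x * cmod (?y - ?y') + cmod (?x - ?x') * cmod ?y'"
      using norm_triangle_ineq[of "?x * (?y - ?y')" "(?x - ?x') * ?y'"] by (simp only: norm_mult)
    also have "\<dots> \<le> B * \<delta> + \<delta> * (B + 1)"
      using d(1) B0 by (intro add_mono mult_mono x y xB h) auto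
    finally have "cmod (?x * ?y - ?x' * ?y') \<le> \<delta> * (2 * B + 1)"
      by (simp add: algebra_simps)
    then show "cmod ((?x * ?y - ?x' * ?y') * of_real ((cmod (matel M j i))\<^sup>2))
        \<le> \<delta> * (2 * B + 1) * (cmod (matel M j i))\<^sup>2"
      unfolding norm_mult using d(1) B0 by (intro mult_mono) (auto simp: norm_power)
  qed
  also have "\<dots> = \<delta> * (2 * B + 1) * (\<Sum>i=1..N. \<Sum>j=1..N. (cmod (matel M j i))\<^sup>2)"
    by (simp only: sum_distrib_left)
  finally have "cmod (of_real (wsum F1 F2 M) :: complex)
      \<le> cmod SH + \<delta> * (2 * B + 1) * (\<Sum>i=1..N. \<Sum>j=1..N. (cmod (matel M j i))\<^sup>2)"
    using norm_triangle_sub[of "of_real (wsum F1 F2 M) :: complex" SH] by linarith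
  then show ?thesis unfolding norm_of_real SH_def by linarith
qed

end

section \<open>Limits along the sequence of representations\<close>

lemma eventually_along: "eventually Q (along \<N>) \<longleftrightarrow> eventually (\<lambda>N. N \<in> \<N> \<longrightarrow> Q N) sequentially"
  by (simp add: eventually_inf_principal)

lemma eventually_along_mem: "\<forall>\<^sub>F N in along \<N>. N \<in> \<N>"
  by (simp add: eventually_along)

locale mixing_sequence = regular_operator G p for G (structure) and p +
  fixes \<N> :: "nat set" and \<rho> :: "nat \<Rightarrow> 'a \<Rightarrow> nat \<Rightarrow> nat"
    and \<phi> K :: "nat \<Rightarrow> nat \<Rightarrow> nat \<Rightarrow> complex" and \<mu> :: "nat \<Rightarrow> nat \<Rightarrow> real" and T :: "'a set"
  assumes zero_notin: "0 \<notin> \<N>"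
    and rho_hom: "\<And>N. N \<in> \<N> \<Longrightarrow> \<rho> N \<in> hom G (sym_group N)"
    and strong: "converges_strongly_in_distribution G \<N> \<rho>"
    and eigenbasis: "\<And>N. N \<in> \<N> \<Longrightarrow> orthonormal_eigenbasis N (rep_mat (\<rho> N) p) (\<phi> N) (\<mu> N)"
    and T_fin: "finite T" and T_sub: "T \<subseteq> carrier G"
    and K_local: "\<And>N. N \<in> \<N> \<Longrightarrow> is_local N (\<rho> N) T (K N)"
    and K_norm: "\<And>N. N \<in> \<N> \<Longrightarrow> norm_1_inf N (K N) \<le> 1"
begin

lemma action: "N \<in> \<N> \<Longrightarrow> eigen_action G N (\<rho> N) p (\<phi> N) (\<mu> N)"
  using rho_hom eigenbasis by unfold_locales

lemma N_pos: "N \<in> \<N> \<Longrightarrow> 0 < N"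
  using zero_notin by (metis gr0I)

lemma fixpts_limit:
  assumes "g \<in> X" "g \<noteq> \<one>"
  shows "((\<lambda>N. real (fixpts N (\<rho> N) g) / real N) \<longlongrightarrow> 0) (along \<N>)"
proof -
  have "((\<lambda>N. (\<Sum>x=1..N. perm_mat (\<rho> N g) x x) / of_nat N) \<longlongrightarrow> 0) (along \<N>)"
    using strong assms unfolding converges_strongly_in_distribution_def converges_in_distribution_def by blast
  from tendsto_norm_zero[OF this] show ?thesis
  proof (rule Lim_transform_eventually)
    show "\<forall>\<^sub>F N in along \<N>. cmod ((\<Sum>x=1..N. perm_mat (\<rho> N g) x x) / of_nat N) = real (fixpts N (\<rho> N) g) / real N"
      using eventually_along_mem
    proof eventually_elim
      case (elim N)
      interpret eigen_action G N "\<rho> N" p "\<phi> N" "\<mu> N" by (rule action[OF elim])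
      show ?case unfolding trace_perm_mat by (simp add: norm_divide)
    qed
  qed
qed

text \<open>
  Errors of size \<open>o(N)\<close>. All of them come from fixed points of nontrivial elements, whose number is
  \<open>o(N)\<close> by convergence in distribution.
\<close>

definition negligible :: "(nat \<Rightarrow> real) \<Rightarrow> bool" where
  "negligible f \<longleftrightarrow> ((\<lambda>N. f N / real N) \<longlongrightarrow> 0) (along \<N>)"

lemma negligible_fixpts:
  "g \<in> X \<Longrightarrow> g \<noteq> \<one> \<Longrightarrow> negligible (\<lambda>N. real (fixpts N (\<rho> N) g))"
  unfolding negligible_def by (rule fixpts_limit)

lemma negligible_cmult: "negligible f \<Longrightarrow> negligible (\<lambda>N. c * f N)"
  unfolding negligible_def using tendsto_mult_right_zero[of "\<lambda>N. f N / real N" "along \<N>" c] by simp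

lemma negligible_sum: "(\<And>a. a \<in> A \<Longrightarrow> negligible (\<lambda>N. f N a)) \<Longrightarrow> negligible (\<lambda>N. \<Sum>a\<in>A. f N a)"
  unfolding negligible_def sum_divide_distrib by (rule tendsto_null_sum)

lemma negligible_if_else: "(\<not> b \<Longrightarrow> negligible f) \<Longrightarrow> negligible (\<lambda>N. if b then 0 else f N)"
  by (cases b) (auto simp: negligible_def)

lemma negligible_if_then: "(b \<Longrightarrow> negligible f) \<Longrightarrow> negligible (\<lambda>N. if b then f N else 0)"
  by (cases b) (auto simp: negligible_def)

lemma negligibleD:
  assumes "negligible f" "e > 0"
  shows "\<forall>\<^sub>F N in along \<N>. f N \<le> e * real N"
  using order_tendstoD(2)[OF assms(1)[unfolded negligible_def] assms(2)] eventually_along_mem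
proof eventually_elim
  case (elim N)
  then show ?case using N_pos[OF elim(2)] by (simp add: field_simps)
qed

lemma fixpts_sum_limit:
  assumes "q \<in> group_algebra G"
  shows "((\<lambda>N. (\<Sum>g\<in>supp q. q g * of_nat (fixpts N (\<rho> N) g)) / of_nat N) \<longlongrightarrow> q \<one>) (along \<N>)"
proof -
  have one: "\<forall>\<^sub>F N in along \<N>. real (fixpts N (\<rho> N) \<one>) / real N = 1"
    using eventually_along_mem
  proof eventually_elim
    case (elim N)
    interpret eigen_action G N "\<rho> N" p "\<phi> N" "\<mu> N" by (rule action[OF elim])
    have "{y \<in> {1..N}. \<rho> N \<one> y = y} = {1..N}" by (auto simp: r_one)
    then have "fixpts N (\<rho> N) \<one> = N" by (simp add: fixpts_def)
    then show ?case using N_pos[OF elim] by simp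
  qed
  have "((\<lambda>N. real (fixpts N (\<rho> N) g) / real N) \<longlongrightarrow> (if g = \<one> then 1 else 0)) (along \<N>)"
    if "g \<in> supp q" for g
    using fixpts_limit[of g] group_algebraD(3)[OF assms that] tendsto_eventually[OF one] by auto
  then have "((\<lambda>N. \<Sum>g\<in>supp q. q g * of_real (real (fixpts N (\<rho> N) g) / real N))
      \<longlongrightarrow> (\<Sum>g\<in>supp q. q g * of_real (if g = \<one> then 1 else 0))) (along \<N>)"
    by (intro tendsto_sum tendsto_mult tendsto_const tendsto_of_real)
  moreover have "(\<Sum>g\<in>supp q. q g * of_real (if g = \<one> then 1 else 0)) = q \<one>"
  proof -
    have "(\<Sum>g\<in>supp q. q g * of_real (if g = \<one> then 1 else 0)) = (\<Sum>g\<in>supp q. if g = \<one> then q g else 0)"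
      by (rule sum.cong) auto
    then show ?thesis using group_algebraD(1)[OF assms] by (simp add: supp_def)
  qed
  ultimately show ?thesis by (simp add: sum_divide_distrib)
qed

text \<open>
  Convergence of the spectral measures of \<open>P\<^sub>N\<close> to that of \<open>P\<close> at \<open>\<delta>\<^sub>e\<close>. For a polynomial \<open>F\<close> the left-hand
  side is the normalised trace of an element of the group algebra, of which only the coefficient of the
  unit survives in the limit.
\<close>

lemma spectral_measure_limit:
  assumes "spectral_pair v F"
  shows "((\<lambda>N. (\<Sum>i=1..N. F (\<mu> N i)) / of_nat N) \<longlongrightarrow> v \<one>) (along \<N>)"
proof (rule tendstoI)
  fix e :: real assume e: "e > 0"
  then have "e / 4 > 0" by simp
  then obtain q H where q: "poly_pair q H" "ell2_norm X (\<lambda>x. v x - q x) \<le> e / 4"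
    "\<And>x. \<bar>x\<bar> \<le> l1_norm p \<Longrightarrow> cmod (F x - H x) \<le> e / 4"
    using assms unfolding spectral_pair_def by blast
  have qg: "q \<in> group_algebra G" using q(1) by (simp add: poly_pair_def)
  have "cmod (v \<one> - q \<one>) \<le> e / 4"
    using cmod_le_ell2_norm[OF ell2_diff(1)[OF _ group_algebra_ell2[OF qg]], of v \<one>] q(2) assms
    unfolding spectral_pair_def by (auto intro: order_trans)
  have "\<forall>\<^sub>F N in along \<N>. dist ((\<Sum>g\<in>supp q. q g * of_nat (fixpts N (\<rho> N) g)) / of_nat N) (q \<one>) < e / 4"
    using tendstoD[OF fixpts_sum_limit[OF qg], of "e / 4"] e by simp
  with eventually_along_mem
  show "\<forall>\<^sub>F N in along \<N>. dist ((\<Sum>i=1..N. F (\<mu> N i)) / of_nat N) (v \<one>) < e"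
  proof eventually_elim
    case (elim N)
    interpret eigen_action G N "\<rho> N" p "\<phi> N" "\<mu> N" by (rule action[OF elim(1)])
    have "cmod ((\<Sum>i=1..N. F (\<mu> N i)) - (\<Sum>i=1..N. H (\<mu> N i))) \<le> (\<Sum>i=1..N. e / 4)"
      unfolding sum_subtractf[symmetric] by (intro sum_norm_le q(3) eigenvalue_le)
    then have "cmod ((\<Sum>i=1..N. F (\<mu> N i)) / of_nat N - (\<Sum>i=1..N. H (\<mu> N i)) / of_nat N) \<le> e / 4"
      using N_pos[OF elim(1)] by (simp add: diff_divide_distrib[symmetric] norm_divide field_simps)
    moreover have "dist ((\<Sum>i=1..N. H (\<mu> N i)) / of_nat N) (q \<one>) < e / 4"
      using elim(2) unfolding spectral_trace[OF q(1)] .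
    ultimately show ?case
      using \<open>cmod (v \<one> - q \<one>) \<le> e / 4\<close> e
        dist_triangle[of "(\<Sum>i=1..N. F (\<mu> N i)) / of_nat N" "v \<one>" "(\<Sum>i=1..N. H (\<mu> N i)) / of_nat N"]
        dist_triangle[of "(\<Sum>i=1..N. H (\<mu> N i)) / of_nat N" "v \<one>" "q \<one>"]
      unfolding dist_norm norm_minus_commute[of "q \<one>"] by linarith
  qed
qed

text \<open>
  Subtracting the average makes each of these functions orthogonal to the constants.
\<close>

definition mcoef :: "nat \<Rightarrow> 'a \<Rightarrow> nat \<Rightarrow> complex" where
  "mcoef N t y = (if y \<in> {1..N} \<and> t \<in> T then K N (\<rho> N t y) y - avg_coeff N (\<rho> N) T (K N) t else 0)"

definition centred :: "nat \<Rightarrow> nat \<Rightarrow> nat \<Rightarrow> complex" where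
  "centred N x y = K N x y - average N (\<rho> N) T (K N) x y"

lemma K_bound:
  assumes "N \<in> \<N>" "x \<in> {1..N}" "y \<in> {1..N}"
  shows "cmod (K N x y) \<le> 1"
proof -
  have "cmod (K N x y) \<le> norm_1_inf N (K N)"
    unfolding norm_1_inf_def by (rule Max_ge) (use assms in \<open>auto intro!: rev_image_eqI[of "(x, y)"]\<close>)
  then show ?thesis using K_norm[OF assms(1)] by linarith
qed

lemma mcoef_bound:
  assumes N: "N \<in> \<N>"
  shows "cmod (mcoef N t y) \<le> 2" "mcoef N t \<in> const_perp N"
proof -
  interpret eigen_action G N "\<rho> N" p "\<phi> N" "\<mu> N" by (rule action[OF N])
  have in': "\<rho> N t y \<in> {1..N}" if "t \<in> T" "y \<in> {1..N}" for t y
    unfolding r_in[OF subsetD[OF T_sub that(1)]] by (rule that(2))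
  have avg: "cmod (avg_coeff N (\<rho> N) T (K N) t) \<le> 1" for t
  proof (cases "t \<in> T")
    case True
    have "cmod (\<Sum>x=1..N. K N (\<rho> N t x) x) \<le> (\<Sum>x=1..N. 1)"
      by (intro sum_norm_le K_bound[OF N] in' True)
    then show ?thesis using True N_pos[OF N] by (simp add: avg_coeff_def norm_divide)
  qed (simp add: avg_coeff_def)
  show "cmod (mcoef N t y) \<le> 2"
  proof (cases "y \<in> {1..N} \<and> t \<in> T")
    case True
    then have "cmod (mcoef N t y) \<le> cmod (K N (\<rho> N t y) y) + cmod (avg_coeff N (\<rho> N) T (K N) t)"
      by (simp add: mcoef_def norm_triangle_ineq4 del: One_nat_def)
    then show ?thesis using K_bound[OF N in'[of t y], of y] True avg[of t] by fastforce
  next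
    case False
    then have "mcoef N t y = 0" unfolding mcoef_def by (rule if_not_P)
    then show ?thesis by simp
  qed
  have "(\<Sum>y=1..N. mcoef N t y) = 0"
  proof (cases "t \<in> T")
    case True
    then have "(\<Sum>y=1..N. mcoef N t y) = (\<Sum>y=1..N. K N (\<rho> N t y) y - avg_coeff N (\<rho> N) T (K N) t)"
      by (intro sum.cong) (auto simp: mcoef_def)
    also have "\<dots> = 0" using True N_pos[OF N] by (simp add: sum_subtractf avg_coeff_def)
    finally show ?thesis .
  qed (simp add: mcoef_def)
  then show "mcoef N t \<in> const_perp N"
    unfolding const_perp_def mem_Collect_eq ell2_inner_finite ell2_finite_iff by (auto simp: mcoef_def)
qed

text \<open>
  \<open>K - \<langle>K\<rangle>\<close> differs from \<open>\<Sum>\<^sub>t \<rho>(t) D\<^sub>t\<close> only at entries \<open>(x, y)\<close> with \<open>x = s.y = t.y\<close> for two distinct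
  \<open>s, t \<in> T\<close>, since there the local matrix counts the entry of \<open>K\<close> several times. Such \<open>y\<close> are fixed points of
  \<open>s\<inverse> t\<close>.
\<close>

lemma defect_bound:
  assumes N: "N \<in> \<N>"
  shows "(\<Sum>x=1..N. \<Sum>y=1..N. (cmod (centred N x y - local_mat (\<rho> N) T (mcoef N) x y))\<^sup>2)
    \<le> (\<Sum>s\<in>T. \<Sum>t\<in>T. if s \<noteq> t then (real (card T))\<^sup>2 * real (fixpts N (\<rho> N) (inv s \<otimes> t)) else 0)"
proof -
  interpret eigen_action G N "\<rho> N" p "\<phi> N" "\<mu> N" by (rule action[OF N])
  let ?r = "\<rho> N" and ?c = "(real (card T))\<^sup>2"
  let ?e = "\<lambda>x y s t. if s \<noteq> t \<and> x = ?r s y \<and> x = ?r t y then ?c else 0"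
  have pt: "(cmod (centred N x y - local_mat ?r T (mcoef N) x y))\<^sup>2 \<le> (\<Sum>s\<in>T. \<Sum>t\<in>T. ?e x y s t)"
    if x: "x \<in> {1..N}" and y: "y \<in> {1..N}" for x y
  proof -
    define A where "A = {t \<in> T. x = ?r t y}"
    have fA: "finite A" "card A \<le> card T" using T_fin by (auto simp: A_def intro!: card_mono)
    have "supp (avg_coeff N ?r T (K N)) \<subseteq> T" by (auto simp: supp_def avg_coeff_def)
    from rep_mat_superset[OF T_fin this]
    have av: "average N ?r T (K N) x y = (\<Sum>t\<in>T. avg_coeff N ?r T (K N) t * perm_mat (?r t) x y)"
      by (simp add: average_def)
    have "local_mat ?r T (mcoef N) x y + average N ?r T (K N) x y
        = (\<Sum>t\<in>T. if x = ?r t y then K N x y else 0)"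
      unfolding local_mat_def av sum.distrib[symmetric]
      by (intro sum.cong refl) (use y in \<open>auto simp: perm_mat_def mcoef_def\<close>)
    also have "\<dots> = of_nat (card A) * K N x y"
      unfolding A_def by (subst sum.inter_filter[OF T_fin, symmetric]) (rule sum_constant)
    finally have e: "centred N x y - local_mat ?r T (mcoef N) x y = K N x y - of_nat (card A) * K N x y"
      by (simp add: centred_def algebra_simps)
    have nn: "0 \<le> (\<Sum>s\<in>T. \<Sum>t\<in>T. ?e x y s t)" by (intro sum_nonneg) auto
    consider "card A = 0" | "card A = 1" | "card A \<ge> 2" by linarith
    then show ?thesis
    proof cases
      case 1
      then have "K N x y = 0" using K_local[OF N] x y fA unfolding is_local_def A_def by auto
      then show ?thesis using nn by (simp add: e)
    next
      case 2
      then show ?thesis using nn by (simp add: e)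
    next
      case 3
      then obtain s t where st: "s \<in> A" "t \<in> A" "s \<noteq> t"
        by (metis One_nat_def card_le_Suc0_iff_eq fA(1) not_less_eq_eq numeral_2_eq_2)
      have "cmod (K N x y - of_nat (card A) * K N x y) = cmod (of_real (1 - real (card A)) * K N x y)"
        by (simp add: algebra_simps)
      also have "\<dots> \<le> real (card T) * 1"
        unfolding norm_mult norm_of_real by (intro mult_mono K_bound[OF N x y]) (use 3 fA in auto)
      finally have "(cmod (centred N x y - local_mat ?r T (mcoef N) x y))\<^sup>2 \<le> ?c"
        unfolding e by (intro power_mono) auto
      also have "?c = ?e x y s t" using st by (simp add: A_def)
      also have "\<dots> \<le> (\<Sum>t\<in>T. ?e x y s t)"
        by (rule member_le_sum) (use st T_fin in \<open>auto simp: A_def\<close>)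
      also have "\<dots> \<le> (\<Sum>s\<in>T. \<Sum>t\<in>T. ?e x y s t)"
        by (rule member_le_sum) (use st T_fin in \<open>auto simp: A_def intro!: sum_nonneg\<close>)
      finally show ?thesis .
    qed
  qed
  have "(\<Sum>x=1..N. \<Sum>y=1..N. (cmod (centred N x y - local_mat ?r T (mcoef N) x y))\<^sup>2)
      \<le> (\<Sum>x=1..N. \<Sum>y=1..N. \<Sum>s\<in>T. \<Sum>t\<in>T. ?e x y s t)"
    by (intro sum_mono pt)
  also have "\<dots> = (\<Sum>s\<in>T. \<Sum>t\<in>T. \<Sum>y=1..N. \<Sum>x=1..N. ?e x y s t)"
    by (subst sum_rotate4[where A = "{1..N}"]) (rule sum_rotate3)
  also have "\<dots> \<le> (\<Sum>s\<in>T. \<Sum>t\<in>T. if s \<noteq> t then ?c * real (fixpts N ?r (inv s \<otimes> t)) else 0)"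
  proof (intro sum_mono)
    fix s t assume st: "s \<in> T" "t \<in> T"
    then have c: "s \<in> X" "t \<in> X" using T_sub by auto
    show "(\<Sum>y=1..N. \<Sum>x=1..N. ?e x y s t) \<le> (if s \<noteq> t then ?c * real (fixpts N ?r (inv s \<otimes> t)) else 0)"
    proof (cases "s = t")
      case False
      have "(\<Sum>x=1..N. ?e x y s t) \<le> (if ?r (inv s \<otimes> t) y = y then ?c else 0)" for y
      proof (cases "?r (inv s \<otimes> t) y = y")
        case True
        have "(\<Sum>x=1..N. ?e x y s t) \<le> (\<Sum>x=1..N. if x = ?r s y then ?c else 0)"
          by (intro sum_mono) auto
        also have "\<dots> \<le> ?c" by (subst sum.delta) auto
        finally show ?thesis using True by simp
      next
        case ne: False
        have no: "\<not> (x = ?r s y \<and> x = ?r t y)" for x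
        proof
          assume "x = ?r s y \<and> x = ?r t y"
          then have "?r t y = ?r s y" by simp
          then have "?r (inv s \<otimes> t) y = ?r (inv s) (?r s y)" using c by (simp only: r_mult inv_closed)
          then show False using ne c by simp
        qed
        have "(\<Sum>x=1..N. ?e x y s t) = 0"
          by (rule sum.neutral, rule ballI, rule if_not_P) (use no in blast)
        then show ?thesis using ne by simp
      qed
      then have "(\<Sum>y=1..N. \<Sum>x=1..N. ?e x y s t) \<le> (\<Sum>y=1..N. if ?r (inv s \<otimes> t) y = y then ?c else 0)"
        by (intro sum_mono)
      also have "\<dots> = ?c * real (fixpts N ?r (inv s \<otimes> t))"
        unfolding fixpts_def by (subst sum.If_cases) (auto simp: Int_def)
      finally show ?thesis using False by simp
    qed simp
  qed
  finally show ?thesis .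
qed

abbreviation "obs N M j i \<equiv> (cmod (mat_elem N (\<phi> N j) M (\<phi> N i)))\<^sup>2"

lemma mat_elem_centred:
  "mat_elem N f (K N) h - mat_elem N f (average N (\<rho> N) T (K N)) h = mat_elem N f (centred N) h"
proof -
  have "mat_app N (centred N) h = (\<lambda>x. mat_app N (K N) h x - mat_app N (average N (\<rho> N) T (K N)) h x)"
    by (auto simp: mat_app_def centred_def sum_subtractf left_diff_distrib)
  then show ?thesis
    unfolding mat_elem_def ell2_inner_finite by (simp add: sum_subtractf right_diff_distrib)
qed

lemma ell2_shifted_pairing:
  assumes A: "finite A" "A \<subseteq> X" and st: "s \<in> X" "t \<in> X" and f: "f \<in> ell2 X" and h: "h \<in> ell2 X"
  shows "(\<Sum>k\<in>A. cmod (f (inv k)) * cmod (h (s \<otimes> k \<otimes> inv t))) \<le> ell2_norm X f * ell2_norm X h"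
proof -
  have inj: "inj_on (\<lambda>k. inv k) A" "inj_on (\<lambda>k. s \<otimes> k \<otimes> inv t) A"
    subgoal by (intro inj_onI) (metis A(2) inv_inv subsetD)
    subgoal using A(2) st by (auto simp: inj_on_def subset_eq)
    done
  have im: "(\<lambda>k. inv k) ` A \<subseteq> X" "(\<lambda>k. s \<otimes> k \<otimes> inv t) ` A \<subseteq> X" using A(2) st by auto
  have "(\<Sum>k\<in>A. cmod (f (inv k)) * cmod (h (s \<otimes> k \<otimes> inv t)))
      = (\<Sum>k\<in>A. \<bar>cmod (f (inv k))\<bar> * \<bar>cmod (h (s \<otimes> k \<otimes> inv t))\<bar>)" by simp
  also have "\<dots> \<le> L2_set (\<lambda>k. cmod (f (inv k))) A * L2_set (\<lambda>k. cmod (h (s \<otimes> k \<otimes> inv t))) A"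
    by (rule L2_set_mult_ineq)
  also have "L2_set (\<lambda>k. cmod (f (inv k))) A = L2_set (\<lambda>k. cmod (f k)) ((\<lambda>k. inv k) ` A)"
    unfolding L2_set_def by (simp add: sum.reindex[OF inj(1)])
  also have "L2_set (\<lambda>k. cmod (h (s \<otimes> k \<otimes> inv t))) A = L2_set (\<lambda>k. cmod (h k)) ((\<lambda>k. s \<otimes> k \<otimes> inv t) ` A)"
    unfolding L2_set_def by (simp add: sum.reindex[OF inj(2)])
  also have "L2_set (\<lambda>k. cmod (f k)) ((\<lambda>k. inv k) ` A) * L2_set (\<lambda>k. cmod (h k)) ((\<lambda>k. s \<otimes> k \<otimes> inv t) ` A)
      \<le> ell2_norm X f * ell2_norm X h"
    using A im by (intro mult_mono L2_set_le_ell2_norm f h) auto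
  finally show ?thesis .
qed

text \<open>
  Approximation in \<open>ell2\<close> of the two factors gives approximation in \<open>\<ell>\<^sup>1\<close> of the product, by the
  Cauchy-Schwarz inequality. The limit kernel is cut off to the finite support of the
  approximating one, which keeps it in the group algebra.
\<close>

lemma conv_kernel_l1_close:
  assumes q: "q1 \<in> group_algebra G" "q2 \<in> group_algebra G" and v: "v1 \<in> ell2 X" "v2 \<in> ell2 X"
    and d: "ell2_norm X (\<lambda>x. v1 x - q1 x) \<le> \<delta>" "ell2_norm X (\<lambda>x. v2 x - q2 x) \<le> \<delta>" "\<delta> \<le> 1"
    and st: "s \<in> X" "t \<in> X"
  shows "l1_norm (\<lambda>k. conv_kernel q1 q2 s t k
      - (if k \<in> supp (conv_kernel q1 q2 s t) then v1 (inv k) * v2 (s \<otimes> k \<otimes> inv t) else 0))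
    \<le> \<delta> * (ell2_norm X v1 + ell2_norm X v2 + 1)"
proof -
  let ?w = "conv_kernel q1 q2 s t"
  let ?d = "\<lambda>k. ?w k - (if k \<in> supp ?w then v1 (inv k) * v2 (s \<otimes> k \<otimes> inv t) else 0)"
  have qe: "q1 \<in> ell2 X" "q2 \<in> ell2 X" using q by (auto intro: group_algebra_ell2)
  have w: "?w \<in> group_algebra G" by (rule conv_kernel_supp(4)[OF q(1)])
  note A = group_algebraD(1,2)[OF w]
  have \<delta>0: "0 \<le> \<delta>" using d(1) ell2_norm_nonneg order_trans by blast
  have "l1_norm ?d = (\<Sum>k\<in>supp ?w. cmod (?d k))"
    unfolding l1_norm_def by (rule sum.mono_neutral_left) (use A in \<open>auto simp: supp_def\<close>)
  also have "\<dots> \<le> (\<Sum>k\<in>supp ?w. cmod (v1 (inv k) - q1 (inv k)) * cmod (q2 (s \<otimes> k \<otimes> inv t))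
      + cmod (v1 (inv k)) * cmod (v2 (s \<otimes> k \<otimes> inv t) - q2 (s \<otimes> k \<otimes> inv t)))"
  proof (rule sum_mono)
    fix k assume k: "k \<in> supp ?w"
    let ?a = "q1 (inv k)" and ?b = "q2 (s \<otimes> k \<otimes> inv t)" and ?a' = "v1 (inv k)" and ?b' = "v2 (s \<otimes> k \<otimes> inv t)"
    have "k \<in> X" using k A(2) by blast
    then have "?d k = - ((?a' - ?a) * ?b + ?a' * (?b' - ?b))"
      using k by (simp add: conv_kernel_def algebra_simps)
    then have "cmod (?d k) = cmod ((?a' - ?a) * ?b + ?a' * (?b' - ?b))"
      by (simp only: norm_minus_cancel)
    also have "\<dots> \<le> cmod (?a' - ?a) * cmod ?b + cmod ?a' * cmod (?b' - ?b)"
      using norm_triangle_ineq[of "(?a' - ?a) * ?b" "?a' * (?b' - ?b)"] by (simp only: norm_mult)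
    finally show "cmod (?d k) \<le> cmod (?a' - ?a) * cmod ?b + cmod ?a' * cmod (?b' - ?b)" .
  qed
  also have "\<dots> \<le> ell2_norm X (\<lambda>x. v1 x - q1 x) * ell2_norm X q2 + ell2_norm X v1 * ell2_norm X (\<lambda>x. v2 x - q2 x)"
    unfolding sum.distrib
    by (intro add_mono ell2_shifted_pairing[OF A st ell2_diff(1)[OF v(1) qe(1)] qe(2)]
        ell2_shifted_pairing[OF A st v(1) ell2_diff(1)[OF v(2) qe(2)]])
  also have "\<dots> \<le> \<delta> * (ell2_norm X v2 + 1) + ell2_norm X v1 * \<delta>"
  proof (intro add_mono mult_mono d ell2_norm_nonneg \<delta>0 order_refl)
    have "ell2_norm X q2 = ell2_norm X (\<lambda>x. v2 x - (v2 x - q2 x))" by simp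
    also have "\<dots> \<le> ell2_norm X v2 + ell2_norm X (\<lambda>x. v2 x - q2 x)"
      by (rule ell2_diff(2)[OF v(2) ell2_diff(1)[OF v(2) qe(2)]])
    finally show "ell2_norm X q2 \<le> ell2_norm X v2 + 1" using d by linarith
  qed
  finally show ?thesis by (simp add: algebra_simps)
qed

text \<open>
  The core of the proof. For fixed approximation quality \<open>\<delta>\<close>, strong convergence turns the pairings on the
  complement of the constants into norms in the regular representation, and the fixed points
  disappear as \<open>N\<close> grows; then \<open>\<delta>\<close> is small enough. The constant \<open>8\<close> is \<open>2\<close> from splitting off the defect
  times \<open>4\<close>, the square of the bound \<open>2\<close> on the functions of \<open>mcoef\<close>.
\<close>

lemma weighted_mixing_limit:
  assumes c1: "spectral_pair v1 (\<lambda>x. of_real (F1 x))" and c2: "spectral_pair v2 (\<lambda>x. of_real (F2 x))"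
    and F: "\<And>x. 0 \<le> F1 x" "\<And>x. F1 x \<le> B" "\<And>x. 0 \<le> F2 x" "\<And>x. F2 x \<le> B"
    and W: "\<And>s t A. s \<in> T \<Longrightarrow> t \<in> T \<Longrightarrow> finite A \<Longrightarrow> A \<subseteq> X \<Longrightarrow>
      op_norm_on X (ell2 X) (left_reg_alg G (\<lambda>k. if k \<in> A then v1 (inv k) * v2 (s \<otimes> k \<otimes> inv t) else 0)) \<le> W"
    and e: "\<epsilon> > 0"
  shows "\<forall>\<^sub>F N in along \<N>. weighted_sum N (\<phi> N) (\<mu> N) F1 F2 (centred N)
    \<le> real N * (8 * (real (card T))\<^sup>2 * W + \<epsilon>)"
proof -
  let ?c = "(real (card T))\<^sup>2"
  have v: "v1 \<in> ell2 X" "v2 \<in> ell2 X" using c1 c2 by (auto simp: spectral_pair_def)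
  have B0: "0 \<le> B" using F(1,2) order_trans by blast
  define V where "V = ell2_norm X v1 + ell2_norm X v2 + 1"
  have V: "V > 0" using ell2_norm_nonneg[of X v1] ell2_norm_nonneg[of X v2] by (simp add: V_def add_nonneg_pos)
  \<comment> \<open>\<open>\<delta> \<kappa>\<close> is the sum of all error terms of the final estimate, divided by \<open>N\<close>\<close>
  define \<kappa> where "\<kappa> = 2 + 8 * ?c * (1 + V) + 8 * ?c * (2 * B + 1) + 2"
  have \<kappa>: "\<kappa> > 0" unfolding \<kappa>_def using V B0 by (intro add_nonneg_pos add_nonneg_nonneg mult_nonneg_nonneg) auto
  define \<delta> where "\<delta> = min 1 (\<epsilon> / \<kappa>)"
  have \<delta>: "\<delta> > 0" "\<delta> \<le> 1" "\<delta> * \<kappa> \<le> \<epsilon>" using e \<kappa> by (auto simp: \<delta>_def min_def field_simps)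
  obtain q1 H1 where q1: "poly_pair q1 H1" "ell2_norm X (\<lambda>x. v1 x - q1 x) \<le> \<delta>"
    "\<And>x. \<bar>x\<bar> \<le> l1_norm p \<Longrightarrow> cmod (of_real (F1 x) - H1 x) \<le> \<delta>"
    using c1 \<delta>(1) unfolding spectral_pair_def by blast
  obtain q2 H2 where q2: "poly_pair q2 H2" "ell2_norm X (\<lambda>x. v2 x - q2 x) \<le> \<delta>"
    "\<And>x. \<bar>x\<bar> \<le> l1_norm p \<Longrightarrow> cmod (of_real (F2 x) - H2 x) \<le> \<delta>"
    using c2 \<delta>(1) unfolding spectral_pair_def by blast
  have g1: "q1 \<in> group_algebra G" and g2: "q2 \<in> group_algebra G" using q1(1) q2(1) by (auto simp: poly_pair_def)
  define u where "u s t = (\<lambda>k. if k \<in> supp (conv_kernel q1 q2 s t) then v1 (inv k) * v2 (s \<otimes> k \<otimes> inv t) else 0)"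
    for s t
  note sw = group_algebraD(1,2)[OF conv_kernel_supp(4)[OF g1]]
  have u: "u s t \<in> group_algebra G" for s t
    by (rule group_algebraI[OF sw[of q2 s t]]) (simp add: u_def)
  have l1: "l1_norm (\<lambda>k. conv_kernel q1 q2 s t k - u s t k) \<le> \<delta> * V" if "s \<in> T" "t \<in> T" for s t
    unfolding u_def V_def
    by (rule conv_kernel_l1_close[OF g1 g2 v q1(2) q2(2) \<delta>(2)]) (use that T_sub in auto)
  have op: "\<forall>\<^sub>F N in along \<N>. \<forall>s\<in>T. \<forall>t\<in>T.
      perp_norm N (\<rho> N) (u s t) \<le> W + \<delta>"
  proof (intro eventually_ball_finite T_fin ballI)
    fix s t assume st: "s \<in> T" "t \<in> T"
    have "((\<lambda>N. perp_norm N (\<rho> N) (u s t))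
        \<longlongrightarrow> op_norm_on X (ell2 X) (left_reg_alg G (u s t))) (along \<N>)"
      using strong u unfolding converges_strongly_in_distribution_def by blast
    moreover have "op_norm_on X (ell2 X) (left_reg_alg G (u s t)) < W + \<delta>"
      using W[OF st sw[of q2 s t]] \<delta>(1) unfolding u_def by linarith
    ultimately have "\<forall>\<^sub>F N in along \<N>. perp_norm N (\<rho> N) (u s t) < W + \<delta>"
      by (rule order_tendstoD(2))
    then show "\<forall>\<^sub>F N in along \<N>. perp_norm N (\<rho> N) (u s t) \<le> W + \<delta>"
      by eventually_elim simp
  qed
  let ?E1 = "\<lambda>N. \<Sum>g\<in>supp q2. \<Sum>h\<in>supp q1. \<Sum>s\<in>T. \<Sum>t\<in>T. if g \<otimes> t \<otimes> h = s then 0 else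
          cmod (q2 g * q1 h) * (2\<^sup>2 * real (fixpts N (\<rho> N) (inv s \<otimes> (g \<otimes> t \<otimes> h))))"
  let ?E2 = "\<lambda>N. \<Sum>s\<in>T. \<Sum>t\<in>T. if s \<noteq> t then ?c * real (fixpts N (\<rho> N) (inv s \<otimes> t)) else 0"
  have "negligible ?E1"
  proof (intro negligible_sum negligible_if_else negligible_cmult negligible_fixpts)
    fix g h s t assume in': "g \<in> supp q2" "h \<in> supp q1" "s \<in> T" "t \<in> T" "g \<otimes> t \<otimes> h \<noteq> s"
    have cc: "g \<in> X" "h \<in> X" "s \<in> X" "t \<in> X"
      using in' group_algebraD(3)[OF g1] group_algebraD(3)[OF g2] T_sub by auto
    then show "inv s \<otimes> (g \<otimes> t \<otimes> h) \<in> X" by simp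
    show "inv s \<otimes> (g \<otimes> t \<otimes> h) \<noteq> \<one>" using inv_solve_left[of \<one> s "g \<otimes> t \<otimes> h"] cc in'(5) by auto
  qed
  note E1 = negligibleD[OF this \<delta>(1)]
  have "negligible (\<lambda>N. B\<^sup>2 * ?E2 N)"
  proof (intro negligible_sum negligible_if_then negligible_cmult negligible_fixpts)
    fix s t assume st: "s \<in> T" "t \<in> T" "s \<noteq> t"
    then have cc: "s \<in> X" "t \<in> X" using T_sub by auto
    then show "inv s \<otimes> t \<in> X" by simp
    show "inv s \<otimes> t \<noteq> \<one>" using inv_solve_left[of \<one> s t] cc st(3) by auto
  qed
  note E2 = negligibleD[OF this \<delta>(1)]
  from eventually_along_mem op E1 E2 show ?thesis
  proof eventually_elim
    case (elim N)
    interpret eigen_action G N "\<rho> N" p "\<phi> N" "\<mu> N" by (rule action[OF elim(1)])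
    note mb = mcoef_bound[OF elim(1)]
    let ?L = "local_mat (\<rho> N) T (mcoef N)"
    let ?D = "\<lambda>x y. centred N x y - ?L x y"
    have hs: "(\<Sum>i=1..N. \<Sum>j=1..N. obs N ?L j i) \<le> 4 * ?c * real N"
      using local_mat_hs_bound[OF T_fin T_sub mb(1)] by simp
    have main: "cmod (\<Sum>i=1..N. \<Sum>j=1..N. H1 (\<mu> N i) * H2 (\<mu> N j) * of_real (obs N ?L j i))
        \<le> \<delta> * real N + ?c * (4 * real N * ((W + \<delta>) + \<delta> * V))"
    proof -
      have "(\<Sum>s\<in>T. \<Sum>t\<in>T. 2\<^sup>2 * real N *
          (perp_norm N (\<rho> N) (u s t)
            + l1_norm (\<lambda>k. conv_kernel q1 q2 s t k - u s t k)))
          \<le> (\<Sum>s\<in>T. \<Sum>t\<in>T. 2\<^sup>2 * real N * ((W + \<delta>) + \<delta> * V))"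
        using elim(2) l1 by (intro sum_mono mult_left_mono add_mono) auto
      also have "\<dots> = ?c * (4 * real N * ((W + \<delta>) + \<delta> * V))"
        by (simp add: power2_eq_square)
      finally show ?thesis
        using local_spectral_bound[OF q1(1) q2(1) T_fin T_sub mb(1) mb(2) u] elim(3)
        by (meson add_mono order_trans)
    qed
    have "\<delta> * (2 * B + 1) * (\<Sum>i=1..N. \<Sum>j=1..N. obs N ?L j i) \<le> \<delta> * (2 * B + 1) * (4 * ?c * real N)"
      using \<delta>(1) B0 by (intro mult_left_mono[OF hs]) auto
    then have SL: "wsum F1 F2 ?L \<le> (\<delta> * real N + ?c * (4 * real N * ((W + \<delta>) + \<delta> * V)))
        + \<delta> * (2 * B + 1) * (4 * ?c * real N)"
      using wsum_perturb[of F1 B F2 \<delta> H1 H2 ?L, OF F less_imp_le[OF \<delta>(1)] \<delta>(2) q1(3) q2(3)] main by linarith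
    have "B\<^sup>2 * (\<Sum>x=1..N. \<Sum>y=1..N. (cmod (?D x y))\<^sup>2) \<le> B\<^sup>2 * ?E2 N"
      by (intro mult_left_mono defect_bound[OF elim(1)]) simp
    then have SD: "wsum F1 F2 ?D \<le> \<delta> * real N"
      using wsum_le_hs[of F1 B F2 ?D, OF F] elim(4) by linarith
    have "wsum F1 F2 (centred N) \<le> 2 * wsum F1 F2 ?L + 2 * wsum F1 F2 ?D"
      using wsum_add_le[of F1 F2 ?L ?D, OF F(1,3)] by simp
    also have "\<dots> \<le> 2 * ((\<delta> * real N + ?c * (4 * real N * ((W + \<delta>) + \<delta> * V)))
        + \<delta> * (2 * B + 1) * (4 * ?c * real N)) + 2 * (\<delta> * real N)"
      using SL SD by simp
    also have "\<dots> = real N * (8 * ?c * W + \<delta> * \<kappa>)"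
      by (simp add: \<kappa>_def algebra_simps)
    also have "\<dots> \<le> real N * (8 * ?c * W + \<epsilon>)"
      using \<delta>(3) by (intro mult_left_mono) auto
    finally show ?case .
  qed
qed

end

locale spectral_sequence = mixing_sequence G p \<N> \<rho> \<phi> K \<mu> T
  for G (structure) and p \<N> \<rho> \<phi> K \<mu> T +
  fixes S :: "'a set" and C\<^sub>1 :: real and I\<^sub>0 :: "real set"
  assumes gen: "fin_gen_set G S" and rd: "rapid_decay G C\<^sub>1"
    and AC: "cond_AC G p I\<^sub>0" and R4: "cond_R4 G S C\<^sub>1 p I\<^sub>0"
begin

abbreviation "len g \<equiv> real (word_length G S g)"

section \<open>Consequences of rapid decay and of the conditions on the resolvent\<close>

lemma green_one_real:
  assumes "Im z \<noteq> 0"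
  shows "Im (green z \<one>) = 0"
proof -
  let ?w = "resolvent X P z (delta \<one>) \<one>"
  have "cnj (resolvent X P (cnj z) (delta \<one>) \<one>) = ?w"
    using resolvent_adjoint[OF assms, of "delta \<one>" "delta \<one>"]
      ell2_inner_commute[of X "resolvent X P (cnj z) (delta \<one>)" "delta \<one>"]
    by (simp add: ell2_inner_delta)
  then have "resolvent X P (cnj z) (delta \<one>) \<one> = cnj ?w" by (metis complex_cnj_cnj)
  then have "green z \<one> = (?w - cnj ?w) / (2 * \<i>)" by (simp add: green_def)
  also have "\<dots> = of_real (Im ?w)" by (simp add: complex_eq_iff)
  finally show ?thesis by simp
qed

lemma green_diagonal_bounds:
  obtains C0 where "C0 \<ge> 1"
    "\<And>E \<eta>. E \<in> I\<^sub>0 \<Longrightarrow> 0 < \<eta> \<Longrightarrow> \<eta> \<le> 1 \<Longrightarrow>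
      1 / C0 \<le> Re (green (Complex E \<eta>) \<one>) \<and> Re (green (Complex E \<eta>) \<one>) \<le> C0
      \<and> cmod (green (Complex E \<eta>) \<one>) \<le> C0"
proof -
  obtain C0 where C: "C0 \<ge> 1" and b: "\<And>E \<eta>. E \<in> I\<^sub>0 \<Longrightarrow> 0 < \<eta> \<Longrightarrow> \<eta> \<le> 1 \<Longrightarrow>
    inverse C0 \<le> Re (Im_res_entry G p (Complex E \<eta>) \<one> \<one>) \<and> Re (Im_res_entry G p (Complex E \<eta>) \<one> \<one>) \<le> C0"
    using AC unfolding cond_AC_def by blast
  show ?thesis
  proof (rule that[OF C])
    fix E \<eta> :: real assume e: "E \<in> I\<^sub>0" "0 < \<eta>" "\<eta> \<le> 1"
    let ?g = "green (Complex E \<eta>) \<one>"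
    have r: "1 / C0 \<le> Re ?g" "Re ?g \<le> C0"
      using b[OF e] e by (auto simp: Im_res_entry_green inverse_eq_divide)
    have "?g = of_real (Re ?g)" using green_one_real[of "Complex E \<eta>"] e by (simp add: complex_eq_iff)
    then have "cmod ?g = \<bar>Re ?g\<bar>" by (metis norm_of_real)
    moreover have "0 \<le> Re ?g" using r(1) C order_trans[of 0 "1 / C0"] by simp
    ultimately show "1 / C0 \<le> Re ?g \<and> Re ?g \<le> C0 \<and> cmod ?g \<le> C0" using r by simp
  qed
qed

text \<open>
  (R4) with the infinite sum replaced by finite sums of real numbers, which is all that the bounds for
  finitely supported elements require.
\<close>

lemma fourth_moment_small:
  obtains a where "a > 2 * C\<^sub>1 + 1"
    "\<And>d. d > 0 \<Longrightarrow> \<exists>\<eta>0>0. \<forall>\<eta>. 0 < \<eta> \<and> \<eta> < \<eta>0 \<longrightarrow> (\<forall>E\<in>I\<^sub>0. \<forall>A. finite A \<and> A \<subseteq> X \<longrightarrow>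
      (\<Sum>g\<in>A. \<eta>\<^sup>2 * cmod (green (Complex E \<eta>) g) ^ 4 * len g powr a) \<le> d)"
proof -
  obtain a where a: "a > 2 * C\<^sub>1 + 1" and lim: "((\<lambda>\<eta>. SUP E\<in>I\<^sub>0. \<Sum>\<^sub>\<infinity>g\<in>X.
          ennreal (\<eta>\<^sup>2 * cmod (Im_res_entry G p (Complex E \<eta>) \<one> g) ^ 4 * len g powr a)) \<longlongrightarrow> 0) (at_right 0)"
    using R4 unfolding cond_R4_def by blast
  show ?thesis
  proof (rule that[OF a])
    fix d :: real assume d: "d > 0"
    let ?f = "\<lambda>\<eta> E g. \<eta>\<^sup>2 * cmod (Im_res_entry G p (Complex E \<eta>) \<one> g) ^ 4 * len g powr a"
    have "\<forall>\<^sub>F \<eta> in at_right 0. (SUP E\<in>I\<^sub>0. \<Sum>\<^sub>\<infinity>g\<in>X. ennreal (?f \<eta> E g)) < ennreal d"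
      using order_tendstoD(2)[OF lim, of "ennreal d"] d by simp
    then obtain \<eta>0 where e0: "\<eta>0 > 0"
      "\<And>\<eta>. 0 < \<eta> \<Longrightarrow> \<eta> < \<eta>0 \<Longrightarrow> (SUP E\<in>I\<^sub>0. \<Sum>\<^sub>\<infinity>g\<in>X. ennreal (?f \<eta> E g)) < ennreal d"
      unfolding eventually_at_right_field by blast
    show "\<exists>\<eta>0>0. \<forall>\<eta>. 0 < \<eta> \<and> \<eta> < \<eta>0 \<longrightarrow> (\<forall>E\<in>I\<^sub>0. \<forall>A. finite A \<and> A \<subseteq> X \<longrightarrow>
      (\<Sum>g\<in>A. \<eta>\<^sup>2 * cmod (green (Complex E \<eta>) g) ^ 4 * len g powr a) \<le> d)"
    proof (intro exI[of _ \<eta>0] conjI e0(1) allI impI ballI)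
      fix \<eta> E A assume \<eta>: "0 < \<eta> \<and> \<eta> < \<eta>0" and E: "E \<in> I\<^sub>0" and A: "finite A \<and> A \<subseteq> X"
      have "ennreal (\<Sum>g\<in>A. ?f \<eta> E g) = (\<Sum>g\<in>A. ennreal (?f \<eta> E g))"
        by (rule sum_ennreal[symmetric]) simp
      also have "\<dots> \<le> (\<Sum>\<^sub>\<infinity>g\<in>X. ennreal (?f \<eta> E g))"
        by (subst nonneg_infsum_complete, simp, rule SUP_upper) (use A in simp)
      also have "\<dots> \<le> (SUP E\<in>I\<^sub>0. \<Sum>\<^sub>\<infinity>g\<in>X. ennreal (?f \<eta> E g))"
        by (rule SUP_upper[OF E])
      also have "\<dots> \<le> ennreal d" using e0(2) \<eta> by (intro less_imp_le) auto
      finally have "(\<Sum>g\<in>A. ?f \<eta> E g) \<le> d" using d by simp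
      moreover have "(\<Sum>g\<in>A. ?f \<eta> E g) = (\<Sum>g\<in>A. \<eta>\<^sup>2 * cmod (green (Complex E \<eta>) g) ^ 4 * len g powr a)"
        by (intro sum.cong refl) (use A \<eta> in \<open>simp add: Im_res_entry_green subset_eq\<close>)
      ultimately show "(\<Sum>g\<in>A. \<eta>\<^sup>2 * cmod (green (Complex E \<eta>) g) ^ 4 * len g powr a) \<le> d" by simp
    qed
  qed
qed

definition fourth_moment_le :: "real \<Rightarrow> ('a \<Rightarrow> complex) \<Rightarrow> real \<Rightarrow> bool" where
  "fourth_moment_le a v y \<longleftrightarrow> (\<forall>A. finite A \<and> A \<subseteq> X \<longrightarrow>
     (\<Sum>g\<in>A. (1 + len g) powr a * cmod (v g) ^ 4) \<le> y)"

lemma fourth_moment_leD: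
  "fourth_moment_le a v y \<Longrightarrow> finite A \<Longrightarrow> A \<subseteq> X \<Longrightarrow> (\<Sum>g\<in>A. (1 + len g) powr a * cmod (v g) ^ 4) \<le> y"
  by (simp add: fourth_moment_le_def)

text \<open>
  The weight \<open>|g|\<^sup>a\<close> vanishes at the unit, whereas rapid decay requires \<open>(1 + |g|)\<^sup>a\<close>. Away from the unit the two
  are comparable; the term at the unit is bounded by (AC), hence it is \<open>O(\<eta>\<^sup>2)\<close> after multiplication by
  \<open>\<eta>\<^sup>2\<close>.
\<close>

lemma weighted_fourth_moment_small:
  obtains a where "a > 2 * C\<^sub>1 + 1"
    "\<And>d. d > 0 \<Longrightarrow> \<exists>\<eta>0>0. \<eta>0 \<le> 1 \<and> (\<forall>\<eta>. 0 < \<eta> \<and> \<eta> < \<eta>0 \<longrightarrow> 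
      (\<forall>E\<in>I\<^sub>0. fourth_moment_le a (green (Complex E \<eta>)) (d / \<eta>\<^sup>2)))"
proof -
  obtain a where a: "a > 2 * C\<^sub>1 + 1" and small:
    "\<And>d. d > 0 \<Longrightarrow> \<exists>\<eta>0>0. \<forall>\<eta>. 0 < \<eta> \<and> \<eta> < \<eta>0 \<longrightarrow> (\<forall>E\<in>I\<^sub>0. \<forall>A. finite A \<and> A \<subseteq> X \<longrightarrow>
      (\<Sum>g\<in>A. \<eta>\<^sup>2 * cmod (green (Complex E \<eta>) g) ^ 4 * len g powr a) \<le> d)"
    using fourth_moment_small by blast
  obtain C0 where C0: "C0 \<ge> 1" and diag: "\<And>E \<eta>. E \<in> I\<^sub>0 \<Longrightarrow> 0 < \<eta> \<Longrightarrow> \<eta> \<le> 1 \<Longrightarrow>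
      1 / C0 \<le> Re (green (Complex E \<eta>) \<one>) \<and> Re (green (Complex E \<eta>) \<one>) \<le> C0
      \<and> cmod (green (Complex E \<eta>) \<one>) \<le> C0"
    using green_diagonal_bounds by blast
  have a0: "a > 0" using a rd by (auto simp: rapid_decay_def)
  show ?thesis
  proof (rule that[OF a])
    fix d :: real assume d: "d > 0"
    define d' where "d' = d / (2 * 2 powr a)"
    have d': "d' > 0" "2 powr a * d' = d / 2" using d by (auto simp: d'_def)
    obtain \<eta>1 where e1: "\<eta>1 > 0" "\<forall>\<eta>. 0 < \<eta> \<and> \<eta> < \<eta>1 \<longrightarrow> (\<forall>E\<in>I\<^sub>0. \<forall>A. finite A \<and> A \<subseteq> X \<longrightarrow>
      (\<Sum>g\<in>A. \<eta>\<^sup>2 * cmod (green (Complex E \<eta>) g) ^ 4 * len g powr a) \<le> d')"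
      using small[OF d'(1)] by (elim exE conjE) (rule that)
    \<comment> \<open>below \<open>\<eta>2\<close> the term at the unit is at most \<open>d / 2\<close>\<close>
    define \<eta>2 where "\<eta>2 = sqrt (d / (2 * C0 ^ 4))"
    have e2: "\<eta>2 > 0" "\<eta>2\<^sup>2 * C0 ^ 4 = d / 2" using d C0 by (auto simp: \<eta>2_def)
    show "\<exists>\<eta>0>0. \<eta>0 \<le> 1 \<and> (\<forall>\<eta>. 0 < \<eta> \<and> \<eta> < \<eta>0 \<longrightarrow> 
      (\<forall>E\<in>I\<^sub>0. fourth_moment_le a (green (Complex E \<eta>)) (d / \<eta>\<^sup>2)))"
      unfolding fourth_moment_le_def
    proof (intro exI[of _ "min 1 (min \<eta>1 \<eta>2)"] conjI allI impI ballI)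
      fix \<eta> E A assume \<eta>: "0 < \<eta> \<and> \<eta> < min 1 (min \<eta>1 \<eta>2)" and E: "E \<in> I\<^sub>0" and A: "finite A \<and> A \<subseteq> X"
      let ?v = "\<lambda>g. cmod (green (Complex E \<eta>) g) ^ 4"
      have "(\<Sum>g\<in>A. (1 + len g) powr a * ?v g) \<le> (\<Sum>g\<in>A. 2 powr a * (?v g * len g powr a) + (if g = \<one> then ?v g else 0))"
      proof (rule sum_mono)
        fix g assume g: "g \<in> A"
        show "(1 + len g) powr a * ?v g \<le> 2 powr a * (?v g * len g powr a) + (if g = \<one> then ?v g else 0)"
        proof (cases "g = \<one>")
          case True
          have "word_length G S \<one> = 0" using word_length_le[of "[]" S \<one>] by simp
          then show ?thesis using True a0 by simp
        next
          case False
          have "1 \<le> len g" using word_length_pos[OF gen _ False] g A by auto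
          then have "(1 + len g) powr a \<le> (2 * len g) powr a" using a0 by (intro powr_mono2) auto
          also have "\<dots> = 2 powr a * len g powr a" by (simp add: powr_mult)
          finally have "(1 + len g) powr a * ?v g \<le> (2 powr a * len g powr a) * ?v g"
            by (intro mult_right_mono) auto
          then show ?thesis using False by (simp add: mult_ac)
        qed
      qed
      also have "\<dots> = 2 powr a * (\<Sum>g\<in>A. ?v g * len g powr a) + (\<Sum>g\<in>A. if g = \<one> then ?v g else 0)"
        by (simp add: sum.distrib sum_distrib_left)
      also have "(\<Sum>g\<in>A. if g = \<one> then ?v g else 0) \<le> C0 ^ 4"
      proof -
        have "cmod (green (Complex E \<eta>) \<one>) \<le> C0" using diag[OF E, of \<eta>] \<eta> by simp
        then show ?thesis using A C0 power_mono[of "cmod (green (Complex E \<eta>) \<one>)" C0 4] by (simp add: sum.delta)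
      qed
      finally have "\<eta>\<^sup>2 * (\<Sum>g\<in>A. (1 + len g) powr a * ?v g)
          \<le> \<eta>\<^sup>2 * (2 powr a * (\<Sum>g\<in>A. ?v g * len g powr a) + C0 ^ 4)"
        by (simp add: mult_left_mono)
      also have "\<dots> = 2 powr a * (\<Sum>g\<in>A. \<eta>\<^sup>2 * ?v g * len g powr a) + \<eta>\<^sup>2 * C0 ^ 4"
        by (simp add: sum_distrib_left distrib_left mult_ac)
      also have "\<dots> \<le> 2 powr a * d' + \<eta>2\<^sup>2 * C0 ^ 4"
        using e1(2)[rule_format, of \<eta> E A] \<eta> E A C0 by (intro add_mono mult_left_mono mult_right_mono power_mono) auto
      also have "\<dots> = d" using d'(2) e2(2) by simp
      finally show "(\<Sum>g\<in>A. (1 + len g) powr a * ?v g) \<le> d / \<eta>\<^sup>2"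
        using \<eta> by (simp add: field_simps)
    qed (use e1 e2 in auto)
  qed
qed

lemma shifted_length:
  obtains L where "L \<ge> 1" "\<And>s t k. s \<in> T \<Longrightarrow> t \<in> T \<Longrightarrow> k \<in> X \<Longrightarrow> 1 + len k \<le> L * (1 + len (s \<otimes> k \<otimes> inv t))"
proof -
  define m where "m = Max (insert 0 (word_length G S ` T))"
  have m: "word_length G S t \<le> m" if "t \<in> T" for t
    unfolding m_def using that T_fin by (intro Max_ge) auto
  show ?thesis
  proof (rule that[of "1 + 2 * real m"])
    fix s t k assume st: "s \<in> T" "t \<in> T" and k: "k \<in> X"
    let ?w = "s \<otimes> k \<otimes> inv t"
    have c: "s \<in> X" "t \<in> X" using st T_sub by auto
    have "k = (inv s \<otimes> ?w) \<otimes> t" using c k by (simp add: m_assoc) (simp add: m_assoc[symmetric])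
    then have "word_length G S k \<le> word_length G S (inv s) + word_length G S ?w + word_length G S t"
      using word_length_mult[OF gen, of "inv s \<otimes> ?w" t] word_length_mult[OF gen, of "inv s" ?w] c k by simp
    then have "word_length G S k \<le> 2 * m + word_length G S ?w"
      using m[OF st(1)] m[OF st(2)] word_length_inv[OF gen c(1)] by linarith
    then have "len k \<le> 2 * real m + len ?w" by linarith
    also have "1 + \<dots> \<le> (1 + 2 * real m) * (1 + len ?w)" by (simp add: algebra_simps)
    finally show "1 + len k \<le> (1 + 2 * real m) * (1 + len ?w)" by simp
  qed simp
qed

text \<open>
  After rapid decay, the arithmetic-geometric inequality \<open>x\<^sup>2 y\<^sup>2 \<le> (x\<^sup>4 + y\<^sup>4) / 2\<close> separates the
  factors. Inversion and the translations by \<open>s\<close> and \<open>t\<close> change the weights by a constant factor only.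
\<close>

lemma product_op_norm_bound:
  assumes a: "a > 2 * C\<^sub>1 + 1"
  obtains D where "D \<ge> 0" "\<And>v1 v2 y s t A.
    fourth_moment_le a v1 y \<Longrightarrow>
    fourth_moment_le a v2 y \<Longrightarrow>
    s \<in> T \<Longrightarrow> t \<in> T \<Longrightarrow> finite A \<Longrightarrow> A \<subseteq> X \<Longrightarrow>
    op_norm_on X (ell2 X) (left_reg_alg G (\<lambda>k. if k \<in> A then v1 (inv k) * v2 (s \<otimes> k \<otimes> inv t) else 0)) \<le> D * sqrt y"
proof -
  obtain D where D: "D \<ge> 0" "\<And>q. q \<in> group_algebra G \<Longrightarrow>
    op_norm_on X (ell2 X) (left_reg_alg G q) \<le> D * sqrt (\<Sum>g\<in>supp q. (1 + len g) powr a * (cmod (q g))\<^sup>2)"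
    using weighted_rapid_decay[OF gen rd a] by blast
  obtain L where L: "L \<ge> 1" "\<And>s t k. s \<in> T \<Longrightarrow> t \<in> T \<Longrightarrow> k \<in> X \<Longrightarrow> 1 + len k \<le> L * (1 + len (s \<otimes> k \<otimes> inv t))"
    using shifted_length by blast
  have a0: "a > 0" using a rd by (auto simp: rapid_decay_def)
  show ?thesis
  proof (rule that[of "D * sqrt (L powr a)"])
    show "D * sqrt (L powr a) \<ge> 0" using D by simp
    fix v1 v2 :: "'a \<Rightarrow> complex" and y s t A
    assume b1: "fourth_moment_le a v1 y" and b2: "fourth_moment_le a v2 y"
      and st: "s \<in> T" "t \<in> T" and A: "finite A" "A \<subseteq> X"
    let ?w = "\<lambda>k. s \<otimes> k \<otimes> inv t"
    define u where "u = (\<lambda>k. if k \<in> A then v1 (inv k) * v2 (?w k) else 0)"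
    have c: "s \<in> X" "t \<in> X" using st T_sub by auto
    have y0: "0 \<le> y" using fourth_moment_leD[OF b1, of "{}"] by simp
    have u: "u \<in> group_algebra G" by (rule group_algebraI[OF A]) (simp add: u_def)
    have inj: "inj_on (\<lambda>k. inv k) A" "inj_on ?w A"
      subgoal by (intro inj_onI) (metis A(2) inv_inv subsetD)
      subgoal using A(2) c by (auto simp: inj_on_def subset_eq)
      done
    have "(\<Sum>g\<in>supp u. (1 + len g) powr a * (cmod (u g))\<^sup>2) \<le> (\<Sum>g\<in>A. (1 + len g) powr a * (cmod (u g))\<^sup>2)"
      by (rule sum_mono2) (use A in \<open>auto simp: u_def supp_def\<close>)
    also have "\<dots> \<le> (\<Sum>k\<in>A. ((1 + len (inv k)) powr a * cmod (v1 (inv k)) ^ 4) / 2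
        + L powr a * ((1 + len (?w k)) powr a * cmod (v2 (?w k)) ^ 4) / 2)"
    proof (rule sum_mono)
      fix k assume k: "k \<in> A"
      then have kX: "k \<in> X" using A by auto
      let ?x = "cmod (v1 (inv k))" and ?y = "cmod (v2 (?w k))"
      have l1: "(1 + len k) powr a \<le> (1 + len (inv k)) powr a"
        using word_length_inv[OF gen, of "inv k"] kX a0 by (intro powr_mono2) auto
      have "(1 + len k) powr a \<le> (L * (1 + len (?w k))) powr a"
        using L(2)[OF st kX] a0 by (intro powr_mono2) auto
      also have "\<dots> = L powr a * (1 + len (?w k)) powr a" using L(1) by (simp add: powr_mult)
      finally have l2: "(1 + len k) powr a \<le> L powr a * (1 + len (?w k)) powr a" .
      have "(cmod (u k))\<^sup>2 = ?x\<^sup>2 * ?y\<^sup>2" using k by (simp add: u_def norm_mult power_mult_distrib)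
      also have "\<dots> \<le> ?x ^ 4 / 2 + ?y ^ 4 / 2"
        using sum_squares_bound[of "?x\<^sup>2" "?y\<^sup>2"] by simp
      finally have "(1 + len k) powr a * (cmod (u k))\<^sup>2 \<le> (1 + len k) powr a * (?x ^ 4 / 2 + ?y ^ 4 / 2)"
        by (intro mult_left_mono) auto
      also have "\<dots> = (1 + len k) powr a * (?x ^ 4 / 2) + (1 + len k) powr a * (?y ^ 4 / 2)"
        by (rule distrib_left)
      also have "\<dots> \<le> (1 + len (inv k)) powr a * (?x ^ 4 / 2) + (L powr a * (1 + len (?w k)) powr a) * (?y ^ 4 / 2)"
        by (intro add_mono mult_right_mono l1 l2) auto
      finally show "(1 + len k) powr a * (cmod (u k))\<^sup>2 \<le> ((1 + len (inv k)) powr a * ?x ^ 4) / 2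
        + L powr a * ((1 + len (?w k)) powr a * ?y ^ 4) / 2"
        by (simp add: mult.assoc)
    qed
    also have "\<dots> = (\<Sum>k\<in>A. (1 + len (inv k)) powr a * cmod (v1 (inv k)) ^ 4) / 2
        + L powr a * (\<Sum>k\<in>A. (1 + len (?w k)) powr a * cmod (v2 (?w k)) ^ 4) / 2"
      by (simp only: sum.distrib sum_divide_distrib sum_distrib_left)
    also have "(\<Sum>k\<in>A. (1 + len (inv k)) powr a * cmod (v1 (inv k)) ^ 4)
        = (\<Sum>g\<in>(\<lambda>k. inv k) ` A. (1 + len g) powr a * cmod (v1 g) ^ 4)"
      by (simp add: sum.reindex[OF inj(1)])
    also have "(\<Sum>k\<in>A. (1 + len (?w k)) powr a * cmod (v2 (?w k)) ^ 4)
        = (\<Sum>g\<in>?w ` A. (1 + len g) powr a * cmod (v2 g) ^ 4)"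
      by (simp add: sum.reindex[OF inj(2)])
    also have "(\<Sum>g\<in>(\<lambda>k. inv k) ` A. (1 + len g) powr a * cmod (v1 g) ^ 4) / 2
        + L powr a * (\<Sum>g\<in>?w ` A. (1 + len g) powr a * cmod (v2 g) ^ 4) / 2 \<le> y / 2 + L powr a * y / 2"
      using A c by (intro add_mono divide_right_mono mult_left_mono
          fourth_moment_leD[OF b1] fourth_moment_leD[OF b2]) auto
    also have "\<dots> \<le> L powr a * y"
    proof -
      have "1 * y \<le> L powr a * y" using L(1) a0 y0 by (intro mult_right_mono ge_one_powr_ge_zero) auto
      then show ?thesis by simp
    qed
    finally have "D * sqrt (\<Sum>g\<in>supp u. (1 + len g) powr a * (cmod (u g))\<^sup>2) \<le> D * sqrt (L powr a * y)"
      using D(1) by (intro mult_left_mono real_sqrt_le_mono)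
    then show "op_norm_on X (ell2 X) (left_reg_alg G (\<lambda>k. if k \<in> A then v1 (inv k) * v2 (?w k) else 0))
        \<le> D * sqrt (L powr a) * sqrt y"
      using D(2)[OF u] by (simp add: u_def real_sqrt_mult mult.assoc)
  qed
qed

lemma poisson_nonneg: "\<eta> > 0 \<Longrightarrow> 0 \<le> poisson E \<eta> x"
  by (simp add: poisson_def)

lemma poisson_le: "\<eta> > 0 \<Longrightarrow> poisson E \<eta> x \<le> 1 / \<eta>"
  by (simp add: poisson_def divide_simps power2_eq_square add_pos_nonneg add_nonneg_pos)

lemma poisson_ge:
  assumes "\<eta> > 0" "\<bar>x - E\<bar> \<le> 3 / 2 * \<eta>"
  shows "1 / (4 * \<eta>) \<le> poisson E \<eta> x"
proof -
  have "(x - E)\<^sup>2 \<le> (3 / 2 * \<eta>)\<^sup>2" using assms(2) abs_le_square_iff[of "x - E" "3 / 2 * \<eta>"] assms(1) by simp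
  also have "\<dots> = 9 / 4 * \<eta>\<^sup>2" by (simp add: power2_eq_square)
  finally have le: "(x - E)\<^sup>2 + \<eta>\<^sup>2 \<le> 4 * \<eta>\<^sup>2" using zero_le_power2[of \<eta>] by linarith
  have "1 / (4 * \<eta>) = \<eta> / (4 * \<eta>\<^sup>2)" using assms(1) by (simp add: power2_eq_square)
  also have "\<dots> \<le> \<eta> / ((x - E)\<^sup>2 + \<eta>\<^sup>2)"
    using le assms(1) by (intro divide_left_mono mult_pos_pos add_nonneg_pos) auto
  finally show ?thesis by (simp add: poisson_def)
qed

abbreviation "poisson_sum N \<eta> E1 E2 \<equiv> weighted_sum N (\<phi> N) (\<mu> N) (poisson E1 \<eta>) (poisson E2 \<eta>) (centred N)"

text \<open>
  The norm in \<open>weighted_mixing_limit\<close> is at most a constant times \<open>\<surd>d / \<eta>\<close>, where \<open>d / \<eta>\<^sup>2\<close> bounds the fourth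
  moments and \<open>d\<close> is arbitrarily small.
\<close>

lemma poisson_mixing_small:
  assumes e: "e > 0"
  obtains \<eta>0 where "\<eta>0 > 0" "\<eta>0 \<le> 1"
    "\<And>\<eta> E1 E2. 0 < \<eta> \<Longrightarrow> \<eta> < \<eta>0 \<Longrightarrow> E1 \<in> I\<^sub>0 \<Longrightarrow> E2 \<in> I\<^sub>0 \<Longrightarrow>
      \<forall>\<^sub>F N in along \<N>. poisson_sum N \<eta> E1 E2
        \<le> real N * (e / \<eta>)"
proof -
  obtain a where a: "a > 2 * C\<^sub>1 + 1" and small:
    "\<And>d. d > 0 \<Longrightarrow> \<exists>\<eta>0>0. \<eta>0 \<le> 1 \<and> (\<forall>\<eta>. 0 < \<eta> \<and> \<eta> < \<eta>0 \<longrightarrow> 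
      (\<forall>E\<in>I\<^sub>0. fourth_moment_le a (green (Complex E \<eta>)) (d / \<eta>\<^sup>2)))"
    using weighted_fourth_moment_small by blast
  obtain D where D: "D \<ge> 0" and opn: "\<And>v1 v2 y s t A.
    fourth_moment_le a v1 y \<Longrightarrow>
    fourth_moment_le a v2 y \<Longrightarrow>
    s \<in> T \<Longrightarrow> t \<in> T \<Longrightarrow> finite A \<Longrightarrow> A \<subseteq> X \<Longrightarrow>
    op_norm_on X (ell2 X) (left_reg_alg G (\<lambda>k. if k \<in> A then v1 (inv k) * v2 (s \<otimes> k \<otimes> inv t) else 0)) \<le> D * sqrt y"
    using product_op_norm_bound[OF a] by blast
  \<comment> \<open>the summand \<open>1\<close> makes \<open>b\<close> positive even if \<open>D = 0\<close>\<close>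
  define b where "b = 8 * (real (card T))\<^sup>2 * D + 1"
  have b: "b > 0" using D by (simp add: b_def add_nonneg_pos)
  define d where "d = (e / (2 * b))\<^sup>2"
  have d: "d > 0" "sqrt d = e / (2 * b)" using e b by (auto simp: d_def)
  obtain \<eta>0 where e0: "\<eta>0 > 0" "\<eta>0 \<le> 1" and sm': "\<forall>\<eta>. 0 < \<eta> \<and> \<eta> < \<eta>0 \<longrightarrow> 
      (\<forall>E\<in>I\<^sub>0. fourth_moment_le a (green (Complex E \<eta>)) (d / \<eta>\<^sup>2))"
    using small[OF d(1)] by (elim exE conjE) (rule that)
  note sm = sm'[rule_format, OF conjI]
  show ?thesis
  proof (rule that[OF e0])
    fix \<eta> E1 E2 assume \<eta>: "0 < \<eta>" "\<eta> < \<eta>0" and E: "E1 \<in> I\<^sub>0" "E2 \<in> I\<^sub>0"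
    have "\<forall>\<^sub>F N in along \<N>. poisson_sum N \<eta> E1 E2
        \<le> real N * (8 * (real (card T))\<^sup>2 * (D * sqrt (d / \<eta>\<^sup>2)) + e / (2 * \<eta>))"
      by (rule weighted_mixing_limit[OF spectral_pair_green[OF \<eta>(1)] spectral_pair_green[OF \<eta>(1)]
            poisson_nonneg[OF \<eta>(1)] poisson_le[OF \<eta>(1)] poisson_nonneg[OF \<eta>(1)] poisson_le[OF \<eta>(1)]
            opn[OF sm[OF \<eta> E(1)] sm[OF \<eta> E(2)]]])
        (use e \<eta> in auto)
    moreover have "8 * (real (card T))\<^sup>2 * (D * sqrt (d / \<eta>\<^sup>2)) + e / (2 * \<eta>) \<le> e / \<eta>"
    proof -
      have "8 * (real (card T))\<^sup>2 * (D * sqrt (d / \<eta>\<^sup>2)) = (8 * (real (card T))\<^sup>2 * D) * (e / (2 * b)) / \<eta>"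
        using \<eta> d(2) by (simp add: real_sqrt_divide)
      also have "\<dots> \<le> b * (e / (2 * b)) / \<eta>"
        using e b \<eta> by (intro divide_right_mono mult_right_mono) (auto simp: b_def)
      also have "\<dots> = e / (2 * \<eta>)" using b by simp
      finally show ?thesis by (simp add: field_simps)
    qed
    ultimately show "\<forall>\<^sub>F N in along \<N>. poisson_sum N \<eta> E1 E2
        \<le> real N * (e / \<eta>)"
      by (elim eventually_mono) (meson mult_left_mono of_nat_0_le_iff order_trans)
  qed
qed

section \<open>Counting eigenvalues in windows\<close>

abbreviation "win N E \<eta> \<equiv> spec_window N (\<mu> N) {E - \<eta>..E + \<eta>}"

text \<open>
  The difference \<open>F\<close> of a Poisson kernel at scale \<open>\<kappa> \<eta>\<close> and \<open>2 \<kappa>\<close> times the one at scale \<open>\<eta>\<close> is nonpositive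
  outside the window, and at most \<open>1 / (\<kappa> \<eta>)\<close> inside, so the sum of \<open>F\<close> over the eigenvalues is a lower
  bound for the count. By (AC) its normalised limit is at least \<open>1 / C0 - 2 \<kappa> C0\<close>.
\<close>

lemma window_count_lower:
  obtains c where "c > 0" "\<And>E \<eta>. E \<in> I\<^sub>0 \<Longrightarrow> 0 < \<eta> \<Longrightarrow> \<eta> \<le> 1 \<Longrightarrow>
    \<forall>\<^sub>F N in along \<N>. c * \<eta> * real N \<le> real (card (win N E \<eta>))"
proof -
  obtain C0 where C0: "C0 \<ge> 1" and diag: "\<And>E \<eta>. E \<in> I\<^sub>0 \<Longrightarrow> 0 < \<eta> \<Longrightarrow> \<eta> \<le> 1 \<Longrightarrow>
      1 / C0 \<le> Re (green (Complex E \<eta>) \<one>) \<and> Re (green (Complex E \<eta>) \<one>) \<le> C0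
      \<and> cmod (green (Complex E \<eta>) \<one>) \<le> C0"
    using green_diagonal_bounds by blast
  \<comment> \<open>chosen such that \<open>1 / C0 - 2 \<kappa> C0 = 1 / (2 C0)\<close> is positive\<close>
  define \<kappa> where "\<kappa> = 1 / (4 * C0\<^sup>2)"
  have C2: "1 \<le> C0\<^sup>2" using C0 by (simp add: one_le_power)
  have \<kappa>: "0 < \<kappa>" "\<kappa> \<le> 1" "2 * \<kappa> * C0 = 1 / (2 * C0)"
    using C0 C2 by (auto simp: \<kappa>_def field_simps power2_eq_square)
  show ?thesis
  proof (rule that[of "\<kappa> / (4 * C0)"])
    show "\<kappa> / (4 * C0) > 0" using \<kappa> C0 by simp
    fix E \<eta> assume E: "E \<in> I\<^sub>0" and \<eta>: "0 < \<eta>" "\<eta> \<le> (1::real)"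
    have \<kappa>\<eta>: "0 < \<kappa> * \<eta>" "\<kappa> * \<eta> \<le> 1" using \<kappa> \<eta> mult_le_one[of \<kappa> \<eta>] by auto
    define F where "F x = poisson E (\<kappa> * \<eta>) x - 2 * \<kappa> * poisson E \<eta> x" for x
    have out: "F x \<le> (if \<bar>x - E\<bar> \<le> \<eta> then 1 / (\<kappa> * \<eta>) else 0)" for x
    proof (cases "\<bar>x - E\<bar> \<le> \<eta>")
      case True
      then show ?thesis
        using poisson_le[OF \<kappa>\<eta>(1), of E x] mult_nonneg_nonneg[OF _ poisson_nonneg[OF \<eta>(1)], of "2 * \<kappa>" E x] \<kappa>(1)
        by (simp add: F_def)
    next
      case False
      then have x: "\<eta>\<^sup>2 \<le> (x - E)\<^sup>2" using abs_le_square_iff[of \<eta> "x - E"] \<eta>(1) by simp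
      have p2: "0 < (x - E)\<^sup>2" using x \<eta>(1) by (meson less_le_trans zero_less_power)
      have "poisson E (\<kappa> * \<eta>) x \<le> \<kappa> * \<eta> / (x - E)\<^sup>2"
        unfolding poisson_def using \<kappa>\<eta>(1) p2 by (intro divide_left_mono mult_pos_pos add_pos_nonneg) auto
      also have "\<dots> = 2 * \<kappa> * (\<eta> / (2 * (x - E)\<^sup>2))" by simp
      also have "\<dots> \<le> 2 * \<kappa> * poisson E \<eta> x"
        unfolding poisson_def using x p2 \<kappa>(1) \<eta>(1)
        by (intro mult_left_mono divide_left_mono mult_pos_pos add_pos_nonneg) auto
      finally show ?thesis using False by (simp add: F_def)
    qed
    define v where "v = (\<lambda>x. 1 * green (Complex E (\<kappa> * \<eta>)) x + (- of_real (2 * \<kappa>)) * green (Complex E \<eta>) x)"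
    have "spectral_pair v (\<lambda>x. of_real (F x))"
      using spectral_pair_lincomb[OF spectral_pair_green[OF \<kappa>\<eta>(1), of E] spectral_pair_green[OF \<eta>(1), of E], of 1 "- of_real (2 * \<kappa>)"]
      unfolding v_def F_def by simp
    from tendsto_Re[OF spectral_measure_limit[OF this]]
    have lim: "((\<lambda>N. (\<Sum>i=1..N. F (\<mu> N i)) / real N) \<longlongrightarrow> Re (v \<one>)) (along \<N>)"
      by (simp add: Re_divide_of_nat)
    have "1 / (4 * C0) < 1 / C0 - 2 * \<kappa> * C0" using C0 unfolding \<kappa>(3) by (simp add: field_simps)
    also have "\<dots> \<le> Re (v \<one>)"
    proof -
      have "2 * \<kappa> * Re (green (Complex E \<eta>) \<one>) \<le> 2 * \<kappa> * C0"
        using diag[OF E \<eta>] \<kappa>(1) by (intro mult_left_mono) auto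
      then show ?thesis using diag[OF E \<kappa>\<eta>] by (simp add: v_def)
    qed
    finally have "\<forall>\<^sub>F N in along \<N>. 1 / (4 * C0) < (\<Sum>i=1..N. F (\<mu> N i)) / real N"
      by (rule order_tendstoD(1)[OF lim])
    with eventually_along_mem
    show "\<forall>\<^sub>F N in along \<N>. \<kappa> / (4 * C0) * \<eta> * real N \<le> real (card (win N E \<eta>))"
    proof eventually_elim
      case (elim N)
      have N: "0 < real N" using N_pos[OF elim(1)] by simp
      have w: "win N E \<eta> = {i \<in> {1..N}. \<bar>\<mu> N i - E\<bar> \<le> \<eta>}"
        by (auto simp: spec_window_def abs_le_iff)
      have "1 / (4 * C0) * real N \<le> (\<Sum>i=1..N. F (\<mu> N i))"
        using elim(2) N by (simp add: field_simps)
      also have "\<dots> \<le> (\<Sum>i=1..N. if \<bar>\<mu> N i - E\<bar> \<le> \<eta> then 1 / (\<kappa> * \<eta>) else 0)"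
        by (intro sum_mono out)
      also have "\<dots> = real (card (win N E \<eta>)) * (1 / (\<kappa> * \<eta>))"
        unfolding w by (subst sum.inter_filter[symmetric]) (simp, rule sum_constant)
      finally have "(\<kappa> * \<eta>) * (1 / (4 * C0) * real N)
          \<le> (\<kappa> * \<eta>) * (real (card (win N E \<eta>)) * (1 / (\<kappa> * \<eta>)))"
        using \<kappa>\<eta>(1) by (intro mult_left_mono) auto
      moreover have "(\<kappa> * \<eta>) * (x * (1 / (\<kappa> * \<eta>))) = x" for x using \<kappa>(1) \<eta>(1) by simp
      ultimately have "(\<kappa> * \<eta>) * (1 / (4 * C0) * real N)
          \<le> real (card (win N E \<eta>))"
        by (simp only:)
      then show ?case by (simp add: mult_ac)
    qed
  qed
qed

section \<open>Quantum mixing and quantum ergodicity\<close>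

text \<open>
  Windows of radius \<open>3 \<eta> / 2\<close> leave room for moving the centre of a window of radius \<open>\<eta>\<close> to a point of
  a net of mesh \<open>\<eta> / 2\<close>.
\<close>

lemma window_sum_le:
  assumes \<eta>: "\<eta> > 0" and A: "A \<subseteq> {1..N}" and B: "B \<subseteq> {1..N}"
    and "\<And>i. i \<in> A \<Longrightarrow> \<bar>\<mu> N i - E1\<bar> \<le> 3 / 2 * \<eta>" "\<And>j. j \<in> B \<Longrightarrow> \<bar>\<mu> N j - E2\<bar> \<le> 3 / 2 * \<eta>"
  shows "(\<Sum>i\<in>A. \<Sum>j\<in>B. obs N (centred N) j i)
    \<le> 16 * \<eta>\<^sup>2 * poisson_sum N \<eta> E1 E2"
proof -
  let ?f = "\<lambda>i j. 16 * \<eta>\<^sup>2 * (poisson E1 \<eta> (\<mu> N i) * poisson E2 \<eta> (\<mu> N j) * obs N (centred N) j i)"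
  have nn: "0 \<le> ?f i j" for i j using poisson_nonneg[OF \<eta>] by simp
  have "(\<Sum>i\<in>A. \<Sum>j\<in>B. obs N (centred N) j i) \<le> (\<Sum>i\<in>A. \<Sum>j\<in>B. ?f i j)"
  proof (intro sum_mono)
    fix i j assume ab: "i \<in> A" "j \<in> B"
    have "1 / (4 * \<eta>) * (1 / (4 * \<eta>)) \<le> poisson E1 \<eta> (\<mu> N i) * poisson E2 \<eta> (\<mu> N j)"
      using poisson_ge[OF \<eta> assms(4)[OF ab(1)]] poisson_ge[OF \<eta> assms(5)[OF ab(2)]] \<eta>
      by (intro mult_mono poisson_nonneg) auto
    then have "16 * \<eta>\<^sup>2 * (1 / (4 * \<eta>) * (1 / (4 * \<eta>))) \<le> 16 * \<eta>\<^sup>2 * (poisson E1 \<eta> (\<mu> N i) * poisson E2 \<eta> (\<mu> N j))"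
      by (intro mult_left_mono) auto
    then have "1 \<le> 16 * \<eta>\<^sup>2 * (poisson E1 \<eta> (\<mu> N i) * poisson E2 \<eta> (\<mu> N j))"
      using \<eta> by (simp add: power2_eq_square)
    from mult_right_mono[OF this, of "obs N (centred N) j i"] show "obs N (centred N) j i \<le> ?f i j" by (simp add: mult.assoc)
  qed
  also have "\<dots> \<le> (\<Sum>i\<in>A. \<Sum>j=1..N. ?f i j)"
    by (intro sum_mono sum_mono2 B nn) auto
  also have "\<dots> \<le> (\<Sum>i=1..N. \<Sum>j=1..N. ?f i j)"
    by (intro sum_mono2 A sum_nonneg nn) auto
  finally show ?thesis by (simp only: sum_distrib_left weighted_sum_def)
qed

lemma finite_net:
  fixes l u \<eta> :: real
  assumes "\<eta> > 0" "l < u"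
  shows "\<exists>Z. finite Z \<and> Z \<subseteq> {l..u} \<and> real (card Z) \<le> 2 * (u - l) / \<eta> + 1
    \<and> (\<forall>E\<in>{l..u}. \<exists>z\<in>Z. \<bar>E - z\<bar> \<le> \<eta> / 2)"
proof -
  define n where "n = nat \<lfloor>2 * (u - l) / \<eta>\<rfloor>"
  have n: "real n \<le> 2 * (u - l) / \<eta>" using assms by (simp add: n_def)
  define z where "z j = l + real j * (\<eta> / 2)" for j
  show ?thesis
  proof (intro exI[of _ "z ` {..n}"] conjI ballI)
    show "z ` {..n} \<subseteq> {l..u}"
    proof
      fix x assume "x \<in> z ` {..n}"
      then obtain j where j: "j \<le> n" "x = z j" by auto
      have "real j \<le> 2 * (u - l) / \<eta>" using j(1) n by linarith
      then have "real j * (\<eta> / 2) \<le> 2 * (u - l) / \<eta> * (\<eta> / 2)" using assms by (intro mult_right_mono) auto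
      then show "x \<in> {l..u}" using assms j(2) by (simp add: z_def)
    qed
    have "card (z ` {..n}) \<le> n + 1" using card_image_le[of "{..n}" z] by simp
    then show "real (card (z ` {..n})) \<le> 2 * (u - l) / \<eta> + 1" using n by linarith
    fix E assume E: "E \<in> {l..u}"
    define j where "j = nat \<lfloor>2 * (E - l) / \<eta>\<rfloor>"
    have q: "0 \<le> 2 * (E - l) / \<eta>" using E assms by simp
    have "2 * (E - l) / \<eta> \<le> 2 * (u - l) / \<eta>" using E assms by (intro divide_right_mono) auto
    then have "j \<le> n" unfolding j_def n_def by (intro nat_mono floor_mono)
    moreover have "real j \<le> 2 * (E - l) / \<eta>" "2 * (E - l) / \<eta> < real j + 1"
      using q by (auto simp: j_def)
    then have "real j * \<eta> \<le> 2 * (E - l)" "2 * (E - l) < (real j + 1) * \<eta>"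
      using assms(1) by (simp_all add: pos_le_divide_eq pos_divide_less_eq)
    then have "\<bar>E - z j\<bar> \<le> \<eta> / 2" by (simp add: z_def abs_le_iff algebra_simps)
    ultimately show "\<exists>z\<in>z ` {..n}. \<bar>E - z\<bar> \<le> \<eta> / 2" by auto
  qed simp
qed

text \<open>
  Uniformity in the two energies comes from a finite net: a window centred at \<open>E\<close> is contained in the
  enlarged window of a nearby net point and contains a smaller window centred there.
\<close>

lemma quantum_mixing_on:
  assumes lu: "l < u" and sub: "{l..u} \<subseteq> I\<^sub>0"
  shows "quantum_mixing \<N> \<rho> \<phi> \<mu> T K {l..u}"
proof -
  obtain c where c: "c > 0" and count: "\<And>E \<eta>. E \<in> I\<^sub>0 \<Longrightarrow> 0 < \<eta> \<Longrightarrow> \<eta> \<le> 1 \<Longrightarrow>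
    \<forall>\<^sub>F N in along \<N>. c * \<eta> * real N \<le> real (card (win N E \<eta>))"
    using window_count_lower by blast
  define Q where "Q \<eta> N E1 E2 = (1 / real (card (win N E1 \<eta>))) *
          (\<Sum>i\<in>win N E1 \<eta>. \<Sum>j\<in>win N E2 \<eta>.
             obs N (centred N) j i)" for \<eta> N E1 E2
  have small: "\<forall>\<^sub>F \<eta> in at_right 0. \<forall>\<^sub>F N in along \<N>. \<forall>E1\<in>{l..u}. \<forall>E2\<in>{l..u}. Q \<eta> N E1 E2 \<le> d"
    if d: "d > 0" for d
  proof -
    \<comment> \<open>\<open>16 \<eta> e N\<close> bounds the double sum over two windows, and there are at least \<open>c \<eta> N / 2\<close> eigenvalues in one\<close>
    define e where "e = d * c / 32"
    have e: "e > 0" using d c by (simp add: e_def)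
    obtain \<eta>0 where e0: "\<eta>0 > 0" "\<eta>0 \<le> 1" and mix: "\<And>\<eta> E1 E2. 0 < \<eta> \<Longrightarrow> \<eta> < \<eta>0 \<Longrightarrow> E1 \<in> I\<^sub>0 \<Longrightarrow> E2 \<in> I\<^sub>0 \<Longrightarrow>
      \<forall>\<^sub>F N in along \<N>. poisson_sum N \<eta> E1 E2
        \<le> real N * (e / \<eta>)"
      using poisson_mixing_small[OF e] by blast
    have "\<forall>\<^sub>F N in along \<N>. \<forall>E1\<in>{l..u}. \<forall>E2\<in>{l..u}. Q \<eta> N E1 E2 \<le> d" if \<eta>: "0 < \<eta>" "\<eta> < \<eta>0" for \<eta>
    proof -
      obtain Z where Z: "finite Z" "Z \<subseteq> {l..u}" "real (card Z) \<le> 2 * (u - l) / \<eta> + 1"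
        and net: "\<forall>E\<in>{l..u}. \<exists>z\<in>Z. \<bar>E - z\<bar> \<le> \<eta> / 2"
        using finite_net[OF \<eta>(1) lu] by (elim exE conjE) (rule that)
      have Z0: "z \<in> I\<^sub>0" if "z \<in> Z" for z using that Z sub by auto
      have "\<forall>\<^sub>F N in along \<N>. \<forall>z\<in>Z. \<forall>z'\<in>Z. poisson_sum N \<eta> z z' \<le> real N * (e / \<eta>)"
        by (intro eventually_ball_finite Z(1) ballI mix \<eta> Z0)
      moreover have "\<forall>\<^sub>F N in along \<N>. \<forall>z\<in>Z.
          c * (\<eta> / 2) * real N \<le> real (card (win N z (\<eta> / 2)))"
        using \<eta> e0 by (intro eventually_ball_finite Z(1) ballI count Z0) auto
      ultimately show ?thesis using eventually_along_mem
      proof eventually_elim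
        case (elim N)
        show ?case
        proof (intro ballI)
          fix E1 E2 assume E: "E1 \<in> {l..u}" "E2 \<in> {l..u}"
          obtain z where z: "z \<in> Z" "\<bar>E1 - z\<bar> \<le> \<eta> / 2" using bspec[OF net E(1)] by blast
          obtain z' where z': "z' \<in> Z" "\<bar>E2 - z'\<bar> \<le> \<eta> / 2" using bspec[OF net E(2)] by blast
          let ?A = "win N E1 \<eta>" and ?B = "win N E2 \<eta>"
          have "(\<Sum>i\<in>?A. \<Sum>j\<in>?B. obs N (centred N) j i)
              \<le> 16 * \<eta>\<^sup>2 * poisson_sum N \<eta> z z'"
            by (rule window_sum_le[OF \<eta>(1)]) (use z(2) z'(2) in \<open>auto simp: spec_window_def abs_real_def split: if_splits\<close>)
          also have "\<dots> \<le> 16 * \<eta>\<^sup>2 * (real N * (e / \<eta>))"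
            using elim(1) z(1) z'(1) by (intro mult_left_mono) auto
          also have "\<dots> = d * (c * (\<eta> / 2) * real N)"
            using \<eta> by (simp add: e_def power2_eq_square)
          also have "\<dots> \<le> d * real (card ?A)"
          proof (intro mult_left_mono)
            have "win N z (\<eta> / 2) \<subseteq> ?A"
              using z(2) by (auto simp: spec_window_def abs_real_def split: if_splits)
            then have "card (win N z (\<eta> / 2)) \<le> card ?A"
              by (rule card_mono[rotated]) (simp add: spec_window_def)
            then show "c * (\<eta> / 2) * real N \<le> real (card ?A)" using elim(2) z(1) by fastforce
          qed (use d in simp)
          finally have le: "(\<Sum>i\<in>?A. \<Sum>j\<in>?B. obs N (centred N) j i) \<le> d * real (card ?A)" .
          show "Q \<eta> N E1 E2 \<le> d"
          proof (cases "card ?A = 0")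
            case True
            then show ?thesis using d by (simp add: Q_def)
          next
            case False
            then show ?thesis using le by (simp add: Q_def field_simps)
          qed
        qed
      qed
    qed
    then show ?thesis unfolding eventually_at_right_field using e0(1) by blast
  qed
  have "((\<lambda>\<eta>. Limsup (along \<N>) (\<lambda>N. SUP (E1, E2)\<in>interior {l..u} \<times> interior {l..u}. ennreal (Q \<eta> N E1 E2)))
      \<longlongrightarrow> 0) (at_right 0)"
  proof (rule order_tendstoI)
    fix x :: ennreal assume "0 < x"
    then obtain y where y: "0 < y" "y < x" using dense by blast
    have yfin: "y < Orderings.top" by (rule order_less_le_trans[OF y(2) top_greatest])
    define d where "d = enn2real y"
    have d: "d > 0" "ennreal d = y" using y yfin by (auto simp: d_def enn2real_positive_iff)
    from small[OF d(1)]
    show "\<forall>\<^sub>F \<eta> in at_right 0. Limsup (along \<N>) (\<lambda>N. SUP (E1, E2)\<in>interior {l..u} \<times> interior {l..u}.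
        ennreal (Q \<eta> N E1 E2)) < x"
    proof eventually_elim
      case (elim \<eta>)
      have "Limsup (along \<N>) (\<lambda>N. SUP (E1, E2)\<in>interior {l..u} \<times> interior {l..u}. ennreal (Q \<eta> N E1 E2)) \<le> ennreal d"
      proof (rule Limsup_bounded)
        from elim show "\<forall>\<^sub>F N in along \<N>. (SUP (E1, E2)\<in>interior {l..u} \<times> interior {l..u}. ennreal (Q \<eta> N E1 E2)) \<le> ennreal d"
        proof eventually_elim
          case (elim N)
          have "interior {l..u} \<subseteq> {l..u}" by (rule interior_subset)
          with elim show ?case by (intro SUP_least) (auto intro!: ennreal_leI)
        qed
      qed
      then show ?case using d y by simp
    qed
  qed simp
  then show ?thesis
    unfolding quantum_mixing_def mat_elem_centred Q_def .
qed

text \<open>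
  The interval is covered by \<open>O(1 / \<eta>)\<close> windows. The contribution of each of them to the double sum is
  \<open>o(\<eta> N)\<close>, while the number of eigenvalues in the interval is of order \<open>N\<close>.
\<close>

lemma quantum_ergodicity_on:
  assumes lu: "l < u" and sub: "{l..u} \<subseteq> I\<^sub>0"
  shows "quantum_ergodicity \<N> \<rho> \<phi> \<mu> T K {l..u}"
proof -
  obtain c where c: "c > 0" and count: "\<And>E \<eta>. E \<in> I\<^sub>0 \<Longrightarrow> 0 < \<eta> \<Longrightarrow> \<eta> \<le> 1 \<Longrightarrow>
    \<forall>\<^sub>F N in along \<N>. c * \<eta> * real N \<le> real (card (win N E \<eta>))"
    using window_count_lower by blast
  \<comment> \<open>a fixed window inside the interval shows that the interval contains at least \<open>c h N\<close> eigenvalues\<close>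
  define h where "h = min 1 ((u - l) / 2)"
  have h: "0 < h" "h \<le> 1" "h \<le> (u - l) / 2" using lu unfolding h_def by (simp, simp, intro min.cobounded2)
  define w where "w = (l + u) / 2"
  have w: "w \<in> I\<^sub>0" "{w - h..w + h} \<subseteq> {l..u}" using h sub lu by (auto simp: w_def field_simps)
  let ?W = "\<lambda>N. spec_window N (\<mu> N) {l..u}"
  have cnt: "\<forall>\<^sub>F N in along \<N>. c * h * real N \<le> real (card (?W N))"
    using count[OF w(1) h(1,2)]
  proof eventually_elim
    case (elim N)
    have "card (win N w h) \<le> card (?W N)"
      by (rule card_mono) (use w(2) in \<open>auto simp: spec_window_def\<close>)
    then show ?case using elim by linarith
  qed
  define b where "b = 16 * (2 * (u - l) + 1)"
  have b: "b > 0" using lu by (simp add: b_def)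
  have small: "\<forall>\<^sub>F N in along \<N>. (1 / real (card (?W N))) * (\<Sum>i\<in>?W N. obs N (centred N) i i) \<le> d"
    if d: "d > 0" for d
  proof -
    define e where "e = d * (c * h) / b"
    have e: "e > 0" using d c h b by (simp add: e_def)
    obtain \<eta>0 where e0: "\<eta>0 > 0" "\<eta>0 \<le> 1" and mix: "\<And>\<eta> E1 E2. 0 < \<eta> \<Longrightarrow> \<eta> < \<eta>0 \<Longrightarrow> E1 \<in> I\<^sub>0 \<Longrightarrow> E2 \<in> I\<^sub>0 \<Longrightarrow>
      \<forall>\<^sub>F N in along \<N>. poisson_sum N \<eta> E1 E2
        \<le> real N * (e / \<eta>)"
      using poisson_mixing_small[OF e] by blast
    define \<eta> where "\<eta> = \<eta>0 / 2"
    have \<eta>: "0 < \<eta>" "\<eta> < \<eta>0" "\<eta> \<le> 1" using e0 by (auto simp: \<eta>_def)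
    obtain Z where Z: "finite Z" "Z \<subseteq> {l..u}" "real (card Z) \<le> 2 * (u - l) / \<eta> + 1"
      and net: "\<forall>E\<in>{l..u}. \<exists>z\<in>Z. \<bar>E - z\<bar> \<le> \<eta> / 2"
      using finite_net[OF \<eta>(1) lu] by (elim exE conjE) (rule that)
    have Z0: "z \<in> I\<^sub>0" if "z \<in> Z" for z using that Z sub by auto
    have "\<forall>\<^sub>F N in along \<N>. \<forall>z\<in>Z. poisson_sum N \<eta> z z \<le> real N * (e / \<eta>)"
      by (intro eventually_ball_finite Z(1) ballI mix \<eta> Z0)
    with cnt show ?thesis
    proof eventually_elim
      case (elim N)
      let ?A = "\<lambda>z. {i \<in> {1..N}. \<bar>\<mu> N i - z\<bar> \<le> \<eta> / 2}"
      have one: "(\<Sum>i\<in>?A z. obs N (centred N) i i) \<le> 16 * \<eta> * e * real N" if z: "z \<in> Z" for z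
      proof -
        have "(\<Sum>i\<in>?A z. obs N (centred N) i i) \<le> (\<Sum>i\<in>?A z. \<Sum>j\<in>?A z. obs N (centred N) j i)"
          by (intro sum_mono member_le_sum[of _ _ "\<lambda>j. obs N (centred N) j _"]) auto
        also have "\<dots> \<le> 16 * \<eta>\<^sup>2 * poisson_sum N \<eta> z z"
          by (rule window_sum_le[OF \<eta>(1)]) (use \<eta>(1) in auto)
        also have "\<dots> \<le> 16 * \<eta>\<^sup>2 * (real N * (e / \<eta>))"
          using elim(2) z by (intro mult_left_mono) auto
        also have "\<dots> = 16 * \<eta> * e * real N" using \<eta> by (simp add: power2_eq_square)
        finally show ?thesis .
      qed
      have "\<forall>i\<in>?W N. \<exists>z\<in>Z. \<bar>\<mu> N i - z\<bar> \<le> \<eta> / 2"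
        using net unfolding spec_window_def by blast
      then obtain \<zeta> where \<zeta>: "\<forall>i\<in>?W N. \<zeta> i \<in> Z \<and> \<bar>\<mu> N i - \<zeta> i\<bar> \<le> \<eta> / 2"
        unfolding Bex_def using bchoice by metis
      have fW: "finite (?W N)" "?W N \<subseteq> {1..N}" by (auto simp: spec_window_def)
      have "(\<Sum>i\<in>?W N. obs N (centred N) i i)
          = (\<Sum>z\<in>Z. \<Sum>i\<in>{i \<in> ?W N. \<zeta> i = z}. obs N (centred N) i i)"
        by (rule sum.group[symmetric]) (use fW Z(1) \<zeta> in auto)
      also have "\<dots> \<le> (\<Sum>z\<in>Z. \<Sum>i\<in>?A z. obs N (centred N) i i)"
        by (intro sum_mono sum_mono2) (use fW \<zeta> in auto)
      also have "\<dots> \<le> (\<Sum>z\<in>Z. 16 * \<eta> * e * real N)" by (intro sum_mono one)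
      also have "\<dots> = (real (card Z) * \<eta>) * (16 * e * real N)" by simp
      also have "\<dots> \<le> (2 * (u - l) + 1) * (16 * e * real N)"
      proof (intro mult_right_mono)
        have "real (card Z) * \<eta> \<le> (2 * (u - l) / \<eta> + 1) * \<eta>" using Z(3) \<eta> by (intro mult_right_mono) auto
        also have "\<dots> \<le> 2 * (u - l) + 1" using \<eta> by (simp add: distrib_right)
        finally show "real (card Z) * \<eta> \<le> 2 * (u - l) + 1" .
      qed (use e in auto)
      also have "\<dots> = d * (c * h * real N)" using b by (simp add: e_def b_def field_simps)
      also have "\<dots> \<le> d * real (card (?W N))" using elim(1) d by (intro mult_left_mono) auto
      finally have le: "(\<Sum>i\<in>?W N. obs N (centred N) i i) \<le> d * real (card (?W N))" .
      show ?case
      proof (cases "card (?W N) = 0")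
        case False
        then show ?thesis using le by (simp add: field_simps)
      qed (use d in simp)
    qed
  qed
  have "((\<lambda>N. (1 / real (card (?W N))) * (\<Sum>i\<in>?W N. obs N (centred N) i i)) \<longlongrightarrow> 0) (along \<N>)"
  proof (rule tendstoI)
    fix d :: real assume "d > 0"
    then have "d / 2 > 0" by simp
    from small[OF this]
    show "\<forall>\<^sub>F N in along \<N>. dist ((1 / real (card (?W N))) * (\<Sum>i\<in>?W N. obs N (centred N) i i)) 0 < d"
    proof eventually_elim
      case (elim N)
      have nn: "0 \<le> (1 / real (card (?W N))) * (\<Sum>i\<in>?W N. obs N (centred N) i i)"
        by (intro mult_nonneg_nonneg sum_nonneg) auto
      show ?case unfolding dist_norm diff_zero real_norm_def abs_of_nonneg[OF nn]
        by (rule le_less_trans[OF elim]) (use \<open>d > 0\<close> in simp)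
    qed
  qed
  then show ?thesis
    unfolding quantum_ergodicity_def mat_elem_centred .
qed

end

theorem theorem1p7:
  fixes G :: "('g, 'm) monoid_scheme"
    and S T :: "'g set"
    and p :: "'g \<Rightarrow> complex"
    and C\<^sub>1 a\<^sub>0 b\<^sub>0 a b :: real
    and I\<^sub>0 I :: "real set"
    and \<N> :: "nat set"
    and \<rho> :: "nat \<Rightarrow> 'g \<Rightarrow> nat \<Rightarrow> nat"
    and \<phi> K :: "nat \<Rightarrow> nat \<Rightarrow> nat \<Rightarrow> complex"
    and \<mu> :: "nat \<Rightarrow> nat \<Rightarrow> real"
  assumes "group G"
    and "fin_gen_set G S"
    and "rapid_decay G C\<^sub>1"
    and "infinite \<N>" and "0 \<notin> \<N>"
    and "\<forall>N\<in>\<N>. \<rho> N \<in> hom G (sym_group N)"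
    and "converges_strongly_in_distribution G \<N> \<rho>"
    and "p \<in> group_algebra G" and "p = galg_star G p"
    and "I\<^sub>0 = {a\<^sub>0..b\<^sub>0}"
    and "cond_AC G p I\<^sub>0"
    and "cond_R4 G S C\<^sub>1 p I\<^sub>0"
    and "I = {a..b}" and "a < b" and "I \<subseteq> interior I\<^sub>0"
    and "\<forall>N\<in>\<N>. orthonormal_eigenbasis N (rep_mat (\<rho> N) p) (\<phi> N) (\<mu> N)"
    and "finite T" and "T \<subseteq> carrier G"
    and "\<forall>N\<in>\<N>. is_local N (\<rho> N) T (K N)"
    and "\<forall>N\<in>\<N>. norm_1_inf N (K N) \<le> 1"
  shows "quantum_ergodicity \<N> \<rho> \<phi> \<mu> T K I \<and> quantum_mixing \<N> \<rho> \<phi> \<mu> T K I"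
proof -
  interpret group G by fact
  interpret spectral_sequence G p \<N> \<rho> \<phi> K \<mu> T S C\<^sub>1 I\<^sub>0
    by unfold_locales (use assms in auto)
  have "{a..b} \<subseteq> I\<^sub>0" using assms(13,15) interior_subset by blast
  then show ?thesis
    using quantum_ergodicity_on quantum_mixing_on assms(13,14) by simp
qed

end
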